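(* Every (topological) CW complex is homotopy equivalent, in the category $\mathsf{NG}$ of numerically generated topological spaces, to a smooth CW complex; that is, for every CW complex $Y$ there exist a smooth CW complex $X$ and a homotopy equivalence $Y\to D(X)$ in $\mathsf{NG}$.
   Context: A diffeological space is a set $X$ together with, for every $n\ge 0$ and every open set $U\subset\mathbb{R}^n$, a set of maps $U\to X$ (called plots), such that: all constant maps are plots; if $P:U\to X$ is a plot and $\phi:V\to U$ is a smooth map between open subsets of Euclidean spaces, then $P\circ\phi$ is a plot; and if $P:U\to X$ is a map and $U$ has an open covering $\{U_\alpha\}$ with every $P|_{U_\alpha}$ a plot, then $P$ is a plot. A map $f:X\to Y$ of diffeological spaces is smooth if $f\circ P$ is a plot of $Y$ for every plot $P$ of $X$. The category $\mathsf{Diffeology}$ of diffeological spaces and smooth maps is complete and cocomplete. Spheres $S^n$ and closed disks $D^{n+1}$ carry their standard diffeologies as subsets of $\mathbb{R}^{n+1}$ (plots are the maps that are smooth as maps into $\mathbb{R}^{n+1}$). The $D$-topology of a diffeological space $X$ is the finest topology making all plots continuous; $D(X)$ denotes $X$ with this topology. A smooth CW complex $X$ is the colimit in $\mathsf{Diffeology}$ of skeleta $\{X_n\}_{n\ge0}$ defined inductively: $X_0$ is a discrete set with the discrete diffeology; for each $n\ge0$ there is a smooth attaching map $h_n: S_n=\coprod_\alpha S^n_\alpha\to X_n$ from a disjoint union of $n$-spheres, and $X_{n+1}=X_n\cup_{h_n}\coprod_\alpha D^{n+1}_\alpha$ is the pushout in $\mathsf{Diffeology}$ of $h_n$ and the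 natural inclusion $S_n\hookrightarrow\coprod_\alpha D^{n+1}_\alpha$. $\mathsf{NG}$ is the full subcategory of topological spaces consisting of the numerically generated spaces, i.e. spaces whose topology is the final topology with respect to all continuous maps into them from open subsets of Euclidean spaces; it contains all CW complexes and all spaces $D(X)$. Homotopy equivalence in $\mathsf{NG}$ is meant in the usual topological sense (continuous maps and continuous homotopies). *)

theory Defs
  imports "HOL-Analysis.Analysis"
begin

section \<open>Smooth maps between open subsets of Euclidean spaces\<close>

text \<open>
  \<open>\<real>\<^sup>n\<close> is the library's \<^const>\<open>Euclidean_space\<close> \<open>n\<close>: the functions \<open>nat \<Rightarrow> real\<close> that vanish at
  all indices \<open>\<ge> n\<close>. This makes the dimension an ordinary natural number.
  A function is \<open>C\<^sup>k\<^sup>+\<^sup>1\<close> on an open set if it is continuous and all of its first-order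
  partial derivatives exist there and are \<open>C\<^sup>k\<close>.
\<close>

primrec Ck_fun :: "nat \<Rightarrow> nat \<Rightarrow> (nat \<Rightarrow> real) set \<Rightarrow> ((nat \<Rightarrow> real) \<Rightarrow> real) \<Rightarrow> bool" where
  "Ck_fun 0 n U f \<longleftrightarrow> continuous_map (subtopology (Euclidean_space n) U) euclideanreal f"
| "Ck_fun (Suc k) n U f \<longleftrightarrow>
     continuous_map (subtopology (Euclidean_space n) U) euclideanreal f \<and>
     (\<forall>i<n. \<exists>g. Ck_fun k n U g \<and>
        (\<forall>x\<in>U. ((\<lambda>t. f (x(i := t))) has_real_derivative g x) (at (x i))))"

definition smooth_fun :: "nat \<Rightarrow> (nat \<Rightarrow> real) set \<Rightarrow> ((nat \<Rightarrow> real) \<Rightarrow> real) \<Rightarrow> bool" where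
  "smooth_fun n U f \<longleftrightarrow> (\<forall>k. Ck_fun k n U f)"

definition euclidean_smooth ::
  "nat \<Rightarrow> (nat \<Rightarrow> real) set \<Rightarrow> nat \<Rightarrow> (nat \<Rightarrow> real) set \<Rightarrow> ((nat \<Rightarrow> real) \<Rightarrow> nat \<Rightarrow> real) \<Rightarrow> bool" where
  "euclidean_smooth m V n U \<phi> \<longleftrightarrow>
     openin (Euclidean_space m) V \<and> openin (Euclidean_space n) U \<and>
     \<phi> \<in> V \<rightarrow> U \<and> (\<forall>i<n. smooth_fun m V (\<lambda>v. \<phi> v i))"


section \<open>Diffeological spaces\<close>

text \<open>
  \<open>plot X n U P\<close> says that the restriction of \<open>P\<close> to \<open>U \<subseteq> \<real>\<^sup>n\<close> is a plot of \<open>X\<close>; the values of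
  \<open>P\<close> outside \<open>U\<close> are irrelevant (second axiom below).
\<close>

record 'a diffeology =
  points :: "'a set"
  plot :: "nat \<Rightarrow> (nat \<Rightarrow> real) set \<Rightarrow> ((nat \<Rightarrow> real) \<Rightarrow> 'a) \<Rightarrow> bool"

definition diffeological_space :: "'a diffeology \<Rightarrow> bool" where
  "diffeological_space X \<longleftrightarrow>
     (\<forall>n U P. plot X n U P \<longrightarrow> openin (Euclidean_space n) U \<and> P \<in> U \<rightarrow> points X) \<and>
     (\<forall>n U P Q. plot X n U P \<and> (\<forall>u\<in>U. P u = Q u) \<longrightarrow> plot X n U Q) \<and>
     (\<forall>n U x. openin (Euclidean_space n) U \<and> x \<in> points X \<longrightarrow> plot X n U (\<lambda>_. x)) \<and>
     (\<forall>n U P m V \<phi>. plot X n U P \<and> euclidean_smooth m V n U \<phi> \<longrightarrow> plot X m V (P \<circ> \<phi>)) \<and>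
     (\<forall>n P \<U>. (\<forall>W\<in>\<U>. openin (Euclidean_space n) W \<and> plot X n W P) \<longrightarrow> plot X n (\<Union>\<U>) P)"

definition smooth_map :: "'a diffeology \<Rightarrow> 'b diffeology \<Rightarrow> ('a \<Rightarrow> 'b) \<Rightarrow> bool" where
  "smooth_map X Y f \<longleftrightarrow>
     f \<in> points X \<rightarrow> points Y \<and> (\<forall>n U P. plot X n U P \<longrightarrow> plot Y n U (f \<circ> P))"

definition discrete_diffeology :: "'a set \<Rightarrow> 'a diffeology" where
  "discrete_diffeology S =
     \<lparr>points = S,
      plot = (\<lambda>n U P. openin (Euclidean_space n) U \<and> P \<in> U \<rightarrow> S \<and>
        (\<forall>u\<in>U. \<exists>W. openin (Euclidean_space n) W \<and> u \<in> W \<and> W \<subseteq> U \<and> (\<forall>w\<in>W. P w = P u)))\<rparr>"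

text \<open>The standard diffeology of a subset \<open>A\<close> of \<open>\<real>\<^sup>n\<close>.\<close>

definition subset_diffeology :: "nat \<Rightarrow> (nat \<Rightarrow> real) set \<Rightarrow> (nat \<Rightarrow> real) diffeology" where
  "subset_diffeology n A =
     \<lparr>points = A,
      plot = (\<lambda>m U P. openin (Euclidean_space m) U \<and> P \<in> U \<rightarrow> A \<and>
        (\<forall>i<n. smooth_fun m U (\<lambda>u. P u i)))\<rparr>"

text \<open>
  The finest diffeology on \<open>S\<close> for which all members of \<open>G\<close> are plots, i.e. the intersection
  of all such diffeologies. Colimits in the category of diffeological spaces are the colimits of
  the underlying sets, equipped with the diffeology generated by the images of the plots of the
  constituents; see the universal properties proved below.
\<close>

definition generated_diffeology ::
  "'a set \<Rightarrow> (nat \<times> (nat \<Rightarrow> real) set \<times> ((nat \<Rightarrow> real) \<Rightarrow> 'a)) set \<Rightarrow> 'a diffeology" where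
  "generated_diffeology S G =
     \<lparr>points = S,
      plot = (\<lambda>n U P. openin (Euclidean_space n) U \<and> P \<in> U \<rightarrow> S \<and>
        (\<forall>E. diffeological_space E \<and> points E = S \<and> (\<forall>(m, V, Q)\<in>G. plot E m V Q)
              \<longrightarrow> plot E n U P))\<rparr>"

definition coproduct_diffeology :: "('i \<Rightarrow> 'a diffeology) \<Rightarrow> 'i set \<Rightarrow> ('i \<times> 'a) diffeology" where
  "coproduct_diffeology Z I =
     generated_diffeology (Sigma I (\<lambda>\<alpha>. points (Z \<alpha>)))
       {(n, U, \<lambda>u. (\<alpha>, P u)) | n U P \<alpha>. \<alpha> \<in> I \<and> plot (Z \<alpha>) n U P}"

text \<open>
  \<open>Z\<close> with \<open>p : A \<rightarrow> Z\<close> and \<open>q : B \<rightarrow> Z\<close> is a pushout of sets of \<open>f : C \<rightarrow> A\<close> and \<open>g : C \<rightarrow> B\<close>: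
  it is the quotient of the disjoint union of \<open>A\<close> and \<open>B\<close> by the equivalence relation generated
  by \<open>f c \<sim> g c\<close>.
\<close>

definition set_pushout ::
  "'c set \<Rightarrow> 'a set \<Rightarrow> 'b set \<Rightarrow> ('c \<Rightarrow> 'a) \<Rightarrow> ('c \<Rightarrow> 'b) \<Rightarrow> 'z set \<Rightarrow> ('a \<Rightarrow> 'z) \<Rightarrow> ('b \<Rightarrow> 'z) \<Rightarrow> bool"
  where
  "set_pushout C A B f g Z p q \<longleftrightarrow>
     (let R = {(Inl (f c), Inr (g c)) | c. c \<in> C} in
      Z = case_sum p q ` (A <+> B) \<and>
      (\<forall>x\<in>A <+> B. \<forall>y\<in>A <+> B. case_sum p q x = case_sum p q y \<longleftrightarrow> (x, y) \<in> (R \<union> R\<inverse>)\<^sup>*))"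

definition diffeological_pushout ::
  "'c diffeology \<Rightarrow> 'a diffeology \<Rightarrow> 'b diffeology \<Rightarrow> ('c \<Rightarrow> 'a) \<Rightarrow> ('c \<Rightarrow> 'b) \<Rightarrow>
   'z diffeology \<Rightarrow> ('a \<Rightarrow> 'z) \<Rightarrow> ('b \<Rightarrow> 'z) \<Rightarrow> bool" where
  "diffeological_pushout C A B f g Z p q \<longleftrightarrow>
     set_pushout (points C) (points A) (points B) f g (points Z) p q \<and>
     Z = generated_diffeology (points Z)
           ({(n, U, p \<circ> P) | n U P. plot A n U P} \<union> {(n, U, q \<circ> P) | n U P. plot B n U P})"

text \<open>The colimit of a sequence of inclusions.\<close>

definition union_diffeology :: "(nat \<Rightarrow> 'a diffeology) \<Rightarrow> 'a diffeology" where
  "union_diffeology Xs =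
     generated_diffeology (\<Union>k. points (Xs k)) {(n, U, P) | n U P. \<exists>k. plot (Xs k) n U P}"


section \<open>The D-topology\<close>

definition D_topology :: "'a diffeology \<Rightarrow> 'a topology" where
  "D_topology X = topology (\<lambda>W. W \<subseteq> points X \<and>
     (\<forall>n U P. plot X n U P \<longrightarrow> openin (Euclidean_space n) {u \<in> U. P u \<in> W}))"


section \<open>Smooth and topological CW complexes\<close>

definition unit_disk :: "nat \<Rightarrow> (nat \<Rightarrow> real) set" where
  "unit_disk n = {x \<in> topspace (Euclidean_space n). (\<Sum>i<n. (x i)\<^sup>2) \<le> 1}"

abbreviation smooth_sphere :: "nat \<Rightarrow> (nat \<Rightarrow> real) diffeology" where
  "smooth_sphere n \<equiv> subset_diffeology (Suc n) (topspace (nsphere n))"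

abbreviation smooth_disk :: "nat \<Rightarrow> (nat \<Rightarrow> real) diffeology" where
  "smooth_disk n \<equiv> subset_diffeology n (unit_disk n)"

text \<open>
  The skeleta are taken to be subsets \<open>X\<^sub>0 \<subseteq> X\<^sub>1 \<subseteq> \<dots>\<close> of the complex, so that the maps
  \<open>X\<^sub>n \<rightarrow> X\<^sub>n\<^sub>+\<^sub>1\<close> of the pushout squares are inclusions; but each skeleton carries its own
  diffeology (topology), namely that of the pushout. The set \<open>I n\<close> indexes the \<open>(n+1)\<close>-cells,
  with attaching maps \<open>h n\<close> and characteristic maps \<open>\<Phi> n\<close>. The type argument is only the type
  from which these index sets are drawn.
\<close>

definition smooth_CW_complex :: "'i itself \<Rightarrow> 'a diffeology \<Rightarrow> bool" where
  "smooth_CW_complex _ X \<longleftrightarrow>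
     (\<exists>(Xs :: nat \<Rightarrow> 'a diffeology) (I :: nat \<Rightarrow> 'i set) h \<Phi>.
        Xs 0 = discrete_diffeology (points (Xs 0)) \<and>
        (\<forall>n. smooth_map (coproduct_diffeology (\<lambda>_. smooth_sphere n) (I n)) (Xs n) (h n) \<and>
             diffeological_pushout
               (coproduct_diffeology (\<lambda>_. smooth_sphere n) (I n))
               (Xs n)
               (coproduct_diffeology (\<lambda>_. smooth_disk (Suc n)) (I n))
               (h n) (\<lambda>x. x) (Xs (Suc n)) (\<lambda>x. x) (\<Phi> n)) \<and>
        X = union_diffeology Xs)"

definition topological_pushout ::
  "'c topology \<Rightarrow> 'a topology \<Rightarrow> 'b topology \<Rightarrow> ('c \<Rightarrow> 'a) \<Rightarrow> ('c \<Rightarrow> 'b) \<Rightarrow>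
   'z topology \<Rightarrow> ('a \<Rightarrow> 'z) \<Rightarrow> ('b \<Rightarrow> 'z) \<Rightarrow> bool" where
  "topological_pushout C A B f g Z p q \<longleftrightarrow>
     set_pushout (topspace C) (topspace A) (topspace B) f g (topspace Z) p q \<and>
     (\<forall>W. openin Z W \<longleftrightarrow>
        W \<subseteq> topspace Z \<and>
        openin A {a \<in> topspace A. p a \<in> W} \<and> openin B {b \<in> topspace B. q b \<in> W})"

definition CW_complex :: "'i itself \<Rightarrow> 'a topology \<Rightarrow> bool" where
  "CW_complex _ Y \<longleftrightarrow>
     (\<exists>(Ys :: nat \<Rightarrow> 'a topology) (I :: nat \<Rightarrow> 'i set) h \<Phi>.
        Ys 0 = discrete_topology (topspace (Ys 0)) \<and>
        (\<forall>n. continuous_map (sum_topology (\<lambda>_. nsphere n) (I n)) (Ys n) (h n) \<and>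
             topological_pushout
               (sum_topology (\<lambda>_. nsphere n) (I n))
               (Ys n)
               (sum_topology (\<lambda>_. subtopology (Euclidean_space (Suc n)) (unit_disk (Suc n))) (I n))
               (h n) (\<lambda>x. x) (Ys (Suc n)) (\<lambda>x. x) (\<Phi> n)) \<and>
        topspace Y = (\<Union>n. topspace (Ys n)) \<and>
        (\<forall>W. openin Y W \<longleftrightarrow>
           W \<subseteq> topspace Y \<and> (\<forall>n. openin (Ys n) {y \<in> topspace (Ys n). y \<in> W})))"


section \<open>Numerically generated spaces\<close>

definition numerically_generated :: "'a topology \<Rightarrow> bool" where
  "numerically_generated X \<longleftrightarrow>
     (\<forall>W. openin X W \<longleftrightarrow>
        W \<subseteq> topspace X \<and>
        (\<forall>n U g. openin (Euclidean_space n) U \<and>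
                 continuous_map (subtopology (Euclidean_space n) U) X g
                 \<longrightarrow> openin (Euclidean_space n) {u \<in> U. g u \<in> W}))"

definition NG_homotopy_equivalent :: "'a topology \<Rightarrow> 'b topology \<Rightarrow> bool" where
  "NG_homotopy_equivalent X Y \<longleftrightarrow>
     numerically_generated X \<and> numerically_generated Y \<and> X homotopy_equivalent_space Y"


section \<open>Basic properties\<close>

lemma openin_D_topology:
  assumes "diffeological_space X"
  shows "openin (D_topology X) W \<longleftrightarrow> W \<subseteq> points X \<and>
     (\<forall>n U P. plot X n U P \<longrightarrow> openin (Euclidean_space n) {u \<in> U. P u \<in> W})"
proof -
  have "istopology (\<lambda>W. W \<subseteq> points X \<and>
     (\<forall>n U P. plot X n U P \<longrightarrow> openin (Euclidean_space n) {u \<in> U. P u \<in> W}))"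
    unfolding istopology_def
  proof (intro conjI allI impI; (elim conjE)?)
    fix S T n U P
    assume "\<forall>n U P. plot X n U P \<longrightarrow> openin (Euclidean_space n) {u \<in> U. P u \<in> S}"
      and "\<forall>n U P. plot X n U P \<longrightarrow> openin (Euclidean_space n) {u \<in> U. P u \<in> T}"
      and "plot X n U P"
    then have "openin (Euclidean_space n) ({u \<in> U. P u \<in> S} \<inter> {u \<in> U. P u \<in> T})"
      by (intro openin_Int) auto
    moreover have "{u \<in> U. P u \<in> S} \<inter> {u \<in> U. P u \<in> T} = {u \<in> U. P u \<in> S \<inter> T}"
      by auto
    ultimately show "openin (Euclidean_space n) {u \<in> U. P u \<in> S \<inter> T}"
      by simp
  next
    fix \<K> n U P
    assume \<K>: "\<forall>W\<in>\<K>. W \<subseteq> points X \<and>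
        (\<forall>n U P. plot X n U P \<longrightarrow> openin (Euclidean_space n) {u \<in> U. P u \<in> W})"
      and "plot X n U P"
    then have "openin (Euclidean_space n) (\<Union>W\<in>\<K>. {u \<in> U. P u \<in> W})"
      by (intro openin_Union) auto
    moreover have "(\<Union>W\<in>\<K>. {u \<in> U. P u \<in> W}) = {u \<in> U. P u \<in> \<Union>\<K>}"
      by auto
    ultimately show "openin (Euclidean_space n) {u \<in> U. P u \<in> \<Union>\<K>}"
      by simp
  qed auto
  then show ?thesis
    by (simp add: D_topology_def topology_inverse')
qed

lemma points_generated_diffeology [simp]: "points (generated_diffeology S G) = S"
  by (simp add: generated_diffeology_def)

lemma
  assumes "diffeological_space X"
  shows plot_openin: "plot X n U P \<Longrightarrow> openin (Euclidean_space n) U"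
    and plot_funcset: "plot X n U P \<Longrightarrow> P \<in> U \<rightarrow> points X"
    and plot_cong: "plot X n U P \<Longrightarrow> (\<And>u. u \<in> U \<Longrightarrow> P u = Q u) \<Longrightarrow> plot X n U Q"
    and plot_const: "openin (Euclidean_space n) U \<Longrightarrow> x \<in> points X \<Longrightarrow> plot X n U (\<lambda>_. x)"
    and plot_comp: "plot X n U P \<Longrightarrow> euclidean_smooth m V n U \<phi> \<Longrightarrow> plot X m V (P \<circ> \<phi>)"
    and plot_cover: "(\<And>W. W \<in> \<U> \<Longrightarrow> openin (Euclidean_space n) W \<and> plot X n W P) \<Longrightarrow> plot X n (\<Union>\<U>) P"
  using assms unfolding diffeological_space_def by metis+

lemma plot_generated_diffeology:
  "plot (generated_diffeology S G) n U P \<longleftrightarrow>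
     openin (Euclidean_space n) U \<and> P \<in> U \<rightarrow> S \<and>
     (\<forall>E. diffeological_space E \<and> points E = S \<and> (\<forall>(m, V, Q)\<in>G. plot E m V Q) \<longrightarrow> plot E n U P)"
  by (simp add: generated_diffeology_def)

lemma diffeological_space_generated: "diffeological_space (generated_diffeology S G)"
  unfolding diffeological_space_def[of "generated_diffeology S G"]
proof (intro conjI allI impI; (elim conjE)?)
  fix n U P Q assume P: "plot (generated_diffeology S G) n U P" and eq: "\<forall>u\<in>U. P u = Q u"
  then have "Q \<in> U \<rightarrow> S"
    by (auto simp: plot_generated_diffeology Pi_iff)
  with P eq show "plot (generated_diffeology S G) n U Q"
    unfolding plot_generated_diffeology by (blast intro: plot_cong)
next
  fix n U x assume "openin (Euclidean_space n) U" "x \<in> points (generated_diffeology S G)"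
  then show "plot (generated_diffeology S G) n U (\<lambda>_. x)"
    by (auto simp: plot_generated_diffeology plot_const)
next
  fix n U P m V \<phi>
  assume P: "plot (generated_diffeology S G) n U P" and \<phi>: "euclidean_smooth m V n U \<phi>"
  then have "P \<circ> \<phi> \<in> V \<rightarrow> S" "openin (Euclidean_space m) V"
    by (auto simp: plot_generated_diffeology euclidean_smooth_def Pi_iff)
  then show "plot (generated_diffeology S G) m V (P \<circ> \<phi>)"
    using P plot_comp[OF _ _ \<phi>] unfolding plot_generated_diffeology by blast
next
  fix n P \<U>
  assume *: "\<forall>W\<in>\<U>. openin (Euclidean_space n) W \<and> plot (generated_diffeology S G) n W P"
  show "plot (generated_diffeology S G) n (\<Union>\<U>) P"
    unfolding plot_generated_diffeology
  proof (intro conjI allI impI)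
    show "openin (Euclidean_space n) (\<Union>\<U>)" "P \<in> \<Union>\<U> \<rightarrow> S"
      using * by (auto simp: plot_generated_diffeology)
  next
    fix E assume E: "diffeological_space E \<and> points E = S \<and> (\<forall>(m, V, Q)\<in>G. plot E m V Q)"
    then have "plot E n W P" if "W \<in> \<U>" for W
      using * that unfolding plot_generated_diffeology by blast
    with E * show "plot E n (\<Union>\<U>) P"
      by (simp add: plot_cover)
  qed
qed (auto simp: plot_generated_diffeology)

text \<open>Universal property of the generated diffeology.\<close>

lemma smooth_map_generated:
  assumes W: "diffeological_space W" and t: "t \<in> S \<rightarrow> points W"
    and G: "\<And>n U P. (n, U, P) \<in> G \<Longrightarrow> P \<in> U \<rightarrow> S \<and> plot W n U (t \<circ> P)"
  shows "smooth_map (generated_diffeology S G) W t"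
proof -
  define E where "E = \<lparr>points = S, plot = (\<lambda>n U P. P \<in> U \<rightarrow> S \<and> plot W n U (t \<circ> P))\<rparr>"
  note dom = plot_openin[OF W] and cong = plot_cong[OF W] and const = plot_const[OF W]
    and comp = plot_comp[OF W] and cover = plot_cover[OF W]
  have "diffeological_space E"
    unfolding diffeological_space_def
  proof (intro conjI allI impI; (elim conjE)?)
    fix n U P Q assume "plot E n U P" "\<forall>u\<in>U. P u = Q u"
    then show "plot E n U Q"
      using cong[of n U "t \<circ> P" "t \<circ> Q"] by (auto simp: E_def Pi_iff)
  next
    fix n U x assume "openin (Euclidean_space n) U" "x \<in> points E"
    then show "plot E n U (\<lambda>_. x)"
      using const[of n U "t x"] t by (auto simp: E_def o_def)
  next
    fix n U P m V \<phi> assume "plot E n U P" "euclidean_smooth m V n U \<phi>"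
    then show "plot E m V (P \<circ> \<phi>)"
      using comp[of n U "t \<circ> P" m V \<phi>] by (auto simp: E_def o_assoc euclidean_smooth_def Pi_iff)
  next
    fix n P \<U> assume "\<forall>V\<in>\<U>. openin (Euclidean_space n) V \<and> plot E n V P"
    then show "plot E n (\<Union>\<U>) P"
      using cover[of \<U> n "t \<circ> P"] by (auto simp: E_def)
  qed (auto simp: E_def dest: dom)
  moreover have "points E = S" "\<forall>(n, U, P)\<in>G. plot E n U P"
    using G by (auto simp: E_def)
  ultimately have "plot E n U P" if "plot (generated_diffeology S G) n U P" for n U P
    using that unfolding plot_generated_diffeology by blast
  then show ?thesis
    using t by (auto simp: smooth_map_def E_def)
qed

lemma diffeological_pushout_universal:
  assumes push: "diffeological_pushout C A B f g Z p q"
    and A: "diffeological_space (A :: 'a diffeology)"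
  and B: "diffeological_space (B :: 'b diffeology)" and W: "diffeological_space W"
    and u: "smooth_map A W u" and v: "smooth_map B W v"
    and eq: "\<And>c. c \<in> points C \<Longrightarrow> u (f c) = v (g c)"
  shows "\<exists>t. smooth_map Z W t \<and> (\<forall>a\<in>points A. t (p a) = u a) \<and> (\<forall>b\<in>points B. t (q b) = v b)"
proof -
  define R :: "('a + 'b) rel" where "R = {(Inl (f c), Inr (g c)) | c. c \<in> points C}"
  have sp: "points Z = case_sum p q ` (points A <+> points B) \<and>
      (\<forall>x\<in>points A <+> points B. \<forall>y\<in>points A <+> points B.
        case_sum p q x = case_sum p q y \<longleftrightarrow> (x, y) \<in> (R \<union> R\<inverse>)\<^sup>*)"
    using push[unfolded diffeological_pushout_def, THEN conjunct1]
    unfolding set_pushout_def Let_def R_def .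
  note Z = sp[THEN conjunct1]
  note ker = sp[THEN conjunct2, rule_format]
  have const: "case_sum u v x = case_sum u v y" if "(x, y) \<in> (R \<union> R\<inverse>)\<^sup>*" for x y
    using that
  proof (induction rule: rtrancl_induct)
    case (step y z)
    then show ?case
      unfolding R_def using eq by fastforce
  qed simp
  define s where "s z = (SOME x. x \<in> points A <+> points B \<and> case_sum p q x = z)" for z
  have s: "s z \<in> points A <+> points B \<and> case_sum p q (s z) = z" if "z \<in> points Z" for z
    unfolding s_def by (rule someI_ex) (use that[unfolded Z] in blast)
  define t where "t z = case_sum u v (s z)" for z
  have t: "t (case_sum p q x) = case_sum u v x" if x: "x \<in> points A <+> points B" for x
  proof -
    have "case_sum p q x \<in> points Z"
      unfolding Z using x by (rule imageI)
    note s[OF this]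
    then have "(s (case_sum p q x), x) \<in> (R \<union> R\<inverse>)\<^sup>*"
      using ker[of "s (case_sum p q x)" x] x by simp
    then show ?thesis
      unfolding t_def by (rule const)
  qed
  have tp: "t (p a) = u a" if "a \<in> points A" for a
    using t[of "Inl a"] that by auto
  have tq: "t (q b) = v b" if "b \<in> points B" for b
    using t[of "Inr b"] that by auto
  have pA: "p a \<in> points Z" if "a \<in> points A" for a
    unfolding Z by (rule image_eqI[of _ _ "Inl a"]) (use that in auto)
  have qB: "q b \<in> points Z" if "b \<in> points B" for b
    unfolding Z by (rule image_eqI[of _ _ "Inr b"]) (use that in auto)
  note plotA = plot_funcset[OF A] and plotB = plot_funcset[OF B] and cong = plot_cong[OF W]
  have "smooth_map (generated_diffeology (points Z)
      ({(n, U, p \<circ> P) | n U P. plot A n U P} \<union> {(n, U, q \<circ> P) | n U P. plot B n U P})) W t"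
  proof (rule smooth_map_generated[OF W])
    show "t \<in> points Z \<rightarrow> points W"
    proof
      fix z assume "z \<in> points Z"
      then obtain x where "x \<in> points A <+> points B" "z = case_sum p q x"
        unfolding Z by blast
      then show "t z \<in> points W"
        using u v by (auto simp: smooth_map_def tp tq Pi_iff)
    qed
  next
    fix n U P
    assume "(n, U, P) \<in> {(n, U, p \<circ> P) | n U P. plot A n U P} \<union> {(n, U, q \<circ> P) | n U P. plot B n U P}"
    then consider Q where "P = p \<circ> Q" "plot A n U Q" | Q where "P = q \<circ> Q" "plot B n U Q"
      by blast
    then show "P \<in> U \<rightarrow> points Z \<and> plot W n U (t \<circ> P)"
    proof cases
      case 1
      then have "plot W n U (u \<circ> Q)"
        using u by (simp add: smooth_map_def)
      then have "plot W n U (t \<circ> P)"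
        by (rule cong) (use plotA[OF 1(2)] in \<open>auto simp: 1(1) tp Pi_iff\<close>)
      moreover have "P \<in> U \<rightarrow> points Z"
        using plotA[OF 1(2)] pA by (auto simp: 1(1) Pi_iff)
      ultimately show ?thesis
        by simp
    next
      case 2
      then have "plot W n U (v \<circ> Q)"
        using v by (simp add: smooth_map_def)
      then have "plot W n U (t \<circ> P)"
        by (rule cong) (use plotB[OF 2(2)] in \<open>auto simp: 2(1) tq Pi_iff\<close>)
      moreover have "P \<in> U \<rightarrow> points Z"
        using plotB[OF 2(2)] qB by (auto simp: 2(1) Pi_iff)
      ultimately show ?thesis
        by simp
    qed
  qed
  then have "smooth_map Z W t"
    using push unfolding diffeological_pushout_def by (elim conjE) (erule ssubst)
  with tp tq show ?thesis
    by blast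
qed

end

theory Submission
  imports Defs
begin

text \<open>
  The smooth complex has the same points and the same open cells as \<open>Y\<close>; only the attaching maps
  change. Two facts drive the induction over the skeleta.

  First, a continuous map \<open>f\<close> from an open subset of \<open>\<real>\<^sup>m\<close> to a smooth skeleton is homotopic to one
  that is a plot near a given compact set. To pass to the next skeleton, approximate \<open>f\<close> inside the
  new cells by Stone-Weierstrass and then push a collar of each cell radially and smoothly onto its
  boundary. The part that was not yet smoothed is thereby moved into the previous skeleton, where
  the induction hypothesis applies; since all homotopies have compact support, the pieces fit
  together. Extending a map of a sphere to the punctured space makes this applicable to attaching
  maps.

  Second, there are spaces \<open>Z\<^sub>n\<close> on the sets \<open>Y\<^sub>n \<times> [0, 1]\<close> that deform onto \<open>Y\<^sub>n\<close> at the end \<open>0\<close> and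
  onto \<open>D(X\<^sub>n)\<close> at the end \<open>1\<close>: to build \<open>Z\<^sub>n\<^sub>+\<^sub>1\<close>, attach \<open>[0, 1] \<times> D\<close> for every cell along a homotopy in
  \<open>Z\<^sub>n\<close> from its topological to its smooth attaching map. The deformations of \<open>Z\<^sub>n\<^sub>+\<^sub>1\<close> strictly extend
  those of \<open>Z\<^sub>n\<close>, so they pass to the union, and \<open>Y\<close> and \<open>D(X)\<close> are both homotopy equivalent to it.
\<close>

section \<open>Calculus of smooth functions\<close>

text \<open>The obstacle is that a plot of a pushout must lift, near every point of its domain,
  either to the old skeleton or to one closed cell. A map that is merely smooth inside the cells can
  violate this where it leaves an open cell and enters the skeleton. The collar push removes such
  crossings: near the critical points the map then lies entirely in the skeleton, where the
  induction hypothesis takes over.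

  Comparing Y and D(X) through a third space avoids gluing homotopy equivalences whose inverses and
  homotopies would fit together from one skeleton to the next only up to further homotopies. Here
  both complexes are ends of the third space and all extensions are equalities.

  The push at time 1 has a second use: it maps all of R^n smoothly onto the closed disk, and it is a
  quotient map. Hence the D-topology of the disk is the ordinary one, also at the boundary, so
  smooth attachments become topological attachments under D; and CW complexes are numerically
  generated.\<close>

lemma Euclidean_space_eq_top_of_set: "Euclidean_space n = top_of_set {x. \<forall>i\<ge>n. x i = 0}"
  by (simp add: Euclidean_space_def euclidean_product_topology)

lemma subtopology_Euclidean_space:
  "U \<subseteq> topspace (Euclidean_space n) \<Longrightarrow> subtopology (Euclidean_space n) U = top_of_set U"
  by (simp add: Euclidean_space_eq_top_of_set subtopology_subtopology Int_absorb1)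

lemma continuous_map_sub_Euclidean_iff:
  "U \<subseteq> topspace (Euclidean_space n) \<Longrightarrow>
    continuous_map (subtopology (Euclidean_space n) U) euclidean f \<longleftrightarrow> continuous_on U f"
  by (simp add: subtopology_Euclidean_space)

lemma tendsto_coordinatewise:
  fixes f :: "'a \<Rightarrow> 'b \<Rightarrow> 'c::topological_space"
  assumes "\<And>i. ((\<lambda>x. f x i) \<longlongrightarrow> l i) F"
  shows "(f \<longlongrightarrow> l) F"
proof -
  have "limitin (product_topology (\<lambda>i. euclidean) UNIV) f l F"
    unfolding limitin_componentwise using assms by simp
  then show ?thesis
    by (simp add: euclidean_product_topology)
qed

text \<open>A basic open set of the product constrains finitely many coordinates by open sets. The
  bound on the coordinates below \<open>n\<close> is enough, because all others are 0 throughout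
  \<open>Euclidean_space n\<close>.\<close>

lemma openin_Euclidean_space_box:
  assumes "openin (Euclidean_space n) U" and "p \<in> U"
  obtains r where "r > 0"
    "\<And>x. x \<in> topspace (Euclidean_space n) \<Longrightarrow> (\<And>i. i < n \<Longrightarrow> \<bar>x i - p i\<bar> < r) \<Longrightarrow> x \<in> U"
proof -
  obtain T where T: "open T" "U = T \<inter> topspace (Euclidean_space n)"
    using assms(1) unfolding Euclidean_space_eq_top_of_set openin_subtopology by auto
  then obtain X where X: "\<And>i. p i \<in> X i" "\<And>i. open (X i)" "finite {i. X i \<noteq> UNIV}"
      "(\<Pi>\<^sub>E i\<in>UNIV. X i) \<subseteq> T"
    using product_topology_open_contains_basis[of "\<lambda>_. euclidean" UNIV T p] assms(2)
    by (auto simp: open_fun_def PiE_iff)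
  have "\<exists>e>0. \<forall>y. \<bar>y - p i\<bar> < e \<longrightarrow> y \<in> X i" for i
    using X(1,2)[of i] unfolding open_dist dist_real_def by blast
  then obtain e where e: "\<And>i. e i > 0" "\<And>i y. \<bar>y - p i\<bar> < e i \<Longrightarrow> y \<in> X i"
    by metis
  \<comment> \<open>The inserted 1 gives the minimum a meaning when \<open>n = 0\<close>.\<close>
  define r where "r = Min (insert 1 (e ` {..<n}))"
  have "r > 0" using e(1) by (auto simp: r_def)
  moreover have "x \<in> U" if x: "x \<in> topspace (Euclidean_space n)" "\<And>i. i < n \<Longrightarrow> \<bar>x i - p i\<bar> < r" for x
  proof -
    have "x i \<in> X i" for i
    proof (cases "i < n")
      case True
      then have "r \<le> e i" by (simp add: r_def)
      with x(2)[OF True] show ?thesis by (intro e(2)) simp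
    next
      case False
      moreover have "p \<in> topspace (Euclidean_space n)" using T(2) assms(2) by auto
      ultimately have "x i = p i" using x(1) by (simp add: topspace_Euclidean_space)
      then show ?thesis using X(1) by simp
    qed
    then have "x \<in> T" using X(4) by (auto simp: PiE_iff)
    then show ?thesis using T(2) x(1) by simp
  qed
  ultimately show ?thesis by (rule that)
qed

text \<open>The mean value theorem without an order between \<open>a\<close> and \<open>b\<close>:
  in the chain rule below, a moving coordinate can be on either side of its base value, or at
  it.\<close>

lemma MVT_segment:
  fixes f f' :: "real \<Rightarrow> real"
  assumes "\<And>s. \<bar>s - a\<bar> \<le> \<bar>b - a\<bar> \<Longrightarrow> (f has_real_derivative f' s) (at s)"
  shows "\<exists>s. \<bar>s - a\<bar> \<le> \<bar>b - a\<bar> \<and> f b - f a = f' s * (b - a)"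
proof -
  consider "a < b" | "a = b" | "b < a" by linarith
  then show ?thesis
  proof cases
    case 1
    then obtain s where "a < s" "s < b" "f b - f a = (b - a) * f' s"
      using MVT2[of a b f f'] assms by (metis abs_of_nonneg diff_ge_0_iff_ge diff_right_mono less_imp_le)
    then show ?thesis by (intro exI[of _ s]) auto
  next
    case 2
    then show ?thesis by auto
  next
    case 3
    then obtain s where "b < s" "s < a" "f a - f b = (a - b) * f' s"
      using MVT2[of b a f f'] assms by force
    then show ?thesis by (intro exI[of _ s]) (auto simp: algebra_simps)
  qed
qed

text \<open>The increment of \<open>f\<close> telescopes into changes of one coordinate at a time.
  Each change is given by the mean value theorem at an intermediate point that tends to
  \<open>p\<close>, and the continuity of the partial derivatives yields the limit.\<close>

lemma DERIV_along_curve: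
  fixes f :: "(nat \<Rightarrow> real) \<Rightarrow> real" and \<gamma> :: "real \<Rightarrow> nat \<Rightarrow> real"
  assumes U: "openin (Euclidean_space n) U"
    and g: "\<And>i. i < n \<Longrightarrow> continuous_on U (g i)"
    and der: "\<And>i x. i < n \<Longrightarrow> x \<in> U \<Longrightarrow> ((\<lambda>t. f (x(i := t))) has_real_derivative g i x) (at (x i))"
    and p: "\<gamma> t0 \<in> U"
    and \<gamma>: "eventually (\<lambda>t. \<gamma> t \<in> topspace (Euclidean_space n)) (at t0)"
    and d: "\<And>i. i < n \<Longrightarrow> ((\<lambda>t. \<gamma> t i) has_real_derivative D i) (at t0)"
  shows "((\<lambda>t. f (\<gamma> t)) has_real_derivative (\<Sum>i<n. g i (\<gamma> t0) * D i)) (at t0)"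
proof -
  define p where "p = \<gamma> t0"
  obtain r where r: "r > 0"
    "\<And>x. x \<in> topspace (Euclidean_space n) \<Longrightarrow> (\<And>i. i < n \<Longrightarrow> \<bar>x i - p i\<bar> < r) \<Longrightarrow> x \<in> U"
    using openin_Euclidean_space_box[OF U, of p] p unfolding p_def by blast
  have pE: "p \<in> topspace (Euclidean_space n)"
    using openin_subset[OF U] p unfolding p_def by blast
  have cont: "((\<lambda>t. \<gamma> t i) \<longlongrightarrow> p i) (at t0)" if "i < n" for i
    using DERIV_isCont[OF d[OF that]] by (simp add: isCont_def p_def)
  \<comment> \<open>The first \<open>j\<close> coordinates have already moved: this leads from
    \<open>p\<close> at \<open>j = 0\<close> to \<open>\<gamma> t\<close> at \<open>j = n\<close>,
    for good \<open>t\<close>.\<close>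
  define x where "x t j = (\<lambda>i. if i < j then \<gamma> t i else p i)" for t j
  define good where "good t \<longleftrightarrow> \<gamma> t \<in> topspace (Euclidean_space n) \<and> (\<forall>i<n. \<bar>\<gamma> t i - p i\<bar> < r)" for t
  have "eventually (\<lambda>t. \<bar>\<gamma> t i - p i\<bar> < r) (at t0)" if "i < n" for i
    using tendstoD[OF cont[OF that] \<open>r > 0\<close>] by (simp add: dist_real_def)
  then have good: "eventually good (at t0)"
    unfolding good_def using \<gamma> by (auto intro!: eventually_conj eventually_ball_finite simp: Ball_def[symmetric] simp flip: lessThan_iff)
  have xU: "(x t j)(j := s) \<in> U" if "good t" "j < n" "\<bar>s - p j\<bar> \<le> \<bar>\<gamma> t j - p j\<bar>" for t j s
  proof (rule r(2))
    show "(x t j)(j := s) \<in> topspace (Euclidean_space n)"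
      using that pE by (auto simp: x_def good_def topspace_Euclidean_space)
    fix i assume "i < n"
    then show "\<bar>((x t j)(j := s)) i - p i\<bar> < r"
      using that r(1) by (auto simp: x_def good_def intro: le_less_trans)
  qed
  have "\<exists>s. good t \<and> j < n \<longrightarrow> \<bar>s - p j\<bar> \<le> \<bar>\<gamma> t j - p j\<bar> \<and>
      f ((x t j)(j := \<gamma> t j)) - f ((x t j)(j := p j)) = g j ((x t j)(j := s)) * (\<gamma> t j - p j)" for t j
  proof (cases "good t \<and> j < n")
    case True
    have "((\<lambda>s. f ((x t j)(j := s))) has_real_derivative g j ((x t j)(j := s))) (at s)"
      if "\<bar>s - p j\<bar> \<le> \<bar>\<gamma> t j - p j\<bar>" for s
      using der[OF _ xU[OF _ _ that], of j] True by simp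
    from MVT_segment[of "p j" "\<gamma> t j" "\<lambda>s. f ((x t j)(j := s))" "\<lambda>s. g j ((x t j)(j := s))", OF this]
    show ?thesis by blast
  qed blast
  then obtain \<xi> where \<xi>: "\<And>t j. good t \<Longrightarrow> j < n \<Longrightarrow> \<bar>\<xi> t j - p j\<bar> \<le> \<bar>\<gamma> t j - p j\<bar>"
      "\<And>t j. good t \<Longrightarrow> j < n \<Longrightarrow> f ((x t j)(j := \<gamma> t j)) - f ((x t j)(j := p j)) =
          g j ((x t j)(j := \<xi> t j)) * (\<gamma> t j - p j)"
    by metis
  define z where "z t j = (x t j)(j := \<xi> t j)" for t j
  have zlim: "((\<lambda>t. z t j) \<longlongrightarrow> p) (at t0)" if "j < n" for j
  proof (rule tendsto_coordinatewise)
    fix i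
    consider "i < j" | "i = j" | "i > j" by linarith
    then show "((\<lambda>t. z t j i) \<longlongrightarrow> p i) (at t0)"
    proof cases
      case 1
      then show ?thesis using cont[of i] that by (simp add: z_def x_def)
    next
      case 2
      have "((\<lambda>t. \<gamma> t j - p j) \<longlongrightarrow> 0) (at t0)"
        using cont[OF that] by (simp add: LIM_zero_iff)
      then have "((\<lambda>t. \<xi> t j - p j) \<longlongrightarrow> 0) (at t0)"
        by (rule Lim_null_comparison[rotated, OF tendsto_rabs_zero])
           (use good \<xi>(1) that in \<open>auto elim!: eventually_mono\<close>)
      then show ?thesis using 2 by (simp add: z_def LIM_zero_iff)
    next
      case 3
      then show ?thesis by (simp add: z_def x_def)
    qed
  qed
  have glim: "((\<lambda>t. g j (z t j)) \<longlongrightarrow> g j p) (at t0)" if "j < n" for j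
  proof (rule continuous_on_tendsto_compose[OF g[OF that] zlim[OF that]])
    show "p \<in> U" using p by (simp add: p_def)
    show "\<forall>\<^sub>F t in at t0. z t j \<in> U"
      using good by eventually_elim (use xU \<xi>(1) that in \<open>auto simp: z_def\<close>)
  qed
  have "((\<lambda>t. \<Sum>j<n. g j (z t j) * ((\<gamma> t j - p j) / (t - t0))) \<longlongrightarrow> (\<Sum>j<n. g j p * D j)) (at t0)"
    using d glim by (intro tendsto_sum tendsto_mult) (auto simp: has_field_derivative_iff p_def)
  moreover have "\<forall>\<^sub>F t in at t0. (\<Sum>j<n. g j (z t j) * ((\<gamma> t j - p j) / (t - t0))) = (f (\<gamma> t) - f (\<gamma> t0)) / (t - t0)"
    using good
  proof eventually_elim
    fix t assume t: "good t"
    have "x t n = \<gamma> t"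
      using t pE by (auto simp: x_def good_def topspace_Euclidean_space not_less fun_eq_iff)
    then have "f (\<gamma> t) - f (\<gamma> t0) = f (x t n) - f (x t 0)"
      by (simp add: x_def p_def)
    also have "\<dots> = (\<Sum>j<n. f (x t (Suc j)) - f (x t j))"
      by (rule sum_lessThan_telescope[of "\<lambda>j. f (x t j)", symmetric])
    also have "\<dots> = (\<Sum>j<n. g j (z t j) * (\<gamma> t j - p j))"
    proof (rule sum.cong)
      fix j assume j: "j \<in> {..<n}"
      have "x t (Suc j) = (x t j)(j := \<gamma> t j)" "x t j = (x t j)(j := p j)"
        by (auto simp: x_def fun_eq_iff)
      then show "f (x t (Suc j)) - f (x t j) = g j (z t j) * (\<gamma> t j - p j)"
        using \<xi>(2)[OF t, of j] j by (simp add: z_def)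
    qed simp
    finally show "(\<Sum>j<n. g j (z t j) * ((\<gamma> t j - p j) / (t - t0))) = (f (\<gamma> t) - f (\<gamma> t0)) / (t - t0)"
      by (simp add: sum_divide_distrib)
  qed
  ultimately show ?thesis
    unfolding has_field_derivative_iff p_def by (rule Lim_transform_eventually)
qed

section \<open>Closure properties of functions of class C^k\<close>

lemma Ck_fun_continuous:
  "Ck_fun k n U f \<Longrightarrow> continuous_map (subtopology (Euclidean_space n) U) euclideanreal f"
  by (cases k) auto

lemma Ck_fun_SucD: "Ck_fun (Suc k) n U f \<Longrightarrow> Ck_fun k n U f"
proof (induction k arbitrary: f)
  case (Suc k)
  from Suc.prems have "continuous_map (subtopology (Euclidean_space n) U) euclideanreal f"
    by (rule Ck_fun_continuous)
  moreover have "\<exists>g. Ck_fun k n U g \<and> (\<forall>x\<in>U. ((\<lambda>t. f (x(i := t))) has_real_derivative g x) (at (x i)))"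
    if "i < n" for i
    using Suc.prems[unfolded Ck_fun.simps(2)[of "Suc k"]] that Suc.IH by blast
  ultimately show ?case by simp
qed simp

lemma Ck_fun_mono: "Ck_fun k n U f \<Longrightarrow> V \<subseteq> U \<Longrightarrow> Ck_fun k n V f"
proof (induction k arbitrary: f)
  case 0
  then show ?case by (auto intro: continuous_map_from_subtopology_mono)
next
  case (Suc k)
  have "\<exists>g. Ck_fun k n V g \<and> (\<forall>x\<in>V. ((\<lambda>t. f (x(i := t))) has_real_derivative g x) (at (x i)))"
    if "i < n" for i
    using Suc.prems Suc.IH that by (metis Ck_fun.simps(2) subsetD)
  with Suc.prems show ?case
    by (auto intro: continuous_map_from_subtopology_mono)
qed

lemma Ck_fun_const: "Ck_fun k n U (\<lambda>_. c)"
proof (induction k arbitrary: c)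
  case (Suc k)
  then show ?case by (auto intro!: exI[of _ "\<lambda>_. 0"])
qed simp

lemma continuous_map_Euclidean_coordinate:
  "continuous_map (subtopology (Euclidean_space n) U) euclideanreal (\<lambda>x. x j)"
  unfolding Euclidean_space_def
  by (intro continuous_map_from_subtopology continuous_map_product_coordinates) simp

lemma Ck_fun_coordinate: "Ck_fun k n U (\<lambda>x. x j)"
proof (cases k)
  case (Suc k')
  have "((\<lambda>t. (x(i := t)) j) has_real_derivative (if i = j then 1 else 0)) (at (x i))"
    for i and x :: "nat \<Rightarrow> real" by auto
  then show ?thesis
    using Suc by (auto simp: continuous_map_Euclidean_coordinate
        intro!: exI[of _ "\<lambda>_. if _ = j then 1 else 0"] Ck_fun_const)
qed (simp add: continuous_map_Euclidean_coordinate)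

lemma Ck_fun_add: "Ck_fun k n U f \<Longrightarrow> Ck_fun k n U g \<Longrightarrow> Ck_fun k n U (\<lambda>x. f x + g x)"
proof (induction k arbitrary: f g)
  case 0
  then show ?case by (auto intro!: continuous_map_add)
next
  case (Suc k)
  have "\<exists>h. Ck_fun k n U h \<and> (\<forall>x\<in>U. ((\<lambda>t. f (x(i := t)) + g (x(i := t))) has_real_derivative h x) (at (x i)))"
    if i: "i < n" for i
  proof -
    obtain f' where f': "Ck_fun k n U f'" "\<And>x. x \<in> U \<Longrightarrow> ((\<lambda>t. f (x(i := t))) has_real_derivative f' x) (at (x i))"
      using Suc.prems(1) i by auto
    obtain g' where g': "Ck_fun k n U g'" "\<And>x. x \<in> U \<Longrightarrow> ((\<lambda>t. g (x(i := t))) has_real_derivative g' x) (at (x i))"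
      using Suc.prems(2) i by auto
    show ?thesis
      using Suc.IH[OF f'(1) g'(1)] by (fast intro: DERIV_add f'(2) g'(2))
  qed
  with Suc.prems show ?case
    by (auto intro!: continuous_map_add)
qed

lemma Ck_fun_mult: "Ck_fun k n U f \<Longrightarrow> Ck_fun k n U g \<Longrightarrow> Ck_fun k n U (\<lambda>x. f x * g x)"
proof (induction k arbitrary: f g)
  case 0
  then show ?case by (auto intro!: continuous_map_real_mult)
next
  case (Suc k)
  have "\<exists>h. Ck_fun k n U h \<and> (\<forall>x\<in>U. ((\<lambda>t. f (x(i := t)) * g (x(i := t))) has_real_derivative h x) (at (x i)))"
    if i: "i < n" for i
  proof -
    obtain f' where f': "Ck_fun k n U f'" "\<And>x. x \<in> U \<Longrightarrow> ((\<lambda>t. f (x(i := t))) has_real_derivative f' x) (at (x i))"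
      using Suc.prems(1) i by auto
    obtain g' where g': "Ck_fun k n U g'" "\<And>x. x \<in> U \<Longrightarrow> ((\<lambda>t. g (x(i := t))) has_real_derivative g' x) (at (x i))"
      using Suc.prems(2) i by auto
    have "Ck_fun k n U (\<lambda>x. f' x * g x + g' x * f x)"
      using Suc.prems f' g' by (intro Ck_fun_add Suc.IH) (auto intro: Ck_fun_SucD)
    moreover have "((\<lambda>t. f (x(i := t)) * g (x(i := t))) has_real_derivative f' x * g x + g' x * f x) (at (x i))"
      if "x \<in> U" for x
      using DERIV_mult[OF f'(2) g'(2), OF that that] by simp
    ultimately show ?thesis by blast
  qed
  with Suc.prems show ?case
    by (auto intro!: continuous_map_real_mult)
qed

lemma Ck_fun_sum:
  "finite A \<Longrightarrow> (\<And>a. a \<in> A \<Longrightarrow> Ck_fun k n U (f a)) \<Longrightarrow> Ck_fun k n U (\<lambda>x. \<Sum>a\<in>A. f a x)"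
  by (induction A rule: finite_induct) (auto intro: Ck_fun_const Ck_fun_add)

lemma eventually_fun_upd_in:
  assumes U: "openin (Euclidean_space n) U" and x: "x \<in> U" and i: "i < n"
  shows "eventually (\<lambda>t. x(i := t) \<in> U) (nhds (x i))"
proof -
  obtain r where r: "r > 0"
    "\<And>y. y \<in> topspace (Euclidean_space n) \<Longrightarrow> (\<And>i. i < n \<Longrightarrow> \<bar>y i - x i\<bar> < r) \<Longrightarrow> y \<in> U"
    using openin_Euclidean_space_box[OF U x] by blast
  have "x \<in> topspace (Euclidean_space n)" using openin_subset[OF U] x by blast
  then have "x(i := t) \<in> U" if "dist t (x i) < r" for t
    using that i r(1) by (intro r(2)) (auto simp: topspace_Euclidean_space dist_real_def)
  then show ?thesis
    using r(1) by (auto simp: eventually_nhds_metric)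
qed

text \<open>A partial derivative at \<open>x\<close> depends on the values at points
  \<open>x(i := t)\<close> near \<open>x\<close>, and in an open set these points belong to the set
  as well.\<close>

lemma Ck_fun_cong:
  assumes U: "openin (Euclidean_space n) U"
  shows "Ck_fun k n U f \<Longrightarrow> (\<And>x. x \<in> U \<Longrightarrow> f x = g x) \<Longrightarrow> Ck_fun k n U g"
proof (induction k arbitrary: f g)
  case 0
  then show ?case using openin_subset[OF U] by (auto intro: continuous_map_eq)
next
  case (Suc k)
  have "\<exists>h. Ck_fun k n U h \<and> (\<forall>x\<in>U. ((\<lambda>t. g (x(i := t))) has_real_derivative h x) (at (x i)))"
    if i: "i < n" for i
  proof -
    obtain f' where f': "Ck_fun k n U f'" "\<And>x. x \<in> U \<Longrightarrow> ((\<lambda>t. f (x(i := t))) has_real_derivative f' x) (at (x i))"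
      using Suc.prems(1) i by auto
    have "((\<lambda>t. g (x(i := t))) has_real_derivative f' x) (at (x i))" if x: "x \<in> U" for x
    proof -
      have "eventually (\<lambda>t. f (x(i := t)) = g (x(i := t))) (nhds (x i))"
        using eventually_fun_upd_in[OF U x i] by eventually_elim (rule Suc.prems(2))
      then show ?thesis
        using DERIV_cong_ev[OF refl _ refl, of "\<lambda>t. f (x(i := t))" "\<lambda>t. g (x(i := t))" "x i" "f' x"] f'(2)[OF x]
        by blast
    qed
    with f'(1) show ?thesis by blast
  qed
  moreover have "continuous_map (subtopology (Euclidean_space n) U) euclideanreal g"
    using Ck_fun_continuous[OF Suc.prems(1)] Suc.prems(2) by (auto intro: continuous_map_eq)
  ultimately show ?case by simp
qed

lemma continuous_map_Union_open:
  assumes "\<And>W. W \<in> \<U> \<Longrightarrow> openin X W \<and> continuous_map (subtopology X W) Y f"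
  shows "continuous_map (subtopology X (\<Union>\<U>)) Y f"
  unfolding continuous_map
proof (intro conjI allI impI)
  have sub: "W \<subseteq> topspace X" if "W \<in> \<U>" for W using assms[OF that] openin_subset by blast
  have "f x \<in> topspace Y" if "x \<in> W" "W \<in> \<U>" for x W
    using assms[OF that(2)] sub[OF that(2)] that(1) by (auto simp: continuous_map_def Pi_iff)
  then show "f ` topspace (subtopology X (\<Union>\<U>)) \<subseteq> topspace Y"
    by auto
  fix T assume T: "openin Y T"
  have "openin X {x \<in> W. f x \<in> T}" if "W \<in> \<U>" for W
  proof -
    have "openin (subtopology X W) {x \<in> topspace (subtopology X W). f x \<in> T}"
      using assms[OF that] T by (auto simp: continuous_map_def)
    moreover have "topspace (subtopology X W) = W" using sub[OF that] by auto
    ultimately show ?thesis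
      using openin_trans_full assms[OF that] by fastforce
  qed
  then have "openin X (\<Union>W\<in>\<U>. {x \<in> W. f x \<in> T})" by (intro openin_Union) auto
  moreover have "(\<Union>W\<in>\<U>. {x \<in> W. f x \<in> T}) = {x \<in> topspace (subtopology X (\<Union>\<U>)). f x \<in> T}"
    using sub by auto
  ultimately show "openin (subtopology X (\<Union>\<U>)) {x \<in> topspace (subtopology X (\<Union>\<U>)). f x \<in> T}"
    unfolding openin_subtopology by (intro exI[of _ "\<Union>W\<in>\<U>. {x \<in> W. f x \<in> T}"]) auto
qed

lemma Ck_fun_Union:
  assumes "\<And>W. W \<in> \<U> \<Longrightarrow> openin (Euclidean_space n) W \<and> Ck_fun k n W f"
  shows "Ck_fun k n (\<Union>\<U>) f"
  using assms
proof (induction k arbitrary: f)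
  case 0
  have "continuous_map (subtopology (Euclidean_space n) (\<Union>\<U>)) euclideanreal f"
    using 0 by (intro continuous_map_Union_open) simp
  then show ?case by simp
next
  case (Suc k)
  have "continuous_map (subtopology (Euclidean_space n) (\<Union>\<U>)) euclideanreal f"
    using Suc.prems Ck_fun_continuous by (intro continuous_map_Union_open) blast
  moreover have "\<exists>g. Ck_fun k n (\<Union>\<U>) g \<and>
      (\<forall>x\<in>\<Union>\<U>. ((\<lambda>t. f (x(i := t))) has_real_derivative g x) (at (x i)))" if i: "i < n" for i
  proof (intro exI conjI)
    \<comment> \<open>The partial derivatives supplied for different members of the cover may differ
      outside their own sets; \<open>deriv\<close> is a single function that agrees with each of
      them where it counts.\<close>
    let ?g = "\<lambda>x. deriv (\<lambda>t. f (x(i := t))) (x i)"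
    have *: "Ck_fun k n W ?g \<and> (\<forall>x\<in>W. ((\<lambda>t. f (x(i := t))) has_real_derivative ?g x) (at (x i)))"
      if W: "W \<in> \<U>" for W
    proof -
      obtain g where g: "Ck_fun k n W g" "\<And>x. x \<in> W \<Longrightarrow> ((\<lambda>t. f (x(i := t))) has_real_derivative g x) (at (x i))"
        using Suc.prems[OF W] i by auto
      then have "?g x = g x" if "x \<in> W" for x
        using that by (simp add: DERIV_imp_deriv)
      then show ?thesis
        using g Ck_fun_cong[of n W k g ?g] Suc.prems[OF W] by auto
    qed
    show "Ck_fun k n (\<Union>\<U>) ?g"
      using * Suc.prems by (intro Suc.IH) blast
    show "\<forall>x\<in>\<Union>\<U>. ((\<lambda>t. f (x(i := t))) has_real_derivative ?g x) (at (x i))"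
      using * by blast
  qed
  ultimately show ?case by simp
qed

text \<open>The coordinates from \<open>n\<close> on vanish on \<open>V\<close>, so continuity into
  the full product follows from the first \<open>n\<close> coordinates.\<close>

lemma continuous_on_Euclidean_map:
  assumes "U \<subseteq> topspace (Euclidean_space n)" "V \<subseteq> topspace (Euclidean_space m)" "\<phi> \<in> V \<rightarrow> U"
    and "\<And>i. i < n \<Longrightarrow> continuous_on V (\<lambda>v. \<phi> v i)"
  shows "continuous_on V \<phi>"
proof (rule continuous_on_coordinatewise_then_product)
  fix i
  show "continuous_on V (\<lambda>v. \<phi> v i)"
  proof (cases "i < n")
    case False
    then have "\<phi> v i = 0" if "v \<in> V" for v
      using assms(1,3) that by (fastforce simp: topspace_Euclidean_space)
    then show ?thesis by (simp cong: continuous_on_cong)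
  qed (rule assms(4))
qed

text \<open>Induction on the order: by the chain rule, a partial derivative of the composition is a
  sum of products in which one factor is a partial derivative of \<open>f\<close> composed with
  \<open>\<phi>\<close>, and this factor falls under the induction hypothesis.\<close>

lemma Ck_fun_compose:
  assumes U: "openin (Euclidean_space n) U" and V: "openin (Euclidean_space m) V" and \<phi>: "\<phi> \<in> V \<rightarrow> U"
  shows "Ck_fun k n U f \<Longrightarrow> (\<And>i. i < n \<Longrightarrow> Ck_fun k m V (\<lambda>v. \<phi> v i)) \<Longrightarrow> Ck_fun k m V (\<lambda>v. f (\<phi> v))"
proof (induction k arbitrary: f)
  have sub: "U \<subseteq> topspace (Euclidean_space n)" "V \<subseteq> topspace (Euclidean_space m)"
    using U V openin_subset by blast+
  have cont: "continuous_map (subtopology (Euclidean_space m) V) euclideanreal (\<lambda>v. f (\<phi> v))"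
    if "Ck_fun k n U f" "\<And>i. i < n \<Longrightarrow> Ck_fun k m V (\<lambda>v. \<phi> v i)" for k f
  proof -
    have "continuous_on V \<phi>"
      using that(2)[THEN Ck_fun_continuous] sub
      by (intro continuous_on_Euclidean_map[OF sub \<phi>]) (simp add: continuous_map_sub_Euclidean_iff)
    moreover have "continuous_on U f"
      using that(1)[THEN Ck_fun_continuous] sub by (simp add: continuous_map_sub_Euclidean_iff)
    ultimately have "continuous_on V (\<lambda>v. f (\<phi> v))"
      using \<phi> continuous_on_compose2 by (metis funcset_image)
    then show ?thesis using sub by (simp add: continuous_map_sub_Euclidean_iff)
  qed
  {
    case 0
    then show ?case using cont[of 0] by simp
  next
    case (Suc k)
    have "\<forall>i. \<exists>g. i < n \<longrightarrow> Ck_fun k n U g \<and>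
        (\<forall>x\<in>U. ((\<lambda>t. f (x(i := t))) has_real_derivative g x) (at (x i)))"
      using Suc.prems(1) by auto
    then obtain g where g: "\<And>i. i < n \<Longrightarrow> Ck_fun k n U (g i)"
        "\<And>i x. i < n \<Longrightarrow> x \<in> U \<Longrightarrow> ((\<lambda>t. f (x(i := t))) has_real_derivative g i x) (at (x i))"
      by metis
    have "\<exists>h. Ck_fun k m V h \<and> (\<forall>x\<in>V. ((\<lambda>t. f (\<phi> (x(j := t)))) has_real_derivative h x) (at (x j)))"
      if j: "j < m" for j
    proof -
      have "\<forall>i. \<exists>d. i < n \<longrightarrow> Ck_fun k m V d \<and>
        (\<forall>x\<in>V. ((\<lambda>t. \<phi> (x(j := t)) i) has_real_derivative d x) (at (x j)))"
        using Suc.prems(2) j by auto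
      then obtain d where d: "\<And>i. i < n \<Longrightarrow> Ck_fun k m V (d i)"
          "\<And>i x. i < n \<Longrightarrow> x \<in> V \<Longrightarrow> ((\<lambda>t. \<phi> (x(j := t)) i) has_real_derivative d i x) (at (x j))"
        by metis
      have "Ck_fun k m V (\<lambda>v. g i (\<phi> v))" if "i < n" for i
        by (rule Suc.IH[OF g(1)[OF that]]) (rule Ck_fun_SucD[OF Suc.prems(2)])
      then have "Ck_fun k m V (\<lambda>v. \<Sum>i<n. g i (\<phi> v) * d i v)"
        using d(1) by (intro Ck_fun_sum Ck_fun_mult) auto
      moreover have "((\<lambda>t. f (\<phi> (x(j := t)))) has_real_derivative (\<Sum>i<n. g i (\<phi> x) * d i x)) (at (x j))"
        if x: "x \<in> V" for x
      proof -
        have "((\<lambda>t. f ((\<lambda>t. \<phi> (x(j := t))) t)) has_real_derivative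
            (\<Sum>i<n. g i ((\<lambda>t. \<phi> (x(j := t))) (x j)) * d i x)) (at (x j))"
        proof (rule DERIV_along_curve[OF U])
          show "continuous_on U (g i)" if "i < n" for i
            using g(1)[OF that, THEN Ck_fun_continuous] sub by (simp add: continuous_map_sub_Euclidean_iff)
          show "\<forall>\<^sub>F t in at (x j). \<phi> (x(j := t)) \<in> topspace (Euclidean_space n)"
            using eventually_fun_upd_in[OF V x j] \<phi> sub
            unfolding eventually_at_filter by (auto elim!: eventually_mono)
          show "\<phi> (x(j := x j)) \<in> U" using \<phi> x by auto
        qed (use g(2) d(2) x in blast)+
        then show ?thesis by simp
      qed
      ultimately show ?thesis by blast
    qed
    with cont[OF Suc.prems] show ?case by simp
  }
qed

section \<open>Smooth functions on open subsets of Euclidean space\<close>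

lemma smooth_fun_continuous:
  "smooth_fun n U f \<Longrightarrow> continuous_map (subtopology (Euclidean_space n) U) euclideanreal f"
  using Ck_fun_continuous by (auto simp: smooth_fun_def)

lemma smooth_fun_mono: "smooth_fun n U f \<Longrightarrow> V \<subseteq> U \<Longrightarrow> smooth_fun n V f"
  unfolding smooth_fun_def by (blast intro: Ck_fun_mono)

lemma smooth_fun_cong:
  "openin (Euclidean_space n) U \<Longrightarrow> smooth_fun n U f \<Longrightarrow> (\<And>x. x \<in> U \<Longrightarrow> f x = g x) \<Longrightarrow> smooth_fun n U g"
  unfolding smooth_fun_def by (blast intro: Ck_fun_cong)

lemma smooth_fun_Union:
  "(\<And>W. W \<in> \<U> \<Longrightarrow> openin (Euclidean_space n) W \<and> smooth_fun n W f) \<Longrightarrow> smooth_fun n (\<Union>\<U>) f"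
  unfolding smooth_fun_def by (blast intro: Ck_fun_Union)

lemma smooth_fun_const: "smooth_fun n U (\<lambda>_. c)"
  and smooth_fun_coordinate: "smooth_fun n U (\<lambda>x. x j)"
  and smooth_fun_add: "smooth_fun n U f \<Longrightarrow> smooth_fun n U g \<Longrightarrow> smooth_fun n U (\<lambda>x. f x + g x)"
  and smooth_fun_mult: "smooth_fun n U f \<Longrightarrow> smooth_fun n U g \<Longrightarrow> smooth_fun n U (\<lambda>x. f x * g x)"
  by (auto simp: smooth_fun_def Ck_fun_const Ck_fun_coordinate Ck_fun_add Ck_fun_mult)

lemma smooth_fun_diff:
  "smooth_fun n U f \<Longrightarrow> smooth_fun n U g \<Longrightarrow> smooth_fun n U (\<lambda>x. f x - g x)"
  using smooth_fun_add[of n U f "\<lambda>x. (-1) * g x"] smooth_fun_mult[OF smooth_fun_const[of n U "-1"]]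
  by simp

lemma smooth_fun_sum:
  "finite A \<Longrightarrow> (\<And>a. a \<in> A \<Longrightarrow> smooth_fun n U (f a)) \<Longrightarrow> smooth_fun n U (\<lambda>x. \<Sum>a\<in>A. f a x)"
  by (simp add: smooth_fun_def Ck_fun_sum)

lemma smooth_fun_power2: "smooth_fun n U f \<Longrightarrow> smooth_fun n U (\<lambda>x. (f x)\<^sup>2)"
  by (simp add: power2_eq_square smooth_fun_mult)

lemma smooth_fun_compose:
  "euclidean_smooth m V n U \<phi> \<Longrightarrow> smooth_fun n U f \<Longrightarrow> smooth_fun m V (\<lambda>v. f (\<phi> v))"
  unfolding smooth_fun_def euclidean_smooth_def by (blast intro: Ck_fun_compose)

text \<open>The sequence \<open>d\<close> of successive derivatives expresses smoothness of the
  function \<open>d 0\<close> of one real variable. This function is read as a smooth function on an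
  open subset of \<open>Euclidean_space 1\<close>, so that \<open>smooth_fun_compose\<close>
  applies.\<close>

lemma smooth_fun_compose_real:
  assumes V: "openin (Euclidean_space m) V" and f: "smooth_fun m V f" and T: "open T" "\<And>v. v \<in> V \<Longrightarrow> f v \<in> T"
    and d: "\<And>k t. t \<in> T \<Longrightarrow> (d k has_real_derivative d (Suc k) t) (at t)"
  shows "smooth_fun m V (\<lambda>v. d 0 (f v))"
proof -
  let ?U = "{x \<in> topspace (Euclidean_space 1). x 0 \<in> T}"
  have U: "openin (Euclidean_space 1) ?U"
    using continuous_map_Euclidean_coordinate[of 1 UNIV 0] T(1)
    by (auto simp: continuous_map_def)
  have c: "continuous_map (subtopology (Euclidean_space 1) ?U) euclideanreal (\<lambda>x. d j (x 0))" for j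
  proof -
    have "continuous_on T (d j)"
      using d by (meson DERIV_continuous_on DERIV_subset has_field_derivative_at_within)
    then have "continuous_on ?U (\<lambda>x. d j (x 0))"
      by (rule continuous_on_compose2)
         (auto intro: continuous_on_subset[OF continuous_on_product_coordinates])
    then show ?thesis
      by (subst continuous_map_sub_Euclidean_iff) auto
  qed
  have "Ck_fun k 1 ?U (\<lambda>x. d j (x 0))" for k j
  proof (induction k arbitrary: j)
    case (Suc k)
    have "((\<lambda>t. d j ((x(i := t)) 0)) has_real_derivative d (Suc j) (x 0)) (at (x i))"
      if "i < 1" "x \<in> ?U" for i and x :: "nat \<Rightarrow> real"
      using d that by auto
    with Suc c show ?case by (auto intro!: exI[of _ "\<lambda>x. d (Suc j) (x 0)"])
  qed (use c in simp)
  then have "smooth_fun 1 ?U (\<lambda>x. d 0 (x 0))" by (simp add: smooth_fun_def)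
  moreover have "euclidean_smooth m V 1 ?U (\<lambda>v i. if i = 0 then f v else 0)"
    unfolding euclidean_smooth_def using V U f T by (auto simp: topspace_Euclidean_space)
  ultimately show ?thesis using smooth_fun_compose by fastforce
qed


section \<open>Cutoff functions and smooth approximation\<close>

text \<open>Up to linear combinations this family is closed under differentiation, which makes its
  member \<open>0\<close> smooth.\<close>

definition flat_exp :: "nat \<Rightarrow> real \<Rightarrow> real" where
  "flat_exp j t = (if t > 0 then exp (- 1 / t) / t ^ j else 0)"

text \<open>Substituting \<open>1 / t\<close> turns this into the decay of a power against the
  exponential.\<close>

lemma flat_exp_lim: "(flat_exp j \<longlongrightarrow> 0) (at_right 0)"
proof -
  have "((\<lambda>t::real. exp (- 1 / t) / t ^ j) \<longlongrightarrow> 0) (at_right 0)"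
    using filterlim_compose[OF tendsto_power_div_exp_0[of j] filterlim_inverse_at_top_right]
    by (simp add: exp_minus field_simps power_inverse)
  then show ?thesis
    by (rule Lim_transform_eventually) (auto simp: flat_exp_def eventually_at_filter)
qed

text \<open>Away from 0 this is the quotient rule. At 0 the difference quotient of member
  \<open>j\<close> is member \<open>j + 1\<close> on the right and 0 on the left, so its limit is
  0.\<close>

lemma flat_exp_DERIV:
  "(flat_exp j has_real_derivative flat_exp (j + 2) t - real j * flat_exp (Suc j) t) (at t)"
proof -
  consider "t > 0" | "t < 0" | "t = 0" by linarith
  then show ?thesis
  proof cases
    case 1
    have "((\<lambda>t. exp (- 1 / t) / t ^ j) has_real_derivative
        ((exp (- 1 / t) * (1 / t\<^sup>2)) * t ^ j - exp (- 1 / t) * (real j * t ^ (j - 1))) / (t ^ j * t ^ j)) (at t)"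
      using 1 by (auto intro!: derivative_eq_intros simp: power2_eq_square)
    moreover have "((exp (- 1 / t) * (1 / t\<^sup>2)) * t ^ j - exp (- 1 / t) * (real j * t ^ (j - 1))) / (t ^ j * t ^ j)
        = flat_exp (j + 2) t - real j * flat_exp (Suc j) t"
      using 1 by (cases j) (auto simp: flat_exp_def field_simps power2_eq_square)
    ultimately have "((\<lambda>t. exp (- 1 / t) / t ^ j) has_real_derivative
        flat_exp (j + 2) t - real j * flat_exp (Suc j) t) (at t)" by simp
    moreover have "eventually (\<lambda>s. exp (- 1 / s) / s ^ j = flat_exp j s) (nhds t)"
      using eventually_nhds_in_open[of "{0<..}" t] 1 by (auto simp: flat_exp_def elim!: eventually_mono)
    ultimately show ?thesis by (subst (asm) DERIV_cong_ev[OF refl _ refl])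
  next
    case 2
    have "eventually (\<lambda>s. 0 = flat_exp j s) (nhds t)"
      using eventually_nhds_in_open[of "{..<0}" t] 2 by (auto simp: flat_exp_def elim!: eventually_mono)
    moreover have "((\<lambda>s. 0) has_real_derivative flat_exp (j + 2) t - real j * flat_exp (Suc j) t) (at t)"
      using 2 by (simp add: flat_exp_def)
    ultimately show ?thesis by (subst (asm) DERIV_cong_ev[OF refl _ refl])
  next
    case 3
    have "((\<lambda>h. (flat_exp j h - flat_exp j 0) / (h - 0)) \<longlongrightarrow> 0) (at_right 0)"
      by (rule Lim_transform_eventually[OF flat_exp_lim[of "Suc j"]])
         (auto simp: flat_exp_def eventually_at_filter)
    moreover have "((\<lambda>h. (flat_exp j h - flat_exp j 0) / (h - 0)) \<longlongrightarrow> 0) (at_left 0)"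
      by (rule Lim_transform_eventually[OF tendsto_const[of 0]])
         (auto simp: flat_exp_def eventually_at_filter)
    ultimately have "((\<lambda>h. (flat_exp j h - flat_exp j 0) / (h - 0)) \<longlongrightarrow> 0) (at 0)"
      by (simp add: filterlim_split_at)
    then show ?thesis using 3 by (simp add: has_field_derivative_iff flat_exp_def)
  qed
qed

text \<open>The derivative of one member is a combination of two others rather than the next term of
  a sequence, so \<open>smooth_fun_compose_real\<close> does not fit directly. Instead, all members
  are shown to be of class C^k at once, by induction on \<open>k\<close>.\<close>

lemma smooth_fun_flat_exp:
  assumes V: "openin (Euclidean_space m) V" and f: "smooth_fun m V f"
  shows "smooth_fun m V (\<lambda>v. flat_exp 0 (f v))"
proof -
  have c: "continuous_map (subtopology (Euclidean_space m) V) euclideanreal (\<lambda>x. flat_exp j (f x))" for j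
  proof -
    have "continuous_map euclideanreal euclideanreal (flat_exp j)"
      using DERIV_isCont[OF flat_exp_DERIV] by (simp add: continuous_at_imp_continuous_on)
    from continuous_map_compose[OF smooth_fun_continuous[OF f] this] show ?thesis by (simp add: o_def)
  qed
  have "Ck_fun k m V (\<lambda>x. flat_exp j (f x))" for k j
  proof (induction k arbitrary: j)
    case (Suc k)
    have "\<exists>g. Ck_fun k m V g \<and> (\<forall>x\<in>V. ((\<lambda>t. flat_exp j (f (x(i := t)))) has_real_derivative g x) (at (x i)))"
      if i: "i < m" for i
    proof -
      obtain g where g: "Ck_fun k m V g" "\<And>x. x \<in> V \<Longrightarrow> ((\<lambda>t. f (x(i := t))) has_real_derivative g x) (at (x i))"
        using f i unfolding smooth_fun_def by (metis Ck_fun.simps(2))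
      have "Ck_fun k m V (\<lambda>x. (flat_exp (j + 2) (f x) + (- real j) * flat_exp (Suc j) (f x)) * g x)"
        by (intro Ck_fun_mult Ck_fun_add Suc g Ck_fun_const)
      moreover have "((\<lambda>t. flat_exp j (f (x(i := t)))) has_real_derivative
          (flat_exp (j + 2) (f x) + (- real j) * flat_exp (Suc j) (f x)) * g x) (at (x i))" if "x \<in> V" for x
        using DERIV_chain2[OF flat_exp_DERIV g(2)[OF that], of j] by simp
      ultimately show ?thesis by blast
    qed
    with c show ?case by simp
  qed (use c in simp)
  then show ?thesis by (simp add: smooth_fun_def)
qed

lemma smooth_fun_powr:
  assumes V: "openin (Euclidean_space m) V" and f: "smooth_fun m V f" "\<And>v. v \<in> V \<Longrightarrow> f v > 0"
  shows "smooth_fun m V (\<lambda>v. f v powr a)"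
proof -
  \<comment> \<open>The \<open>k\<close>-th derivative of \<open>t powr a\<close>, with a falling
    factorial of \<open>a\<close> as coefficient.\<close>
  define d where "d k t = (\<Prod>i<k. a - real i) * t powr (a - real k)" for k t
  have "smooth_fun m V (\<lambda>v. d 0 (f v))"
  proof (rule smooth_fun_compose_real[OF V f(1), of "{0<..}"])
    fix k and t :: real assume "t \<in> {0<..}"
    then show "(d k has_real_derivative d (Suc k) t) (at t)"
      unfolding d_def by (auto intro!: derivative_eq_intros simp: algebra_simps)
  qed (use f in auto)
  then show ?thesis by (simp add: d_def)
qed


text \<open>The denominator enters as a power with exponent -1, so that its smoothness comes from
  \<open>smooth_fun_powr\<close>. It is positive everywhere, because \<open>t\<close> or
  \<open>1 - t\<close> is.\<close>

definition smooth_step :: "real \<Rightarrow> real" where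
  "smooth_step t = flat_exp 0 t * (flat_exp 0 t + flat_exp 0 (1 - t)) powr (- 1)"

lemma flat_exp_0_nonneg: "flat_exp 0 t \<ge> 0" and flat_exp_0_pos: "t > 0 \<Longrightarrow> flat_exp 0 t > 0"
  and flat_exp_0_eq: "t \<le> 0 \<Longrightarrow> flat_exp 0 t = 0"
  by (auto simp: flat_exp_def)

lemma flat_exp_sum_pos: "flat_exp 0 t + flat_exp 0 (1 - t) > 0"
  using flat_exp_0_nonneg[of t] flat_exp_0_nonneg[of "1 - t"] flat_exp_0_pos[of t] flat_exp_0_pos[of "1 - t"]
  by linarith

lemma smooth_step_alt: "smooth_step t = flat_exp 0 t / (flat_exp 0 t + flat_exp 0 (1 - t))"
  using flat_exp_sum_pos[of t] by (simp add: smooth_step_def powr_minus_divide)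

lemma smooth_step_eq_0: "t \<le> 0 \<Longrightarrow> smooth_step t = 0"
  and smooth_step_eq_1: "t \<ge> 1 \<Longrightarrow> smooth_step t = 1"
  and smooth_step_nonneg: "smooth_step t \<ge> 0"
  and smooth_step_le_1: "smooth_step t \<le> 1"
  using flat_exp_sum_pos[of t] flat_exp_0_nonneg[of t] flat_exp_0_nonneg[of "1 - t"]
  by (auto simp: smooth_step_alt flat_exp_0_eq divide_simps)

lemma smooth_fun_smooth_step:
  assumes V: "openin (Euclidean_space m) V" and f: "smooth_fun m V f"
  shows "smooth_fun m V (\<lambda>v. smooth_step (f v))"
  unfolding smooth_step_def
  by (intro smooth_fun_mult smooth_fun_flat_exp smooth_fun_powr smooth_fun_add smooth_fun_diff
      smooth_fun_const assms flat_exp_sum_pos)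

section \<open>Balls, cutoff functions and approximation\<close>

abbreviation sqdist :: "nat \<Rightarrow> (nat \<Rightarrow> real) \<Rightarrow> (nat \<Rightarrow> real) \<Rightarrow> real" where
  "sqdist n c x \<equiv> \<Sum>i<n. (x i - c i)\<^sup>2"

lemma smooth_fun_sqdist: "smooth_fun n U (sqdist n c)"
  by (intro smooth_fun_sum smooth_fun_power2 smooth_fun_diff smooth_fun_coordinate smooth_fun_const) simp

lemma continuous_map_sqdist: "continuous_map (Euclidean_space n) euclideanreal (sqdist n c)"
  using smooth_fun_continuous[OF smooth_fun_sqdist[of n UNIV c]] by simp

lemma openin_sqdist_ball: "openin (Euclidean_space n) {x \<in> topspace (Euclidean_space n). sqdist n c x < r}"
  using openin_continuous_map_preimage[OF continuous_map_sqdist, of "{..<r}" n c] by simp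

text \<open>A closed subset of a compact box; the coordinates from \<open>n\<close> on range over
  the compact set {0}.\<close>

lemma compactin_sqdist_ball: "compactin (Euclidean_space n) {x \<in> topspace (Euclidean_space n). sqdist n c x \<le> r}"
proof -
  define B where "B i = (if i < n then {c i - sqrt r .. c i + sqrt r} else {0})" for i
  have "compactin (product_topology (\<lambda>i. euclideanreal) UNIV) (\<Pi>\<^sub>E i\<in>UNIV. B i)"
    unfolding compactin_PiE by (simp add: B_def)
  moreover have sub: "{x \<in> topspace (Euclidean_space n). sqdist n c x \<le> r} \<subseteq> (\<Pi>\<^sub>E i\<in>UNIV. B i)"
  proof
    fix x assume x: "x \<in> {x \<in> topspace (Euclidean_space n). sqdist n c x \<le> r}"
    have "x i \<in> B i" for i
    proof (cases "i < n")
      case True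
      then have "(x i - c i)\<^sup>2 \<le> sqdist n c x" by (intro member_le_sum) auto
      then have "\<bar>x i - c i\<bar> \<le> sqrt r" using x by (intro real_le_rsqrt) simp
      then show ?thesis using True by (auto simp: B_def)
    next
      case False
      then show ?thesis using x by (auto simp: B_def topspace_Euclidean_space)
    qed
    then show "x \<in> (\<Pi>\<^sub>E i\<in>UNIV. B i)" by auto
  qed
  moreover have "closedin (Euclidean_space n) {x \<in> topspace (Euclidean_space n). sqdist n c x \<le> r}"
    using closedin_continuous_map_preimage[OF continuous_map_sqdist, of "{..r}" n c] by simp
  ultimately have "compact {x \<in> topspace (Euclidean_space n). sqdist n c x \<le> r}"
    using compact_Int_closed[OF _ closedin_Euclidean_imp_closed,
        of "\<Pi>\<^sub>E i\<in>UNIV. B i" n "{x \<in> topspace (Euclidean_space n). sqdist n c x \<le> r}"]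
    by (simp add: euclidean_product_topology inf.absorb2 del: closedin_Euclidean_space_iff)
  then show ?thesis
    unfolding Euclidean_space_eq_top_of_set by (auto simp: compactin_subtopology)
qed

lemma sqdist_ball_subset:
  assumes U: "openin (Euclidean_space n) U" and c: "c \<in> U"
  obtains r where "r > 0" "{x \<in> topspace (Euclidean_space n). sqdist n c x \<le> r} \<subseteq> U"
proof -
  obtain s where s: "s > 0"
    "\<And>x. x \<in> topspace (Euclidean_space n) \<Longrightarrow> (\<And>i. i < n \<Longrightarrow> \<bar>x i - c i\<bar> < s) \<Longrightarrow> x \<in> U"
    using openin_Euclidean_space_box[OF U c] by blast
  have "x \<in> U" if x: "x \<in> topspace (Euclidean_space n)" "sqdist n c x \<le> (s/2)\<^sup>2" for x
  proof (rule s(2)[OF x(1)])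
    fix i assume "i < n"
    then have "(x i - c i)\<^sup>2 \<le> sqdist n c x" by (intro member_le_sum) auto
    then have "\<bar>x i - c i\<bar> \<le> s / 2" using x(2) s(1) power2_le_iff_abs_le[of "s/2" "x i - c i"] by simp
    then show "\<bar>x i - c i\<bar> < s" using s(1) by simp
  qed
  then show ?thesis using s(1) by (intro that[of "(s/2)\<^sup>2"]) auto
qed

text \<open>Finitely many balls inside \<open>U\<close> cover \<open>K\<close>, even with half of
  their squared radii. One bump per ball makes the sum at least 1 there, and a last
  \<open>smooth_step\<close> clamps it to exactly 1. The open set \<open>N\<close> is part of the
  result because smoothness has to be checked near points, not only at them.\<close>

lemma smooth_cutoff:
  assumes K: "compactin (Euclidean_space n) K" and U: "openin (Euclidean_space n) U" and "K \<subseteq> U"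
  obtains \<eta> N L where "smooth_fun n (topspace (Euclidean_space n)) \<eta>" "\<And>x. \<eta> x \<in> {0..1}"
    "openin (Euclidean_space n) N" "K \<subseteq> N" "\<And>x. x \<in> N \<Longrightarrow> \<eta> x = 1"
    "compactin (Euclidean_space n) L" "L \<subseteq> U" "N \<subseteq> L"
    "\<And>x. x \<in> topspace (Euclidean_space n) - L \<Longrightarrow> \<eta> x = 0"
proof -
  let ?E = "topspace (Euclidean_space n)"
  have "\<exists>r. c \<in> K \<longrightarrow> r > 0 \<and> {x \<in> ?E. sqdist n c x \<le> r} \<subseteq> U" for c
    using sqdist_ball_subset[OF U, of c] \<open>K \<subseteq> U\<close> by blast
  then have "\<exists>r. \<forall>c. c \<in> K \<longrightarrow> r c > 0 \<and> {x \<in> ?E. sqdist n c x \<le> r c} \<subseteq> U"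
    by (intro choice allI)
  then obtain r where r: "\<And>c. c \<in> K \<Longrightarrow> r c > 0" "\<And>c. c \<in> K \<Longrightarrow> {x \<in> ?E. sqdist n c x \<le> r c} \<subseteq> U"
    by blast
  define B where "B c = {x \<in> ?E. sqdist n c x < r c / 2}" for c
  have oB: "openin (Euclidean_space n) (B c)" for c
    unfolding B_def by (rule openin_sqdist_ball)
  have KE: "K \<subseteq> ?E" using K compactin_subset_topspace by blast
  have "\<exists>\<F>. finite \<F> \<and> \<F> \<subseteq> B ` K \<and> K \<subseteq> \<Union>\<F>"
  proof (rule compactinD[OF K])
    show "openin (Euclidean_space n) V" if "V \<in> B ` K" for V
      using that oB by blast
    show "K \<subseteq> \<Union> (B ` K)"
    proof
      fix x assume "x \<in> K"
      then have "x \<in> B x" using r(1) KE by (auto simp: B_def)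
      with \<open>x \<in> K\<close> show "x \<in> \<Union> (B ` K)" by blast
    qed
  qed
  then obtain F where F: "finite F" "F \<subseteq> K" "K \<subseteq> \<Union>(B ` F)"
    by (metis finite_subset_image)
  \<comment> \<open>The argument of \<open>smooth_step\<close> falls from 1 to 0 while the squared
    distance grows from \<open>r c / 2\<close> to \<open>r c\<close>.\<close>
  define b where "b c x = smooth_step (2 - (2 / r c) * sqdist n c x)" for c x
  define \<eta> where "\<eta> x = smooth_step (\<Sum>c\<in>F. b c x)" for x
  define L where "L = (\<Union>c\<in>F. {x \<in> ?E. sqdist n c x \<le> r c})"
  show ?thesis
  proof (rule that[of \<eta> "\<Union>(B ` F)" L])
    show "smooth_fun n ?E \<eta>"
      unfolding \<eta>_def b_def
      by (intro smooth_fun_smooth_step openin_topspace smooth_fun_sum[OF F(1)] smooth_fun_diff smooth_fun_mult smooth_fun_const smooth_fun_sqdist)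
    show "\<eta> x \<in> {0..1}" for x by (simp add: \<eta>_def smooth_step_nonneg smooth_step_le_1)
    show "openin (Euclidean_space n) (\<Union>(B ` F))"
      using oB by blast
    show "K \<subseteq> \<Union>(B ` F)" by (rule F)
    have arith: "2 - (2 / s) * q \<ge> 1 \<longleftrightarrow> q \<le> s / 2" "2 - (2 / s) * q \<le> 0 \<longleftrightarrow> q \<ge> s"
      if "s > 0" for s q :: real
      using that by (auto simp: field_simps)
    show "\<eta> x = 1" if x: "x \<in> \<Union>(B ` F)" for x
    proof -
      obtain c where c: "c \<in> F" "x \<in> B c" using x by blast
      then have "r c > 0" "sqdist n c x \<le> r c / 2"
        using r(1)[of c] F(2) by (auto simp: B_def)
      then have "b c x = 1"
        unfolding b_def by (intro smooth_step_eq_1) (simp only: arith)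
      moreover have "b c x \<le> (\<Sum>c\<in>F. b c x)"
        using c(1) F(1) by (intro member_le_sum) (auto simp: b_def smooth_step_nonneg)
      ultimately show ?thesis by (simp add: \<eta>_def smooth_step_eq_1)
    qed
    show "compactin (Euclidean_space n) L"
      unfolding L_def using F(1) by (intro compactin_Union) (auto simp: compactin_sqdist_ball)
    show "L \<subseteq> U" using r(2) F(2) by (auto simp: L_def)
    have "B c \<subseteq> {x \<in> ?E. sqdist n c x \<le> r c}" if "c \<in> F" for c
      using r(1)[of c] F(2) that by (auto simp: B_def)
    then show "\<Union>(B ` F) \<subseteq> L" unfolding L_def by blast
    show "\<eta> x = 0" if "x \<in> ?E - L" for x
    proof -
      have "b c x = 0" if c: "c \<in> F" for c
      proof -
        have "r c > 0" using c F(2) r(1) by blast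
        moreover have "sqdist n c x \<ge> r c"
          using c \<open>x \<in> ?E - L\<close> unfolding L_def by force
        ultimately show ?thesis
          unfolding b_def by (intro smooth_step_eq_0) (simp only: arith)
      qed
      then show ?thesis by (simp add: \<eta>_def smooth_step_eq_0)
    qed
  qed
qed

text \<open>Functions that are smooth on the whole space form an algebra that contains the
  constants, and its coordinate functions separate points.\<close>

lemma smooth_approximation:
  assumes L: "compactin (Euclidean_space n) L" and f: "continuous_on L f" and e: "e > 0"
  obtains p where "smooth_fun n (topspace (Euclidean_space n)) p" "\<And>x. x \<in> L \<Longrightarrow> \<bar>f x - p x\<bar> < e"
proof -
  let ?E = "topspace (Euclidean_space n)"
  have LE: "L \<subseteq> ?E" and "compact L"
    using L by (auto simp: Euclidean_space_eq_top_of_set compactin_subtopology)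
  have "\<exists>p. smooth_fun n ?E p \<and> (\<forall>x\<in>L. \<bar>f x - p x\<bar> < e)"
  proof (rule Stone_Weierstrass_HOL[OF \<open>compact L\<close> _ _ _ _ _ f e])
    show "continuous_on L p" if "smooth_fun n ?E p" for p
      using smooth_fun_continuous[OF that] continuous_on_subset[OF _ LE] continuous_map_sub_Euclidean_iff[of ?E n p]
      by simp
    show "\<exists>f. smooth_fun n ?E f \<and> f x \<noteq> f y" if "x \<in> L \<and> y \<in> L \<and> x \<noteq> y" for x y
      using that by (metis ext smooth_fun_coordinate)
  qed (auto intro: smooth_fun_const smooth_fun_add smooth_fun_mult)
  with that show ?thesis by blast
qed

section \<open>Pushing a collar of the disk to its boundary\<close>

text \<open>Here \<open>s\<close> is a squared radius. The factor is 1 up to radius 1/4 and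
  \<open>1 / sqrt s\<close> from radius 1/2 on, where multiplying by it normalizes a vector to
  length 1; in between, \<open>(16 * s - 1) / 3\<close> runs from 0 to 1. Being 1 near the centre,
  it avoids the singularity of the normalization.\<close>

definition collar_factor :: "real \<Rightarrow> real" where
  "collar_factor s = 1 + smooth_step ((16 * s - 1) / 3) * (s powr (- 1 / 2) - 1)"

lemma collar_factor_large: "s \<ge> 1/4 \<Longrightarrow> collar_factor s = 1 / sqrt s"
  by (simp add: collar_factor_def smooth_step_eq_1 powr_minus_divide powr_half_sqrt)

lemma collar_factor_small: "s \<le> 1/16 \<Longrightarrow> collar_factor s = 1"
  by (simp add: collar_factor_def smooth_step_eq_0)

text \<open>With \<open>q = sqrt s\<close> and the blending weight \<open>\<sigma>\<close>, the
  product \<open>collar_factor s * q\<close> is the convex combination of \<open>q\<close> and 1 in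
  which 1 has weight \<open>\<sigma>\<close>. So the radius grows but does not exceed 1.\<close>

lemma collar_factor_bounds:
  assumes "0 \<le> s" "s \<le> 1"
  shows "collar_factor s \<ge> 1" "collar_factor s * sqrt s \<le> 1"
proof -
  have "collar_factor s \<ge> 1 \<and> collar_factor s * sqrt s \<le> 1"
  proof (cases "s > 0")
    case True
    define q where "q = sqrt s"
    define \<sigma> where "\<sigma> = smooth_step ((16 * s - 1) / 3)"
    have q: "0 < q" "q \<le> 1" using True assms by (auto simp: q_def)
    have \<sigma>: "0 \<le> \<sigma>" "\<sigma> \<le> 1" by (auto simp: \<sigma>_def smooth_step_nonneg smooth_step_le_1)
    have c: "collar_factor s = 1 + \<sigma> * (1 / q - 1)"
      using True by (simp add: collar_factor_def \<sigma>_def q_def powr_minus_divide powr_half_sqrt)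
    have "\<sigma> * (1 / q - 1) \<ge> 0" using q \<sigma> by (intro mult_nonneg_nonneg) auto
    moreover have "collar_factor s * q = 1 - (1 - \<sigma>) * (1 - q)"
      using q by (simp add: c field_simps)
    moreover have "(1 - \<sigma>) * (1 - q) \<ge> 0" using q \<sigma> by (intro mult_nonneg_nonneg) auto
    ultimately show ?thesis using c by (simp add: q_def)
  next
    case False
    then show ?thesis using assms by (simp add: collar_factor_small)
  qed
  then show "collar_factor s \<ge> 1" "collar_factor s * sqrt s \<le> 1" by auto
qed

text \<open>The power is singular at 0, but the factor is constant near 0. Smoothness holds on the
  open sets where \<open>f\<close> is below 1/16 and where it is positive, and these cover
  \<open>V\<close>.\<close>

lemma smooth_fun_collar_factor:
  assumes V: "openin (Euclidean_space m) V" and f: "smooth_fun m V f"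
  shows "smooth_fun m V (\<lambda>v. collar_factor (f v))"
proof -
  let ?A = "{v \<in> V. f v \<in> {..<1/16}}" and ?B = "{v \<in> V. f v \<in> {0<..}}"
  have o: "openin (Euclidean_space m) {v \<in> V. f v \<in> T}" if "open T" for T
    using openin_trans_full[OF _ V] smooth_fun_continuous[OF f] openin_subset[OF V] that
    by (fastforce simp: continuous_map_def Int_absorb1 inf_absorb2)
  have "smooth_fun m ?A (\<lambda>v. collar_factor (f v))"
    using o[of "{..<1/16}"] by (intro smooth_fun_cong[OF _ smooth_fun_const[of _ _ 1]]) (auto simp: collar_factor_small)
  moreover have "smooth_fun m ?B (\<lambda>v. collar_factor (f v))"
  proof -
    have oB: "openin (Euclidean_space m) ?B" by (rule o) simp
    have f': "smooth_fun m ?B f" by (rule smooth_fun_mono[OF f]) auto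
    have "smooth_fun m ?B (\<lambda>v. (16 * f v - 1) * (1 / 3))"
      by (intro smooth_fun_mult[of _ _ "\<lambda>v. 16 * f v - 1"] smooth_fun_mult[of _ _ "\<lambda>v. 16"]
          smooth_fun_diff f' smooth_fun_const)
    from smooth_fun_smooth_step[OF oB this] smooth_fun_powr[OF oB f', of "- 1 / 2"] show ?thesis
      unfolding collar_factor_def
      by (intro smooth_fun_add smooth_fun_mult smooth_fun_diff smooth_fun_const) simp_all
  qed
  ultimately have "smooth_fun m (\<Union>{?A, ?B}) (\<lambda>v. collar_factor (f v))"
    using o[of "{..<1/16}"] o[of "{0<..}"] by (intro smooth_fun_Union) auto
  moreover have "\<Union>{?A, ?B} = V" by (auto simp: not_less)
  ultimately show ?thesis by simp
qed

section \<open>The disk and its radial deformation\<close>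

abbreviation sqn :: "nat \<Rightarrow> (nat \<Rightarrow> real) \<Rightarrow> real" where
  "sqn n x \<equiv> \<Sum>i<n. (x i)\<^sup>2"

abbreviation disk_topology :: "nat \<Rightarrow> (nat \<Rightarrow> real) topology" where
  "disk_topology n \<equiv> subtopology (Euclidean_space n) (unit_disk n)"

lemma continuous_map_into_Euclidean:
  "continuous_map X (Euclidean_space n) f \<longleftrightarrow>
    (\<forall>i<n. continuous_map X euclideanreal (\<lambda>x. f x i)) \<and> f \<in> topspace X \<rightarrow> topspace (Euclidean_space n)"
  (is "_ \<longleftrightarrow> ?R")
proof
  assume "continuous_map X (Euclidean_space n) f"
  moreover have "continuous_map (Euclidean_space n) euclideanreal (\<lambda>x. x i)" for i
    using continuous_map_Euclidean_coordinate[of n UNIV] by simp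
  ultimately have "continuous_map X euclideanreal (\<lambda>x. f x i)" for i
    using continuous_map_compose[of X "Euclidean_space n" f euclideanreal "\<lambda>x. x i"] by (simp add: o_def)
  then show ?R
    using \<open>continuous_map X (Euclidean_space n) f\<close> by (auto simp: continuous_map_def)
next
  assume R: ?R
  then have "continuous_map X (Euclidean_space n) (\<lambda>x i. if i < n then f x i else 0)"
    by (simp add: continuous_map_componentwise_Euclidean_space)
  then show "continuous_map X (Euclidean_space n) f"
    by (rule continuous_map_eq) (use R in \<open>auto simp: topspace_Euclidean_space fun_eq_iff Pi_iff not_less\<close>)
qed

lemma smooth_fun_sqn: "(\<And>i. i < n \<Longrightarrow> smooth_fun m V (\<lambda>v. y v i)) \<Longrightarrow> smooth_fun m V (\<lambda>v. sqn n (y v))"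
  by (intro smooth_fun_sum smooth_fun_power2) auto

lemma continuous_map_sqn:
  "continuous_map X (Euclidean_space n) y \<Longrightarrow> continuous_map X euclideanreal (\<lambda>v. sqn n (y v))"
  by (intro continuous_map_sum continuous_map_real_pow) (auto simp: continuous_map_into_Euclidean)

lemma sqn_scale: "sqn n (\<lambda>i. c * x i) = c\<^sup>2 * sqn n x"
  by (simp add: power_mult_distrib sum_distrib_left)

lemma sqn_nonneg: "sqn n x \<ge> 0"
  by (simp add: sum_nonneg)

lemma topspace_nsphere: "topspace (nsphere n) = {x \<in> topspace (Euclidean_space (Suc n)). sqn (Suc n) x = 1}"
  by (auto simp: nsphere_def lessThan_Suc_atMost)

lemma unit_disk_subset: "unit_disk n \<subseteq> topspace (Euclidean_space n)"
  by (auto simp: unit_disk_def)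

lemma topspace_disk_topology [simp]: "topspace (disk_topology n) = unit_disk n"
  using unit_disk_subset by auto

lemma nsphere_subset_unit_disk: "topspace (nsphere n) \<subseteq> unit_disk (Suc n)"
  by (auto simp: topspace_nsphere unit_disk_def)

lemma nsphere_eq_subtopology: "nsphere n = subtopology (Euclidean_space (Suc n)) (topspace (nsphere n))"
  unfolding nsphere_def topspace_subtopology by (rule subtopology_restrict[symmetric])

lemma nsphere_eq: "nsphere n = subtopology (disk_topology (Suc n)) (topspace (nsphere n))"
  using nsphere_eq_subtopology[of n] nsphere_subset_unit_disk[of n]
  by (simp add: subtopology_subtopology Int_absorb1)

lemma closedin_nsphere: "closedin (Euclidean_space (Suc n)) (topspace (nsphere n))"
proof -
  have "continuous_map (Euclidean_space (Suc n)) euclideanreal (sqn (Suc n))"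
    using continuous_map_sqn[of "Euclidean_space (Suc n)" "Suc n" "\<lambda>x. x"] by (simp del: sum.lessThan_Suc)
  from closedin_continuous_map_preimage[OF this, of "{1}"] show ?thesis
    by (simp add: topspace_nsphere del: sum.lessThan_Suc)
qed

lemma closedin_disk_nsphere: "closedin (disk_topology (Suc n)) (topspace (nsphere n))"
  using closedin_nsphere nsphere_subset_unit_disk by (rule closedin_subset_topspace)

lemma compactin_unit_disk: "compactin (Euclidean_space n) (unit_disk n)"
  using compactin_sqdist_ball[of n "\<lambda>_. 0" 1] by (simp add: unit_disk_def)

lemma continuous_map_collar_factor:
  assumes "continuous_map X (Euclidean_space n) y"
  shows "continuous_map X euclideanreal (\<lambda>v. collar_factor (sqn n (y v)))"
proof -
  have "smooth_fun n (topspace (Euclidean_space n)) (\<lambda>v. collar_factor (sqn n v))"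
    by (intro smooth_fun_collar_factor smooth_fun_sqn smooth_fun_coordinate openin_topspace)
  then have "continuous_map (Euclidean_space n) euclideanreal (\<lambda>v. collar_factor (sqn n v))"
    using smooth_fun_continuous by fastforce
  from continuous_map_compose[OF assms this] show ?thesis by (simp add: o_def)
qed

text \<open>A scaling along rays, linear in the time \<open>t\<close>. The time is an argument so
  that it can itself vary smoothly with the point, as it does when a cutoff function is inserted for
  it.\<close>

definition collar_push :: "nat \<Rightarrow> real \<Rightarrow> (nat \<Rightarrow> real) \<Rightarrow> nat \<Rightarrow> real" where
  "collar_push n t x = (\<lambda>i. (1 - t + t * collar_factor (sqn n x)) * x i)"

lemma sqn_collar_push: "sqn n (collar_push n t x) = (1 - t + t * collar_factor (sqn n x))\<^sup>2 * sqn n x"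
  unfolding collar_push_def by (rule sqn_scale)

lemma collar_push_in_Euclidean:
  "x \<in> topspace (Euclidean_space n) \<Longrightarrow> collar_push n t x \<in> topspace (Euclidean_space n)"
  by (simp add: collar_push_def topspace_Euclidean_space)

text \<open>The new radius is a convex combination of the old one and the radius after the full
  push, both at most 1.\<close>

lemma collar_push_in_disk:
  assumes x: "x \<in> unit_disk n" and t: "0 \<le> t" "t \<le> 1"
  shows "collar_push n t x \<in> unit_disk n"
proof -
  define s q where "s = sqn n x" and "q = sqrt s"
  have s: "0 \<le> s" "s \<le> 1" using x sqn_nonneg by (auto simp: s_def unit_disk_def)
  define c where "c = 1 - t + t * collar_factor s"
  have "c \<ge> 0" using collar_factor_bounds(1)[OF s] t by (simp add: c_def)
  moreover have "c * q = (1 - t) * q + t * (collar_factor s * q)"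
    by (simp add: c_def algebra_simps)
  moreover have "(1 - t) * q + t * (collar_factor s * q) \<le> (1 - t) * 1 + t * 1"
    using collar_factor_bounds(2)[OF s] t s by (intro add_mono mult_left_mono) (auto simp: q_def)
  moreover have "0 \<le> q" using s by (simp add: q_def)
  ultimately have "c * q \<le> 1" "0 \<le> c * q" using mult_nonneg_nonneg[of c q] by auto
  then have "(c * q)\<^sup>2 \<le> 1" by (simp add: power_le_one)
  then have "sqn n (collar_push n t x) \<le> 1"
    using s by (simp add: sqn_collar_push c_def s_def q_def power_mult_distrib)
  then show ?thesis
    using x collar_push_in_Euclidean by (auto simp: unit_disk_def)
qed

lemma sqn_collar_push_1: "sqn n x \<ge> 1/4 \<Longrightarrow> sqn n (collar_push n 1 x) = 1"
  unfolding sqn_collar_push by (simp add: collar_factor_large power_divide)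

text \<open>Points outside the disk land on the sphere. So the push at time 1 is defined on the
  whole space R^n, an open domain as a plot requires.\<close>

lemma collar_push_1_in_disk:
  assumes "x \<in> topspace (Euclidean_space n)"
  shows "collar_push n 1 x \<in> unit_disk n"
proof (cases "sqn n x \<le> 1")
  case True
  then show ?thesis using assms by (intro collar_push_in_disk) (auto simp: unit_disk_def)
next
  case False
  then show ?thesis using assms sqn_collar_push_1 collar_push_in_Euclidean by (auto simp: unit_disk_def)
qed

lemma collar_push_0: "collar_push n 0 x = x"
  by (simp add: collar_push_def)

lemma collar_push_boundary: "sqn n x = 1 \<Longrightarrow> collar_push n t x = x"
  by (simp add: collar_push_def collar_factor_large)

lemma smooth_fun_collar_push:
  assumes "openin (Euclidean_space m) V" "smooth_fun m V \<tau>" "\<And>i. i < n \<Longrightarrow> smooth_fun m V (\<lambda>v. y v i)" "i < n"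
  shows "smooth_fun m V (\<lambda>v. collar_push n (\<tau> v) (y v) i)"
  unfolding collar_push_def
  by (intro smooth_fun_mult smooth_fun_add smooth_fun_diff smooth_fun_const smooth_fun_collar_factor
      smooth_fun_sqn assms)

lemma continuous_map_collar_push:
  assumes "continuous_map X euclideanreal \<tau>" "continuous_map X (Euclidean_space n) y"
  shows "continuous_map X (Euclidean_space n) (\<lambda>v. collar_push n (\<tau> v) (y v))"
proof -
  have "continuous_map X euclideanreal (\<lambda>v. (1 - \<tau> v + \<tau> v * collar_factor (sqn n (y v))) * y v i)" if "i < n" for i
    using assms(2) that
    by (intro continuous_map_real_mult continuous_map_add continuous_map_diff assms continuous_map_collar_factor)
       (auto simp: continuous_map_into_Euclidean)
  then show ?thesis
    using assms(2) collar_push_in_Euclidean unfolding continuous_map_into_Euclidean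
    by (auto simp: collar_push_def Pi_iff)
qed

text \<open>Along the ray through \<open>w\<close>, the radius after the push varies continuously
  from 0 to 1 with the radius before it, so the intermediate value theorem provides a preimage. For
  \<open>w = 0\<close> there is no ray, but this point is fixed.\<close>

lemma collar_push_1_surj:
  assumes w: "w \<in> unit_disk n"
  obtains x where "x \<in> unit_disk n" "collar_push n 1 x = w"
proof (cases "sqn n w = 0")
  case True
  then have "collar_push n 1 w = w" by (simp add: collar_push_def collar_factor_small)
  with w that show ?thesis by blast
next
  case False
  define q where "q = sqrt (sqn n w)"
  have q: "0 < q" "q \<le> 1" "q\<^sup>2 = sqn n w"
    using False sqn_nonneg[of w n] w by (auto simp: q_def unit_disk_def)
  define x where "x t = (\<lambda>i. (t / q) * w i)" for t
  have sx: "sqn n (x t) = t\<^sup>2" for t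
    unfolding x_def sqn_scale using False by (simp add: power_divide flip: q(3))
  have xE: "x t \<in> topspace (Euclidean_space n)" for t
    using w by (simp add: x_def unit_disk_def topspace_Euclidean_space)
  have "continuous_map euclideanreal (Euclidean_space n) x"
    unfolding continuous_map_into_Euclidean using xE q
    by (auto simp: x_def intro!: continuous_intros)
  then have "continuous_map euclideanreal euclideanreal (\<lambda>t. collar_factor (sqn n (x t)))"
    by (rule continuous_map_collar_factor)
  then have "continuous_on UNIV (\<lambda>t. collar_factor (t\<^sup>2))"
    by (simp add: sx)
  then have "continuous_on {0..1} (\<lambda>t. collar_factor (t\<^sup>2) * t)"
    by (intro continuous_on_mult continuous_on_id) (auto intro: continuous_on_subset)
  then obtain t where t: "0 \<le> t" "t \<le> 1" "collar_factor (t\<^sup>2) * t = q"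
    using IVT'[of "\<lambda>t. collar_factor (t\<^sup>2) * t" 0 q 1] q by (auto simp: collar_factor_large)
  have "collar_push n 1 (x t) = (\<lambda>i. (collar_factor (t\<^sup>2) * t / q) * w i)"
    by (simp add: collar_push_def sx) (simp add: x_def mult_ac)
  also have "\<dots> = w" using t q by simp
  finally have "collar_push n 1 (x t) = w" .
  moreover have "x t \<in> unit_disk n"
    using xE sx t by (simp add: unit_disk_def power_le_one)
  ultimately show ?thesis using that by blast
qed

text \<open>The complement of \<open>W\<close> is the image of a closed part of the compact disk,
  hence compact and closed. This test of openness by one smooth map from R^n serves both for the
  D-topology of disks and for the numerical generation of CW complexes.\<close>

lemma openin_disk_if_push:
  assumes W: "W \<subseteq> unit_disk n"
    and op: "openin (Euclidean_space n) {x \<in> topspace (Euclidean_space n). collar_push n 1 x \<in> W}"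
  shows "openin (disk_topology n) W"
proof -
  let ?O = "{x \<in> topspace (Euclidean_space n). collar_push n 1 x \<in> W}"
  have "closedin (Euclidean_space n) (topspace (Euclidean_space n) - ?O)"
    using op by blast
  then have "compactin (Euclidean_space n) ((topspace (Euclidean_space n) - ?O) \<inter> unit_disk n)"
    by (rule closed_Int_compactin[OF _ compactin_unit_disk])
  moreover have "continuous_map (Euclidean_space n) (Euclidean_space n) (\<lambda>x. collar_push n 1 x)"
    by (rule continuous_map_collar_push) auto
  ultimately have "compactin (Euclidean_space n) (collar_push n 1 ` ((topspace (Euclidean_space n) - ?O) \<inter> unit_disk n))"
    by (rule image_compactin)
  moreover have "collar_push n 1 ` ((topspace (Euclidean_space n) - ?O) \<inter> unit_disk n) = unit_disk n - W"
  proof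
    show "collar_push n 1 ` ((topspace (Euclidean_space n) - ?O) \<inter> unit_disk n) \<subseteq> unit_disk n - W"
      using collar_push_1_in_disk by auto
    show "unit_disk n - W \<subseteq> collar_push n 1 ` ((topspace (Euclidean_space n) - ?O) \<inter> unit_disk n)"
    proof
      fix w assume w: "w \<in> unit_disk n - W"
      then obtain x where "x \<in> unit_disk n" "collar_push n 1 x = w" using collar_push_1_surj by blast
      then show "w \<in> collar_push n 1 ` ((topspace (Euclidean_space n) - ?O) \<inter> unit_disk n)"
        using w unit_disk_subset by (intro image_eqI[of _ _ x]) auto
    qed
  qed
  ultimately have "closedin (Euclidean_space n) (unit_disk n - W)"
    using compactin_imp_closedin Hausdorff_Euclidean_space by metis
  then have "closedin (disk_topology n) (unit_disk n - W)"
    by (metis Diff_subset closedin_subset_topspace)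
  then show ?thesis
    using W by (metis double_diff openin_closedin_eq topspace_disk_topology order_refl)
qed

section \<open>Plots of generated diffeologies\<close>

lemma euclidean_smooth_id:
  "openin (Euclidean_space n) U \<Longrightarrow> openin (Euclidean_space n) V \<Longrightarrow> U \<subseteq> V \<Longrightarrow> euclidean_smooth n U n V (\<lambda>x. x)"
  by (auto simp: euclidean_smooth_def smooth_fun_coordinate)

lemma euclidean_smooth_comp:
  assumes "euclidean_smooth m V n U \<phi>" "euclidean_smooth l W m V \<psi>"
  shows "euclidean_smooth l W n U (\<lambda>x. \<phi> (\<psi> x))"
proof -
  have "smooth_fun l W (\<lambda>x. \<phi> (\<psi> x) i)" if "i < n" for i
    using smooth_fun_compose[OF assms(2), of "\<lambda>y. \<phi> y i"] assms(1) that by (simp add: euclidean_smooth_def)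
  then show ?thesis
    using assms by (auto simp: euclidean_smooth_def Pi_iff)
qed

lemma euclidean_smooth_continuous:
  assumes "euclidean_smooth m V n U \<phi>"
  shows "continuous_map (subtopology (Euclidean_space m) V) (Euclidean_space n) \<phi>"
proof -
  have "U \<subseteq> topspace (Euclidean_space n)" using assms openin_subset by (auto simp: euclidean_smooth_def)
  then show ?thesis
    using assms smooth_fun_continuous by (auto simp: euclidean_smooth_def continuous_map_into_Euclidean Pi_iff)
qed

lemma openin_preimage:
  assumes "openin X V" "continuous_map (subtopology X V) Y f" "openin Y W"
  shows "openin X {v \<in> V. f v \<in> W}"
proof -
  have "openin (subtopology X V) {v \<in> topspace (subtopology X V). f v \<in> W}"
    using assms(2,3) by (rule openin_continuous_map_preimage)
  moreover have "topspace (subtopology X V) = V" using openin_subset[OF assms(1)] by auto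
  ultimately show ?thesis using openin_trans_full assms(1) by metis
qed

lemma openin_euclidean_smooth_preimage:
  "euclidean_smooth m V n U \<phi> \<Longrightarrow> openin (Euclidean_space n) W \<Longrightarrow> openin (Euclidean_space m) {v \<in> V. \<phi> v \<in> W}"
  using openin_preimage[OF _ euclidean_smooth_continuous] by (metis euclidean_smooth_def)

lemma euclidean_smooth_restrict:
  assumes "euclidean_smooth m V n U \<phi>" "openin (Euclidean_space m) V'" "V' \<subseteq> V"
    "openin (Euclidean_space n) U'" "\<phi> \<in> V' \<rightarrow> U'"
  shows "euclidean_smooth m V' n U' \<phi>"
  using assms smooth_fun_mono by (auto simp: euclidean_smooth_def)

lemma plot_mono:
  assumes "diffeological_space X" "plot X n U P" "openin (Euclidean_space n) W" "W \<subseteq> U"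
  shows "plot X n W P"
  using plot_comp[OF assms(1,2) euclidean_smooth_id[OF assms(3) plot_openin[OF assms(1,2)] assms(4)]]
  by (simp add: o_def)

lemma plot_locally:
  assumes X: "diffeological_space X" and "\<And>u. u \<in> U \<Longrightarrow> \<exists>W. openin (Euclidean_space n) W \<and> u \<in> W \<and> W \<subseteq> U \<and> plot X n W P"
  shows "plot X n U P"
proof -
  let ?\<U> = "{W. openin (Euclidean_space n) W \<and> W \<subseteq> U \<and> plot X n W P}"
  have "plot X n (\<Union>?\<U>) P" by (rule plot_cover[OF X]) auto
  moreover have "\<Union>?\<U> = U" using assms(2) by blast
  ultimately show ?thesis by simp
qed

section \<open>Subset diffeologies and discrete diffeologies\<close>

lemma diffeological_space_subset: "diffeological_space (subset_diffeology n A)"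
  unfolding diffeological_space_def
proof (intro conjI allI impI; (elim conjE)?)
  fix m U P Q assume *: "plot (subset_diffeology n A) m U P" "\<forall>u\<in>U. P u = Q u"
  have "smooth_fun m U (\<lambda>u. Q u i)" if "i < n" for i
    by (rule smooth_fun_cong[of m U "\<lambda>u. P u i"]) (use * that in \<open>auto simp: subset_diffeology_def\<close>)
  then show "plot (subset_diffeology n A) m U Q"
    using * by (auto simp: subset_diffeology_def Pi_iff)
next
  fix m U P l V \<phi> assume "plot (subset_diffeology n A) m U P" "euclidean_smooth l V m U \<phi>"
  then show "plot (subset_diffeology n A) l V (P \<circ> \<phi>)"
    by (auto simp: subset_diffeology_def intro: smooth_fun_compose) (auto simp: euclidean_smooth_def Pi_iff)
next
  fix m P \<U> assume "\<forall>W\<in>\<U>. openin (Euclidean_space m) W \<and> plot (subset_diffeology n A) m W P"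
  then show "plot (subset_diffeology n A) m (\<Union>\<U>) P"
    by (auto simp: subset_diffeology_def intro!: smooth_fun_Union)
qed (auto simp: subset_diffeology_def smooth_fun_const)

lemma points_subset_diffeology [simp]: "points (subset_diffeology n A) = A"
  by (simp add: subset_diffeology_def)

lemma plot_subset_diffeology:
  "plot (subset_diffeology n A) m U P \<longleftrightarrow>
    openin (Euclidean_space m) U \<and> P \<in> U \<rightarrow> A \<and> (\<forall>i<n. smooth_fun m U (\<lambda>u. P u i))"
  by (simp add: subset_diffeology_def)

lemma plot_discrete_diffeology:
  "plot (discrete_diffeology S) n U P \<longleftrightarrow> openin (Euclidean_space n) U \<and> P \<in> U \<rightarrow> S \<and>
     (\<forall>u\<in>U. \<exists>W. openin (Euclidean_space n) W \<and> u \<in> W \<and> W \<subseteq> U \<and> (\<forall>w\<in>W. P w = P u))"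
  by (simp add: discrete_diffeology_def)

lemma points_discrete_diffeology [simp]: "points (discrete_diffeology S) = S"
  by (simp add: discrete_diffeology_def)

lemma diffeological_space_discrete: "diffeological_space (discrete_diffeology S)"
  unfolding diffeological_space_def
proof (intro conjI allI impI; (elim conjE)?)
  fix n U P Q assume *: "plot (discrete_diffeology S) n U P" "\<forall>u\<in>U. P u = Q u"
  have "\<exists>W. openin (Euclidean_space n) W \<and> u \<in> W \<and> W \<subseteq> U \<and> (\<forall>w\<in>W. Q w = Q u)" if u: "u \<in> U" for u
  proof -
    obtain W where W: "openin (Euclidean_space n) W" "u \<in> W" "W \<subseteq> U" "\<forall>w\<in>W. P w = P u"
      using * u unfolding plot_discrete_diffeology by blast
    then have "\<forall>w\<in>W. Q w = Q u" using *(2) by (metis subsetD)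
    with W show ?thesis by blast
  qed
  moreover have "Q \<in> U \<rightarrow> S" using * by (auto simp: plot_discrete_diffeology Pi_iff simp del: ball_simps)
  ultimately show "plot (discrete_diffeology S) n U Q"
    using *(1) unfolding plot_discrete_diffeology by blast
next
  fix n U P m V \<phi> assume *: "plot (discrete_diffeology S) n U P" "euclidean_smooth m V n U \<phi>"
  have \<phi>: "\<phi> v \<in> U" if "v \<in> V" for v using *(2) that by (auto simp: euclidean_smooth_def)
  have "\<exists>W. openin (Euclidean_space m) W \<and> v \<in> W \<and> W \<subseteq> V \<and> (\<forall>w\<in>W. (P \<circ> \<phi>) w = (P \<circ> \<phi>) v)" if v: "v \<in> V" for v
  proof -
    obtain W where "openin (Euclidean_space n) W" "\<phi> v \<in> W" "W \<subseteq> U" "\<forall>w\<in>W. P w = P (\<phi> v)"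
      using * \<phi>[OF v] unfolding plot_discrete_diffeology by blast
    then show ?thesis using openin_euclidean_smooth_preimage[OF *(2), of W] v
      unfolding o_apply by (intro exI[of _ "{v \<in> V. \<phi> v \<in> W}"]) blast
  qed
  moreover have "P \<circ> \<phi> \<in> V \<rightarrow> S" using *(1) \<phi> unfolding plot_discrete_diffeology Pi_iff o_apply by blast
  ultimately show "plot (discrete_diffeology S) m V (P \<circ> \<phi>)"
    using *(2) unfolding plot_discrete_diffeology euclidean_smooth_def by blast
next
  fix n U x assume "openin (Euclidean_space n) U" "x \<in> points (discrete_diffeology S)"
  then show "plot (discrete_diffeology S) n U (\<lambda>_. x)" by (auto simp: plot_discrete_diffeology)
next
  fix n P \<U> assume *: "\<forall>W\<in>\<U>. openin (Euclidean_space n) W \<and> plot (discrete_diffeology S) n W P"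
  then have "openin (Euclidean_space n) (\<Union>\<U>)" by blast
  then show "plot (discrete_diffeology S) n (\<Union>\<U>) P"
    using * unfolding plot_discrete_diffeology by (auto simp only: Pi_iff Union_iff) (meson Union_upper subset_trans)
qed (auto simp only: plot_discrete_diffeology points_discrete_diffeology)

lemma plot_generator:
  "(n, U, P) \<in> G \<Longrightarrow> openin (Euclidean_space n) U \<Longrightarrow> P \<in> U \<rightarrow> S \<Longrightarrow> plot (generated_diffeology S G) n U P"
  by (auto simp: plot_generated_diffeology)

text \<open>The maps that satisfy this locally form a diffeology themselves, so they include all plots of the
  generated one.\<close>

definition locally_generated ::
  "'a set \<Rightarrow> (nat \<times> (nat \<Rightarrow> real) set \<times> ((nat \<Rightarrow> real) \<Rightarrow> 'a)) set \<Rightarrow> nat \<Rightarrow> (nat \<Rightarrow> real) set \<Rightarrow> ((nat \<Rightarrow> real) \<Rightarrow> 'a) \<Rightarrow> bool" where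
  "locally_generated S G n W P \<longleftrightarrow> (\<exists>s\<in>S. \<forall>w\<in>W. P w = s) \<or>
     (\<exists>m V Q \<phi>. (m, V, Q) \<in> G \<and> euclidean_smooth n W m V \<phi> \<and> (\<forall>w\<in>W. P w = Q (\<phi> w)))"

lemma locally_generated_cong:
  assumes "locally_generated S G n W P" "\<And>w. w \<in> W \<Longrightarrow> P w = Q w"
  shows "locally_generated S G n W Q"
  using assms(1) unfolding locally_generated_def
proof (elim disjE exE bexE conjE)
  fix s assume "s \<in> S" "\<forall>w\<in>W. P w = s"
  then have "\<exists>s\<in>S. \<forall>w\<in>W. Q w = s" using assms(2) by force
  then show "(\<exists>s\<in>S. \<forall>w\<in>W. Q w = s) \<or> (\<exists>m V R \<phi>. (m, V, R) \<in> G \<and>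
      euclidean_smooth n W m V \<phi> \<and> (\<forall>w\<in>W. Q w = R (\<phi> w)))" ..
next
  fix m V R \<phi> assume "(m, V, R) \<in> G" "euclidean_smooth n W m V \<phi>" "\<forall>w\<in>W. P w = R (\<phi> w)"
  then have "\<exists>m V R \<phi>. (m, V, R) \<in> G \<and> euclidean_smooth n W m V \<phi> \<and> (\<forall>w\<in>W. Q w = R (\<phi> w))"
    using assms(2) by (intro exI[of _ m] exI[of _ V] exI[of _ R] exI[of _ \<phi>]) auto
  then show "(\<exists>s\<in>S. \<forall>w\<in>W. Q w = s) \<or> (\<exists>m V R \<phi>. (m, V, R) \<in> G \<and>
      euclidean_smooth n W m V \<phi> \<and> (\<forall>w\<in>W. Q w = R (\<phi> w)))" ..
qed

text \<open>Replaces the intersection over all diffeologies in \<open>generated_diffeology\<close>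
  by an explicit description near each point. The constant case is there because the generators need
  not reach every point of \<open>S\<close>.\<close>

lemma plot_generated_local:
  assumes G: "\<And>m V Q. (m, V, Q) \<in> G \<Longrightarrow> openin (Euclidean_space m) V \<and> Q \<in> V \<rightarrow> S"
    and P: "plot (generated_diffeology S G) n U P" and u: "u \<in> U"
  obtains W where "openin (Euclidean_space n) W" "u \<in> W" "W \<subseteq> U" "locally_generated S G n W P"
proof -
  define L where "L n U P \<longleftrightarrow> openin (Euclidean_space n) U \<and> P \<in> U \<rightarrow> S \<and>
    (\<forall>u\<in>U. \<exists>W. openin (Euclidean_space n) W \<and> u \<in> W \<and> W \<subseteq> U \<and> locally_generated S G n W P)" for n U P
  define E where "E = \<lparr>points = S, plot = L\<rparr>"
  have plotE: "plot E = L" and pointsE: "points E = S" by (simp_all add: E_def)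
  have "diffeological_space E"
    unfolding diffeological_space_def
  proof (intro conjI allI impI; (elim conjE)?)
    fix n U P Q assume *: "plot E n U P" "\<forall>u\<in>U. P u = Q u"
    have "locally_generated S G n W Q" if "locally_generated S G n W P" "W \<subseteq> U" for W
      by (rule locally_generated_cong[OF that(1)]) (use *(2) that(2) in blast)
    moreover have "Q \<in> U \<rightarrow> S" using * unfolding plotE L_def by (metis (no_types, lifting) Pi_iff)
    ultimately show "plot E n U Q"
      using *(1) unfolding plotE L_def by blast
  next
    fix n U P m V \<phi> assume *: "plot E n U P" "euclidean_smooth m V n U \<phi>"
    have "\<exists>W. openin (Euclidean_space m) W \<and> v \<in> W \<and> W \<subseteq> V \<and> locally_generated S G m W (P \<circ> \<phi>)" if v: "v \<in> V" for v
    proof -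
      have "\<phi> v \<in> U" using *(2) v by (auto simp: euclidean_smooth_def)
      then obtain W where W: "openin (Euclidean_space n) W" "\<phi> v \<in> W" "W \<subseteq> U" "locally_generated S G n W P"
        using *(1) unfolding plotE L_def by blast
      let ?W = "{v \<in> V. \<phi> v \<in> W}"
      have o: "openin (Euclidean_space m) ?W" using openin_euclidean_smooth_preimage[OF *(2) W(1)] .
      have s: "euclidean_smooth m ?W n W \<phi>"
        by (rule euclidean_smooth_restrict[OF *(2) o]) (use W in auto)
      have "locally_generated S G m ?W (P \<circ> \<phi>)"
        using W(4) unfolding locally_generated_def
      proof (elim disjE exE conjE)
        assume "\<exists>s\<in>S. \<forall>w\<in>W. P w = s"
        then show "(\<exists>s\<in>S. \<forall>w\<in>?W. (P \<circ> \<phi>) w = s) \<or> (\<exists>l T Q \<psi>. (l, T, Q) \<in> G \<and>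
            euclidean_smooth m ?W l T \<psi> \<and> (\<forall>w\<in>?W. (P \<circ> \<phi>) w = Q (\<psi> w)))" by auto
      next
        fix l T Q \<psi> assume "(l, T, Q) \<in> G" "euclidean_smooth n W l T \<psi>" "\<forall>w\<in>W. P w = Q (\<psi> w)"
        then show "(\<exists>s\<in>S. \<forall>w\<in>?W. (P \<circ> \<phi>) w = s) \<or> (\<exists>l T Q \<psi>. (l, T, Q) \<in> G \<and>
            euclidean_smooth m ?W l T \<psi> \<and> (\<forall>w\<in>?W. (P \<circ> \<phi>) w = Q (\<psi> w)))"
          using euclidean_smooth_comp[OF _ s]
          by (intro disjI2 exI[of _ l] exI[of _ T] exI[of _ Q] exI[of _ "\<lambda>x. \<psi> (\<phi> x)"]) auto
      qed
      then show ?thesis using o v W(2) by blast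
    qed
    moreover have "P \<circ> \<phi> \<in> V \<rightarrow> S" "openin (Euclidean_space m) V"
      using * unfolding plotE L_def euclidean_smooth_def by auto
    ultimately show "plot E m V (P \<circ> \<phi>)"
      unfolding plotE L_def by blast
  next
    fix n U x assume "openin (Euclidean_space n) U" "x \<in> points E"
    then show "plot E n U (\<lambda>_. x)"
      unfolding plotE pointsE L_def locally_generated_def by blast
  next
    fix n P \<U> assume *: "\<forall>W\<in>\<U>. openin (Euclidean_space n) W \<and> plot E n W P"
    show "plot E n (\<Union>\<U>) P"
      unfolding plotE L_def
    proof (intro conjI ballI)
      show "openin (Euclidean_space n) (\<Union>\<U>)" using * by blast
      show "P \<in> \<Union>\<U> \<rightarrow> S" using * unfolding plotE L_def by blast
      fix u assume "u \<in> \<Union>\<U>"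
      then obtain W where W: "W \<in> \<U>" "u \<in> W" by blast
      have "L n W P" using * W(1) by (simp add: plotE)
      then obtain T where "openin (Euclidean_space n) T" "u \<in> T" "T \<subseteq> W" "locally_generated S G n T P"
        using W(2) unfolding L_def by blast
      with W(1) show "\<exists>W. openin (Euclidean_space n) W \<and> u \<in> W \<and> W \<subseteq> \<Union>\<U> \<and> locally_generated S G n W P"
        by blast
    qed
  qed (unfold plotE pointsE L_def, blast+)
  moreover have "plot E m V Q" if "(m, V, Q) \<in> G" for m V Q
  proof -
    have "locally_generated S G m V Q"
      using that euclidean_smooth_id[of m V V] G[OF that] unfolding locally_generated_def by blast
    then show ?thesis
      using G[OF that] unfolding plotE L_def by blast
  qed
  ultimately have "plot E n U P"
    using P pointsE unfolding plot_generated_diffeology by blast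
  with u that show ?thesis unfolding plotE L_def by blast
qed

section \<open>The D-topology of generated diffeologies\<close>

lemma topspace_D_topology [simp]:
  assumes "diffeological_space X"
  shows "topspace (D_topology X) = points X"
proof
  show "topspace (D_topology X) \<subseteq> points X"
    using openin_D_topology[OF assms, of "topspace (D_topology X)"] by simp
  have "{u \<in> U. P u \<in> points X} = U" if "plot X n U P" for n U P
    using plot_funcset[OF assms that] by auto
  then have "openin (D_topology X) (points X)"
    using openin_D_topology[OF assms] plot_openin[OF assms] by auto
  then show "points X \<subseteq> topspace (D_topology X)" by (rule openin_subset)
qed

lemma continuous_map_plot:
  assumes X: "diffeological_space X" and P: "plot X n U P"
  shows "continuous_map (subtopology (Euclidean_space n) U) (D_topology X) P"
  unfolding continuous_map
proof (intro conjI allI impI)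
  have U: "openin (Euclidean_space n) U" using plot_openin[OF X P] .
  then have t: "topspace (subtopology (Euclidean_space n) U) = U" using openin_subset[of "Euclidean_space n" U] by auto
  show "P ` topspace (subtopology (Euclidean_space n) U) \<subseteq> topspace (D_topology X)"
    using plot_funcset[OF X P] t X by auto
  fix W assume "openin (D_topology X) W"
  then have "openin (Euclidean_space n) {u \<in> U. P u \<in> W}"
    using openin_D_topology[OF X] P by blast
  then show "openin (subtopology (Euclidean_space n) U) {u \<in> topspace (subtopology (Euclidean_space n) U). P u \<in> W}"
    unfolding t using U by (simp add: openin_open_subtopology Collect_restrict)
qed

text \<open>Near each point, a plot is constant or a generator preceded by a smooth, hence
  continuous, map. Openness of preimages therefore passes from the generators to all plots.\<close>

lemma openin_D_generated:
  assumes G: "\<And>m V Q. (m, V, Q) \<in> G \<Longrightarrow> openin (Euclidean_space m) V \<and> Q \<in> V \<rightarrow> S"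
  shows "openin (D_topology (generated_diffeology S G)) W \<longleftrightarrow>
    W \<subseteq> S \<and> (\<forall>m V Q. (m, V, Q) \<in> G \<longrightarrow> openin (Euclidean_space m) {v \<in> V. Q v \<in> W})"
    (is "_ \<longleftrightarrow> ?R")
proof
  assume "openin (D_topology (generated_diffeology S G)) W"
  then show ?R
    using G plot_generator[of _ _ _ G S] openin_D_topology[OF diffeological_space_generated, of S G W] by auto
next
  assume R: ?R
  have "openin (Euclidean_space n) {u \<in> U. P u \<in> W}" if P: "plot (generated_diffeology S G) n U P" for n U P
  proof (subst openin_subopen, clarify)
    fix u assume u: "u \<in> U" "P u \<in> W"
    obtain O' where O: "openin (Euclidean_space n) O'" "u \<in> O'" "O' \<subseteq> U" "locally_generated S G n O' P"
      using plot_generated_local[OF G P u(1)] by blast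
    have "openin (Euclidean_space n) {w \<in> O'. P w \<in> W}"
      using O(4) unfolding locally_generated_def
    proof (elim disjE exE bexE conjE)
      fix s assume "\<forall>w\<in>O'. P w = s"
      then have "{w \<in> O'. P w \<in> W} = O'" using u(2) O(2) by auto
      then show ?thesis using O(1) by simp
    next
      fix m V Q \<phi>
      assume *: "(m, V, Q) \<in> G" "euclidean_smooth n O' m V \<phi>" "\<forall>w\<in>O'. P w = Q (\<phi> w)"
      then have "{w \<in> O'. P w \<in> W} = {w \<in> O'. \<phi> w \<in> {v \<in> V. Q v \<in> W}}"
        by (auto simp: euclidean_smooth_def)
      moreover have "openin (Euclidean_space m) {v \<in> V. Q v \<in> W}" using R *(1) by blast
      ultimately show ?thesis using openin_euclidean_smooth_preimage[OF *(2), of "{v \<in> V. Q v \<in> W}"] by (simp only:)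
    qed
    then show "\<exists>T. openin (Euclidean_space n) T \<and> u \<in> T \<and> T \<subseteq> {u \<in> U. P u \<in> W}"
      using O u by (intro exI[of _ "{w \<in> O'. P w \<in> W}"]) auto
  qed
  with R show "openin (D_topology (generated_diffeology S G)) W"
    by (simp add: openin_D_topology[OF diffeological_space_generated])
qed

text \<open>Plots are continuous for the subspace topology, so the D-topology is at least as fine.
  That it is no finer, even at the boundary, is detected by the single plot
  \<open>collar_push n 1\<close>.\<close>

lemma openin_D_disk: "openin (D_topology (smooth_disk n)) W \<longleftrightarrow> openin (disk_topology n) W"
proof
  assume W: "openin (D_topology (smooth_disk n)) W"
  have "plot (smooth_disk n) n (topspace (Euclidean_space n)) (collar_push n 1)"
    unfolding plot_subset_diffeology
    by (auto intro!: collar_push_1_in_disk smooth_fun_collar_push smooth_fun_const smooth_fun_coordinate)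
  then show "openin (disk_topology n) W"
    using W openin_D_topology[OF diffeological_space_subset]
    by (intro openin_disk_if_push) auto
next
  assume W: "openin (disk_topology n) W"
  then obtain T where T: "openin (Euclidean_space n) T" "W = T \<inter> unit_disk n"
    by (auto simp: openin_subtopology)
  have "openin (Euclidean_space m) {u \<in> U. P u \<in> W}" if P: "plot (smooth_disk n) m U P" for m U P
  proof -
    have "continuous_map (subtopology (Euclidean_space m) U) (Euclidean_space n) P"
      using P smooth_fun_continuous unit_disk_subset
      unfolding continuous_map_into_Euclidean plot_subset_diffeology by fastforce
    then have "openin (Euclidean_space m) {u \<in> U. P u \<in> T}"
      using P T(1) openin_preimage unfolding plot_subset_diffeology by blast
    moreover have "{u \<in> U. P u \<in> W} = {u \<in> U. P u \<in> T}"
      using P T(2) by (auto simp: plot_subset_diffeology)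
    ultimately show ?thesis by simp
  qed
  then show "openin (D_topology (smooth_disk n)) W"
    using T(2) by (simp add: openin_D_topology[OF diffeological_space_subset])
qed

section \<open>Cell attachments\<close>

lemma openin_tube:
  assumes Q: "openin (prod_topology J X) Q" and C: "compactin J C"
  shows "openin X {x \<in> topspace X. C \<times> {x} \<subseteq> Q}"
proof (subst openin_subopen, clarify)
  fix x assume x: "x \<in> topspace X" "C \<times> {x} \<subseteq> Q"
  obtain U V where UV: "openin J U" "openin X V" "C \<subseteq> U" "x \<in> V" "U \<times> V \<subseteq> Q"
    using tube_lemma_left[OF Q C x] by blast
  then have "V \<subseteq> {x \<in> topspace X. C \<times> {x} \<subseteq> Q}"
    using openin_subset[OF UV(2)] by blast
  with UV show "\<exists>T. openin X T \<and> x \<in> T \<and> T \<subseteq> {x \<in> topspace X. C \<times> {x} \<subseteq> Q}"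
    by blast
qed

text \<open>Each condition concerns a set in one factor alone, so it can be tested on the pieces of
  a space with a final topology. In this form the proof uses the fact that the product with the
  compact interval preserves such topologies.\<close>

lemma openin_prod_interval:
  fixes P :: "(real \<times> 'a) set"
  assumes sub: "P \<subseteq> {0..1} \<times> topspace Z"
    and slice: "\<And>z. z \<in> topspace Z \<Longrightarrow> openin (top_of_set {0..1}) {t. (t, z) \<in> P}"
    and tube: "\<And>C. compactin (top_of_set {0..1}) C \<Longrightarrow> openin Z {z \<in> topspace Z. C \<times> {z} \<subseteq> P}"
  shows "openin (prod_topology (top_of_set {0..1}) Z) P"
proof (subst openin_subopen, clarify)
  fix t z assume tz: "(t, z) \<in> P"
  then have z: "z \<in> topspace Z" and t: "t \<in> {0..1}" using sub by auto
  obtain e where e: "e > 0" "\<And>s. s \<in> {0..1} \<Longrightarrow> dist s t < e \<Longrightarrow> (s, z) \<in> P"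
    using slice[OF z] tz unfolding openin_euclidean_subtopology_iff by auto
  \<comment> \<open>A compact neighbourhood of \<open>t\<close> inside the slice through
    \<open>z\<close>; the tube over it yields an open rectangle around
    \<open>(t, z)\<close>.\<close>
  define C where "C = {0..1} \<inter> cball t (e/2)"
  have "compactin (top_of_set {0..1}) C"
    unfolding C_def by (auto simp: compactin_subtopology intro!: compact_Int_closed)
  from tube[OF this] have O: "openin Z {z \<in> topspace Z. C \<times> {z} \<subseteq> P}" .
  have J: "openin (top_of_set {0..1}) ({0..1} \<inter> ball t (e/2))"
    by (auto simp: openin_open)
  have "s \<in> {0..1} \<Longrightarrow> dist t s \<le> e/2 \<Longrightarrow> (s, z) \<in> P" for s
    using e by (auto simp: dist_commute)
  then have "C \<times> {z} \<subseteq> P" by (auto simp: C_def)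
  then have "(t, z) \<in> ({0..1} \<inter> ball t (e/2)) \<times> {z \<in> topspace Z. C \<times> {z} \<subseteq> P}"
    using z t e(1) by auto
  moreover have "({0..1} \<inter> ball t (e/2)) \<times> {z \<in> topspace Z. C \<times> {z} \<subseteq> P} \<subseteq> P"
    by (auto simp: C_def)
  moreover have "openin (prod_topology (top_of_set {0..1}) Z)
      (({0..1} \<inter> ball t (e/2)) \<times> {z \<in> topspace Z. C \<times> {z} \<subseteq> P})"
    using O J by (simp add: openin_prod_Times_iff)
  ultimately show "\<exists>T. openin (prod_topology (top_of_set {0..1}) Z) T \<and> (t, z) \<in> T \<and> T \<subseteq> P"
    by blast
qed

lemma openin_slice:
  assumes "openin (prod_topology J X) Q" "x \<in> topspace X"
  shows "openin J {t. (t, x) \<in> Q}"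
proof -
  have "continuous_map J (prod_topology J X) (\<lambda>t. (t, x))"
    using assms(2) by (simp add: continuous_map_pairwise o_def)
  from openin_continuous_map_preimage[OF this assms(1)]
  have "openin J {t \<in> topspace J. (t, x) \<in> Q}" .
  moreover have "{t \<in> topspace J. (t, x) \<in> Q} = {t. (t, x) \<in> Q}"
    using openin_subset[OF assms(1)] by auto
  ultimately show ?thesis by simp
qed

text \<open>The model cell \<open>B\<close> with boundary \<open>S\<close> is left general: it is a
  disk for the complexes and a cylinder [0, 1] x disk for the spaces between them. The pushout
  \<open>Z\<close> is described by its point set and its final topology, with the attaching maps
  contained in \<open>\<Phi>\<close> as boundary values.\<close>

locale cell_attachment =
  fixes A Z :: "'a topology" and B :: "'b topology" and S :: "'b set"
    and I :: "'i set" and \<Phi> :: "'i \<times> 'b \<Rightarrow> 'a"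
  assumes boundary_closed: "closedin B S"
    and topspace_Z: "topspace Z = topspace A \<union> \<Phi> ` (I \<times> topspace B)"
    and attach: "\<alpha> \<in> I \<Longrightarrow> continuous_map (subtopology B S) A (\<lambda>x. \<Phi> (\<alpha>, x))"
    and inj: "inj_on \<Phi> (I \<times> (topspace B - S))"
    and disjoint: "\<Phi> ` (I \<times> (topspace B - S)) \<inter> topspace A = {}"
    and openin_Z: "openin Z W \<longleftrightarrow> W \<subseteq> topspace Z \<and> openin A (W \<inter> topspace A) \<and>
      (\<forall>\<alpha>\<in>I. openin B {x \<in> topspace B. \<Phi> (\<alpha>, x) \<in> W})"
begin

lemma boundary_subset: "S \<subseteq> topspace B"
  using boundary_closed closedin_subset by blast

lemma attach_in: "\<alpha> \<in> I \<Longrightarrow> x \<in> S \<Longrightarrow> \<Phi> (\<alpha>, x) \<in> topspace A"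
  using attach[of \<alpha>] boundary_subset by (auto simp: continuous_map_def)

lemma interior_notin: "\<alpha> \<in> I \<Longrightarrow> x \<in> topspace B \<Longrightarrow> x \<notin> S \<Longrightarrow> \<Phi> (\<alpha>, x) \<notin> topspace A"
  using disjoint by blast

lemma A_subset: "topspace A \<subseteq> topspace Z"
  by (simp add: topspace_Z)

lemma cell_in: "\<alpha> \<in> I \<Longrightarrow> x \<in> topspace B \<Longrightarrow> \<Phi> (\<alpha>, x) \<in> topspace Z"
  by (auto simp: topspace_Z)

lemma cell_cases:
  assumes "z \<in> topspace Z"
  obtains "z \<in> topspace A" | \<alpha> x where "\<alpha> \<in> I" "x \<in> topspace B" "x \<notin> S" "z = \<Phi> (\<alpha>, x)" "z \<notin> topspace A"
  using assms attach_in interior_notin unfolding topspace_Z by blast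

lemma continuous_inclusion: "continuous_map A Z (\<lambda>x. x)"
  unfolding continuous_map using A_subset by (auto simp: openin_Z Collect_conj_eq Int_commute)

lemma continuous_cell: "\<alpha> \<in> I \<Longrightarrow> continuous_map B Z (\<lambda>x. \<Phi> (\<alpha>, x))"
  unfolding continuous_map using cell_in by (auto simp: openin_Z)

lemma continuous_mapI:
  assumes A: "continuous_map A T f" and cell: "\<And>\<alpha>. \<alpha> \<in> I \<Longrightarrow> continuous_map B T (\<lambda>x. f (\<Phi> (\<alpha>, x)))"
  shows "continuous_map Z T f"
  unfolding continuous_map
proof (intro conjI allI impI)
  show "f ` topspace Z \<subseteq> topspace T"
    using A cell unfolding topspace_Z continuous_map_def by blast
  fix W assume W: "openin T W"
  have "{x \<in> topspace Z. f x \<in> W} \<inter> topspace A = {x \<in> topspace A. f x \<in> W}"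
    using A_subset by auto
  moreover have "{x \<in> topspace B. \<Phi> (\<alpha>, x) \<in> {x \<in> topspace Z. f x \<in> W}} = {x \<in> topspace B. f (\<Phi> (\<alpha>, x)) \<in> W}" if "\<alpha> \<in> I" for \<alpha>
    using cell_in[OF that] by auto
  ultimately show "openin Z {x \<in> topspace Z. f x \<in> W}"
    unfolding openin_Z using openin_continuous_map_preimage[OF A W] openin_continuous_map_preimage[OF cell W] by auto
qed

text \<open>Slices and tubes of a preimage restrict to slices and tubes over \<open>A\<close> and
  over each cell, so \<open>openin_prod_interval\<close> reduces continuity to the pieces. All
  homotopies on attachments are built this way.\<close>

lemma continuous_map_prodI:
  fixes f :: "real \<times> 'a \<Rightarrow> 'c"
  assumes A: "continuous_map (prod_topology (top_of_set {0..1}) A) T f"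
    and cell: "\<And>\<alpha>. \<alpha> \<in> I \<Longrightarrow> continuous_map (prod_topology (top_of_set {0..1}) B) T (\<lambda>p. f (fst p, \<Phi> (\<alpha>, snd p)))"
  shows "continuous_map (prod_topology (top_of_set {0..1}) Z) T f"
  unfolding continuous_map
proof (intro conjI allI impI)
  have "f (t, z) \<in> topspace T" if t: "t \<in> {0..1}" and z: "z \<in> topspace Z" for t z
    using z
  proof (cases rule: cell_cases)
    case 1
    then show ?thesis using A t by (auto simp: continuous_map_def)
  next
    case (2 \<alpha> x)
    have "(\<lambda>p. f (fst p, \<Phi> (\<alpha>, snd p))) \<in> {0..1} \<times> topspace B \<rightarrow> topspace T"
      using cell[OF 2(1)] by (simp add: continuous_map_def)
    from funcset_mem[OF this, of "(t, x)"] show ?thesis using 2 t by simp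
  qed
  then show "f ` topspace (prod_topology (top_of_set {0..1}) Z) \<subseteq> topspace T" by auto
  fix W assume W: "openin T W"
  let ?P = "{p \<in> topspace (prod_topology (top_of_set {0..1}) Z). f p \<in> W}"
  let ?PA = "{p \<in> topspace (prod_topology (top_of_set {0..1}) A). f p \<in> W}"
  let ?PB = "\<lambda>\<alpha>. {p \<in> topspace (prod_topology (top_of_set {0..1}) B). f (fst p, \<Phi> (\<alpha>, snd p)) \<in> W}"
  have PA: "openin (prod_topology (top_of_set {0..1}) A) ?PA"
    by (rule openin_continuous_map_preimage[OF A W])
  have PB: "openin (prod_topology (top_of_set {0..1}) B) (?PB \<alpha>)" if "\<alpha> \<in> I" for \<alpha>
    by (rule openin_continuous_map_preimage[OF cell[OF that] W])
  show "openin (prod_topology (top_of_set {0..1}) Z) ?P"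
  proof (rule openin_prod_interval)
    fix z assume "z \<in> topspace Z"
    then show "openin (top_of_set {0..1}) {t. (t, z) \<in> ?P}"
    proof (cases rule: cell_cases)
      case 1
      have "{t. (t, z) \<in> ?P} = {t. (t, z) \<in> ?PA}" using 1 A_subset by auto
      then show ?thesis using openin_slice[OF PA 1] by simp
    next
      case (2 \<alpha> x)
      have "{t. (t, z) \<in> ?P} = {t. (t, x) \<in> ?PB \<alpha>}" using 2 cell_in by auto
      then show ?thesis using openin_slice[OF PB 2(2)] 2(1) by simp
    qed
  next
    fix C :: "real set" assume C: "compactin (top_of_set {0..1}) C"
    then have C01: "C \<subseteq> {0..1}" using compactin_subset_topspace by fastforce
    have "{z \<in> topspace Z. C \<times> {z} \<subseteq> ?P} \<inter> topspace A = {z \<in> topspace A. C \<times> {z} \<subseteq> ?PA}"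
      using A_subset C01 by auto
    moreover have "{x \<in> topspace B. \<Phi> (\<alpha>, x) \<in> {z \<in> topspace Z. C \<times> {z} \<subseteq> ?P}} = {x \<in> topspace B. C \<times> {x} \<subseteq> ?PB \<alpha>}"
      if "\<alpha> \<in> I" for \<alpha>
      using cell_in[OF that] C01 by auto
    ultimately show "openin Z {z \<in> topspace Z. C \<times> {z} \<subseteq> ?P}"
      unfolding openin_Z using openin_tube[OF PA C] openin_tube[OF PB C] by auto
  qed auto
qed

section \<open>Coordinates on the open cells\<close>

definition coord :: "'a \<Rightarrow> 'i \<times> 'b" where
  "coord = inv_into (I \<times> (topspace B - S)) \<Phi>"

lemma coord_cell: "\<alpha> \<in> I \<Longrightarrow> x \<in> topspace B \<Longrightarrow> x \<notin> S \<Longrightarrow> coord (\<Phi> (\<alpha>, x)) = (\<alpha>, x)"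
  unfolding coord_def using inj by (intro inv_into_f_f) auto

text \<open>Takes the value \<open>g (\<alpha>, x)\<close> at \<open>\<Phi> (\<alpha>, x)\<close> for all \<open>x\<close> only if \<open>g\<close> agrees with \<open>f\<close> on the boundaries.\<close>

definition cell_ext :: "('a \<Rightarrow> 'c) \<Rightarrow> ('i \<times> 'b \<Rightarrow> 'c) \<Rightarrow> 'a \<Rightarrow> 'c" where
  "cell_ext f g z = (if z \<in> topspace A then f z else g (coord z))"

lemma cell_ext_A: "z \<in> topspace A \<Longrightarrow> cell_ext f g z = f z"
  by (simp add: cell_ext_def)

lemma cell_ext_interior: "\<alpha> \<in> I \<Longrightarrow> x \<in> topspace B \<Longrightarrow> x \<notin> S \<Longrightarrow> cell_ext f g (\<Phi> (\<alpha>, x)) = g (\<alpha>, x)"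
  using interior_notin by (simp add: cell_ext_def coord_cell)

lemma cell_ext_cell:
  "\<alpha> \<in> I \<Longrightarrow> x \<in> topspace B \<Longrightarrow> (x \<in> S \<Longrightarrow> g (\<alpha>, x) = f (\<Phi> (\<alpha>, x))) \<Longrightarrow> cell_ext f g (\<Phi> (\<alpha>, x)) = g (\<alpha>, x)"
  by (cases "x \<in> S") (simp_all add: cell_ext_interior attach_in cell_ext_A)

text \<open>Open cells meet neither \<open>A\<close> nor one another. So the preimage of this set in
  the cell of index \<open>\<alpha>\<close> is \<open>T \<alpha> - S\<close>, and its part in
  \<open>A\<close> is empty.\<close>

lemma openin_interior_image:
  assumes "\<And>\<alpha>. \<alpha> \<in> I \<Longrightarrow> openin B (T \<alpha>)"
  shows "openin Z (\<Phi> ` (SIGMA \<alpha>:I. T \<alpha> - S))"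
  unfolding openin_Z
proof (intro conjI ballI)
  have T: "T \<alpha> \<subseteq> topspace B" if "\<alpha> \<in> I" for \<alpha> using assms[OF that] openin_subset by blast
  show "\<Phi> ` (SIGMA \<alpha>:I. T \<alpha> - S) \<subseteq> topspace Z"
    using cell_in T by blast
  have "\<Phi> ` (SIGMA \<alpha>:I. T \<alpha> - S) \<inter> topspace A = {}"
    using interior_notin T by blast
  then show "openin A (\<Phi> ` (SIGMA \<alpha>:I. T \<alpha> - S) \<inter> topspace A)" by simp
  fix \<alpha> assume \<alpha>: "\<alpha> \<in> I"
  have "{x \<in> topspace B. \<Phi> (\<alpha>, x) \<in> \<Phi> ` (SIGMA \<alpha>:I. T \<alpha> - S)} = T \<alpha> - S"
  proof (intro equalityI subsetI)
    fix x assume "x \<in> {x \<in> topspace B. \<Phi> (\<alpha>, x) \<in> \<Phi> ` (SIGMA \<alpha>:I. T \<alpha> - S)}"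
    then obtain \<beta> y where *: "x \<in> topspace B" "\<beta> \<in> I" "y \<in> T \<beta>" "y \<notin> S" "\<Phi> (\<alpha>, x) = \<Phi> (\<beta>, y)" by auto
    then have "x \<notin> S" using attach_in[OF \<alpha>] interior_notin[of \<beta> y] T by force
    then have "(\<alpha>, x) = (\<beta>, y)"
      using * T \<alpha> coord_cell by (metis subsetD)
    then show "x \<in> T \<alpha> - S" using * by auto
  qed (use T[OF \<alpha>] \<alpha> in auto)
  then show "openin B {x \<in> topspace B. \<Phi> (\<alpha>, x) \<in> \<Phi> ` (SIGMA \<alpha>:I. T \<alpha> - S)}"
    using assms[OF \<alpha>] boundary_closed by (simp add: openin_diff)
qed

lemma openin_interior: "openin Z (topspace Z - topspace A)"
proof -
  have "topspace Z - topspace A = \<Phi> ` (SIGMA \<alpha>:I. topspace B - S)"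
    using cell_in interior_notin by (auto elim!: cell_cases)
  then show ?thesis using openin_interior_image[of "\<lambda>_. topspace B"] by simp
qed

lemma coord_in: "z \<in> topspace Z - topspace A \<Longrightarrow> coord z \<in> I \<times> (topspace B - S)"
  by (auto elim!: cell_cases simp: coord_cell)

lemma cell_coord: "z \<in> topspace Z - topspace A \<Longrightarrow> \<Phi> (coord z) = z"
  by (auto elim!: cell_cases simp: coord_cell)

lemma openin_coord_preimage:
  assumes "\<And>\<alpha>. \<alpha> \<in> I \<Longrightarrow> openin B (T \<alpha>)"
  shows "openin Z {z \<in> topspace Z - topspace A. snd (coord z) \<in> T (fst (coord z))}"
proof -
  have T: "T \<alpha> \<subseteq> topspace B" if "\<alpha> \<in> I" for \<alpha> using assms[OF that] openin_subset by blast
  have "{z \<in> topspace Z - topspace A. snd (coord z) \<in> T (fst (coord z))} = \<Phi> ` (SIGMA \<alpha>:I. T \<alpha> - S)"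
  proof (intro equalityI subsetI)
    fix z assume "z \<in> {z \<in> topspace Z - topspace A. snd (coord z) \<in> T (fst (coord z))}"
    then show "z \<in> \<Phi> ` (SIGMA \<alpha>:I. T \<alpha> - S)"
      using coord_in[of z] cell_coord[of z] by (intro image_eqI[of _ _ "coord z"]) auto
  next
    fix z assume "z \<in> \<Phi> ` (SIGMA \<alpha>:I. T \<alpha> - S)"
    then obtain \<alpha> x where "\<alpha> \<in> I" "x \<in> T \<alpha>" "x \<notin> S" "z = \<Phi> (\<alpha>, x)" by auto
    then show "z \<in> {z \<in> topspace Z - topspace A. snd (coord z) \<in> T (fst (coord z))}"
      using T cell_in interior_notin coord_cell by (auto simp: subset_iff)
  qed
  then show ?thesis using openin_interior_image[OF assms] by simp
qed

lemma continuous_snd_coord: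
  "continuous_map (subtopology Z (topspace Z - topspace A)) B (\<lambda>z. snd (coord z))"
  unfolding continuous_map
proof (intro conjI allI impI)
  show "(\<lambda>z. snd (coord z)) ` topspace (subtopology Z (topspace Z - topspace A)) \<subseteq> topspace B"
    using coord_in by force
  fix W assume "openin B W"
  then have "openin Z {z \<in> topspace Z - topspace A. snd (coord z) \<in> W}"
    by (rule openin_coord_preimage)
  then show "openin (subtopology Z (topspace Z - topspace A))
      {x \<in> topspace (subtopology Z (topspace Z - topspace A)). snd (coord x) \<in> W}"
    using openin_interior by (auto simp: openin_open_subtopology Int_absorb1)
qed

text \<open>Needed to treat a map into the open cells one cell at a time: the index of the cell is
  locally constant.\<close>

lemma openin_fst_coord: "openin Z {z \<in> topspace Z - topspace A. fst (coord z) = \<beta>}"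
proof -
  have "{z \<in> topspace Z - topspace A. snd (coord z) \<in> (if fst (coord z) = \<beta> then topspace B else {})} =
      {z \<in> topspace Z - topspace A. fst (coord z) = \<beta>}"
    using coord_in by (auto simp: mem_Times_iff split: if_splits)
  then show ?thesis
    using openin_coord_preimage[of "\<lambda>\<alpha>. if \<alpha> = \<beta> then topspace B else {}"] by (simp cong: if_cong)
qed

text \<open>The point is the target: continuity holds into \<open>A\<close> with its own topology,
  not just into \<open>Z\<close>, because on each collar the map is an attaching map after
  \<open>\<rho>\<close>.\<close>

lemma continuous_collar_retract:
  assumes T: "openin B T" "S \<subseteq> T" and \<rho>: "continuous_map (subtopology B T) (subtopology B S) \<rho>"
    and id: "\<And>x. x \<in> S \<Longrightarrow> \<rho> x = x"
  shows "continuous_map (subtopology Z (topspace A \<union> \<Phi> ` (I \<times> T))) A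
    (cell_ext (\<lambda>z. z) (\<lambda>c. \<Phi> (fst c, \<rho> (snd c))))" (is "continuous_map (subtopology Z ?N) A ?g")
  unfolding continuous_map
proof (intro conjI allI impI)
  have TB: "T \<subseteq> topspace B" using T openin_subset by blast
  have g: "?g (\<Phi> (\<alpha>, x)) = \<Phi> (\<alpha>, \<rho> x)" if "\<alpha> \<in> I" "x \<in> T" for \<alpha> x
    using that TB by (subst cell_ext_cell) (auto simp: id)
  have \<rho>S: "\<rho> x \<in> S" if "x \<in> T" for x
    using \<rho> that TB by (auto simp: continuous_map_def Pi_iff)
  have N: "topspace (subtopology Z ?N) = ?N"
    using TB A_subset cell_in by auto
  show "?g ` topspace (subtopology Z ?N) \<subseteq> topspace A"
    unfolding N using g \<rho>S attach_in by (auto simp: cell_ext_A)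
  fix W assume W: "openin A W"
  let ?Q = "{z \<in> ?N. ?g z \<in> W}"
  have "openin Z ?Q"
    unfolding openin_Z
  proof (intro conjI ballI)
    show "?Q \<subseteq> topspace Z" using N by auto
    have "?Q \<inter> topspace A = W" using openin_subset[OF W] by (auto simp: cell_ext_A)
    then show "openin A (?Q \<inter> topspace A)" using W by simp
    fix \<alpha> assume \<alpha>: "\<alpha> \<in> I"
    have c: "continuous_map (subtopology B T) A (\<lambda>x. \<Phi> (\<alpha>, \<rho> x))"
      using continuous_map_compose[OF \<rho> attach[OF \<alpha>]] by (simp add: o_def)
    \<comment> \<open>Here injectivity on the open cells enters: a point of the model cell whose
      image lies in the union of the collars belongs to \<open>T\<close> itself.\<close>
    have "{x \<in> topspace B. \<Phi> (\<alpha>, x) \<in> ?Q} = {x \<in> T. \<Phi> (\<alpha>, \<rho> x) \<in> W}"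
    proof (intro equalityI subsetI)
      fix x assume x: "x \<in> {x \<in> topspace B. \<Phi> (\<alpha>, x) \<in> ?Q}"
      have "x \<in> T"
      proof (cases "x \<in> S")
        case False
        then have "\<Phi> (\<alpha>, x) \<notin> topspace A" using interior_notin[OF \<alpha>] x by blast
        then obtain \<beta> y where *: "\<beta> \<in> I" "y \<in> T" "\<Phi> (\<alpha>, x) = \<Phi> (\<beta>, y)" using x by auto
        then have "y \<notin> S" using \<open>\<Phi> (\<alpha>, x) \<notin> topspace A\<close> attach_in by metis
        then have "(\<alpha>, x) = (\<beta>, y)"
          using * TB \<alpha> x False coord_cell by (metis (no_types, lifting) mem_Collect_eq subsetD)
        then show ?thesis using * by simp
      qed (use T in auto)
      with x g[OF \<alpha>] show "x \<in> {x \<in> T. \<Phi> (\<alpha>, \<rho> x) \<in> W}" by auto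
    next
      fix x assume "x \<in> {x \<in> T. \<Phi> (\<alpha>, \<rho> x) \<in> W}"
      then show "x \<in> {x \<in> topspace B. \<Phi> (\<alpha>, x) \<in> ?Q}"
        using TB \<alpha> g[OF \<alpha>, of x] by auto
    qed
    then show "openin B {x \<in> topspace B. \<Phi> (\<alpha>, x) \<in> ?Q}"
      using openin_preimage[OF T(1) c W] by simp
  qed
  then show "openin (subtopology Z ?N) {z \<in> topspace (subtopology Z ?N). ?g z \<in> W}"
    unfolding N openin_subtopology by blast
qed

end

section \<open>Pushouts along an inclusion\<close>

text \<open>On the side of \<open>B\<close>, only points of \<open>C\<close> occur in the generating
  relation. So the class of a point of \<open>B - C\<close> is a singleton, and every other class
  has exactly one member in \<open>A\<close>.\<close>

lemma set_pushout_inclusion_iff: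
  fixes A Z :: "'a set" and B C :: "'b set"
  assumes C: "C \<subseteq> B" and h: "h \<in> C \<rightarrow> A"
  shows "set_pushout C A B h (\<lambda>x. x) Z (\<lambda>x. x) \<Phi> \<longleftrightarrow>
    Z = A \<union> \<Phi> ` B \<and> (\<forall>c\<in>C. \<Phi> c = h c) \<and> inj_on \<Phi> (B - C) \<and> \<Phi> ` (B - C) \<inter> A = {}"
    (is "?L \<longleftrightarrow> ?R")
proof -
  define R :: "('a + 'b) rel" where "R = {(Inl (h c), Inr c) | c. c \<in> C}"
  let ?f = "case_sum (\<lambda>x. x) \<Phi>"
  have L: "?L \<longleftrightarrow> Z = ?f ` (A <+> B) \<and>
      (\<forall>x\<in>A <+> B. \<forall>y\<in>A <+> B. ?f x = ?f y \<longleftrightarrow> (x, y) \<in> (R \<union> R\<inverse>)\<^sup>*)"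
    by (simp add: set_pushout_def R_def Let_def)
  have img: "?f ` (A <+> B) = A \<union> \<Phi> ` B"
    by (force simp: Plus_def)
  show ?thesis
  proof
    assume ?L
    then have Z: "Z = ?f ` (A <+> B)"
      and k: "\<And>x y. x \<in> A <+> B \<Longrightarrow> y \<in> A <+> B \<Longrightarrow> ?f x = ?f y \<longleftrightarrow> (x, y) \<in> (R \<union> R\<inverse>)\<^sup>*"
      unfolding L by blast+
    have single: "y = Inr b" if "(Inr b, y) \<in> (R \<union> R\<inverse>)\<^sup>*" "b \<notin> C" for b y
      using that(1)
    proof (cases rule: converse_rtranclE)
      case (step y')
      then show ?thesis using that(2) by (auto simp: R_def)
    qed simp
    have "\<Phi> c = h c" if c: "c \<in> C" for c
    proof -
      have "(Inr c, Inl (h c)) \<in> (R \<union> R\<inverse>)\<^sup>*" using c by (intro r_into_rtrancl) (auto simp: R_def)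
      then show ?thesis using k[of "Inr c" "Inl (h c)"] C h c by auto
    qed
    moreover have "inj_on \<Phi> (B - C)"
    proof (rule inj_onI)
      fix b b' assume b: "b \<in> B - C" "b' \<in> B - C" "\<Phi> b = \<Phi> b'"
      then have "(Inr b, Inr b') \<in> (R \<union> R\<inverse>)\<^sup>*" using k[of "Inr b" "Inr b'"] by auto
      then show "b = b'" using single b(1) by fastforce
    qed
    moreover have False if "b \<in> B - C" "\<Phi> b \<in> A" for b
    proof -
      have "(Inr b, Inl (\<Phi> b)) \<in> (R \<union> R\<inverse>)\<^sup>*" using k[of "Inr b" "Inl (\<Phi> b)"] that by auto
      then show ?thesis using single that(1) by fastforce
    qed
    ultimately show ?R using Z img by auto
  next
    assume R: ?R
    \<comment> \<open>The normal form of a class: its member in \<open>A\<close> if there is one.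
      Each point is related to its normal form in at most one step.\<close>
    define can where "can x = (case x of Inl a \<Rightarrow> Inl a | Inr b \<Rightarrow> if b \<in> C then Inl (\<Phi> b) else Inr b)" for x :: "'a + 'b"
    have to: "(x, can x) \<in> (R \<union> R\<inverse>)\<^sup>*" and fro: "(can x, x) \<in> (R \<union> R\<inverse>)\<^sup>*" for x
      using R by (auto simp: can_def R_def split: sum.splits)
    have "?f x = ?f y \<longleftrightarrow> (x, y) \<in> (R \<union> R\<inverse>)\<^sup>*" if xy: "x \<in> A <+> B" "y \<in> A <+> B" for x y
    proof
      assume "?f x = ?f y"
      moreover have "h c \<noteq> \<Phi> b" "\<Phi> b \<noteq> h c" if "c \<in> C" "b \<in> B" "b \<notin> C" for b c
        using R h that by fastforce+
      ultimately have "can x = can y"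
        using xy R C h by (auto simp: can_def inj_on_def Pi_iff split: sum.splits if_splits)
      then show "(x, y) \<in> (R \<union> R\<inverse>)\<^sup>*" using to[of x] fro[of y] by (simp add: rtrancl_trans)
    next
      assume "(x, y) \<in> (R \<union> R\<inverse>)\<^sup>*"
      then show "?f x = ?f y"
        by (induction rule: rtrancl_induct) (use R in \<open>auto simp: R_def\<close>)
    qed
    with R img show ?L unfolding L by blast
  qed
qed

section \<open>Smooth attachments\<close>

lemma points_coproduct [simp]: "points (coproduct_diffeology Z I) = Sigma I (\<lambda>\<alpha>. points (Z \<alpha>))"
  by (simp add: coproduct_diffeology_def)

lemma diffeological_space_coproduct: "diffeological_space (coproduct_diffeology Z I)"
  by (simp add: coproduct_diffeology_def diffeological_space_generated)

context
  fixes Z :: "'i \<Rightarrow> 'a diffeology" and I :: "'i set"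
  assumes Z: "\<And>\<alpha>. \<alpha> \<in> I \<Longrightarrow> diffeological_space (Z \<alpha>)"
begin

lemma coproduct_generators:
  assumes "(m, V, Q) \<in> {(n, U, \<lambda>u. (\<alpha>, P u)) | n U P \<alpha>. \<alpha> \<in> I \<and> plot (Z \<alpha>) n U P}"
  shows "openin (Euclidean_space m) V \<and> Q \<in> V \<rightarrow> Sigma I (\<lambda>\<alpha>. points (Z \<alpha>))"
  using assms plot_openin[OF Z] plot_funcset[OF Z] by auto blast

lemma plot_coproductI:
  assumes "\<alpha> \<in> I" "plot (Z \<alpha>) n U P"
  shows "plot (coproduct_diffeology Z I) n U (\<lambda>u. (\<alpha>, P u))"
  unfolding coproduct_diffeology_def
  by (rule plot_generator)
     (use assms plot_openin[OF Z[OF assms(1)] assms(2)] funcset_mem[OF plot_funcset[OF Z[OF assms(1)] assms(2)]] in auto)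

text \<open>Generators and constants each live in a single summand, and a smooth change of
  parameters does not leave it.\<close>

lemma plot_coproduct_local:
  assumes P: "plot (coproduct_diffeology Z I) n U P" and u: "u \<in> U"
  obtains W \<alpha> Q where "openin (Euclidean_space n) W" "u \<in> W" "W \<subseteq> U" "\<alpha> \<in> I" "plot (Z \<alpha>) n W Q"
    "\<And>w. w \<in> W \<Longrightarrow> P w = (\<alpha>, Q w)"
proof -
  obtain W where W: "openin (Euclidean_space n) W" "u \<in> W" "W \<subseteq> U"
      "locally_generated (Sigma I (\<lambda>\<alpha>. points (Z \<alpha>)))
        {(n, U, \<lambda>u. (\<alpha>, P u)) | n U P \<alpha>. \<alpha> \<in> I \<and> plot (Z \<alpha>) n U P} n W P"
    using plot_generated_local[OF coproduct_generators P[unfolded coproduct_diffeology_def] u] by blast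
  from W(4) show ?thesis
    unfolding locally_generated_def
  proof (elim disjE exE bexE conjE)
    fix s assume s: "s \<in> Sigma I (\<lambda>\<alpha>. points (Z \<alpha>))" "\<forall>w\<in>W. P w = s"
    then have "plot (Z (fst s)) n W (\<lambda>_. snd s)"
      using plot_const[OF Z W(1)] by force
    then show ?thesis using that[OF W(1-3), of "fst s" "\<lambda>_. snd s"] s by auto
  next
    fix m V Q \<phi>
    assume *: "(m, V, Q) \<in> {(n, U, \<lambda>u. (\<alpha>, P u)) | n U P \<alpha>. \<alpha> \<in> I \<and> plot (Z \<alpha>) n U P}"
      "euclidean_smooth n W m V \<phi>" "\<forall>w\<in>W. P w = Q (\<phi> w)"
    then obtain \<alpha> R where R: "\<alpha> \<in> I" "plot (Z \<alpha>) m V R" "Q = (\<lambda>u. (\<alpha>, R u))" by auto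
    then have "plot (Z \<alpha>) n W (R \<circ> \<phi>)" using plot_comp[OF Z _ *(2)] by blast
    then show ?thesis using that[OF W(1-3) R(1)] *(3) R(3) by auto
  qed
qed

lemma openin_D_coproduct:
  "openin (D_topology (coproduct_diffeology Z I)) W \<longleftrightarrow>
    W \<subseteq> Sigma I (\<lambda>\<alpha>. points (Z \<alpha>)) \<and> (\<forall>\<alpha>\<in>I. openin (D_topology (Z \<alpha>)) {x \<in> points (Z \<alpha>). (\<alpha>, x) \<in> W})"
proof -
  have eq: "{v \<in> V. (\<alpha>, P v) \<in> W} = {v \<in> V. P v \<in> {x \<in> points (Z \<alpha>). (\<alpha>, x) \<in> W}}"
    if "\<alpha> \<in> I" "plot (Z \<alpha>) n V P" for n V P \<alpha>
    using plot_funcset[OF Z that(2)] that(1) by auto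
  have "openin (D_topology (coproduct_diffeology Z I)) W \<longleftrightarrow>
    W \<subseteq> Sigma I (\<lambda>\<alpha>. points (Z \<alpha>)) \<and>
    (\<forall>m V \<alpha> P. \<alpha> \<in> I \<and> plot (Z \<alpha>) m V P \<longrightarrow> openin (Euclidean_space m) {v \<in> V. (\<alpha>, P v) \<in> W})"
  proof -
    let ?G = "{(n, U, \<lambda>u. (\<alpha>, P u)) | n U P \<alpha>. \<alpha> \<in> I \<and> plot (Z \<alpha>) n U P}"
    have "openin (D_topology (coproduct_diffeology Z I)) W \<longleftrightarrow>
      W \<subseteq> Sigma I (\<lambda>\<alpha>. points (Z \<alpha>)) \<and>
      (\<forall>m V Q. (m, V, Q) \<in> ?G \<longrightarrow> openin (Euclidean_space m) {v \<in> V. Q v \<in> W})"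
      unfolding coproduct_diffeology_def by (rule openin_D_generated) (rule coproduct_generators)
    then show ?thesis by blast
  qed
  also have "\<dots> \<longleftrightarrow> W \<subseteq> Sigma I (\<lambda>\<alpha>. points (Z \<alpha>)) \<and>
    (\<forall>\<alpha>\<in>I. openin (D_topology (Z \<alpha>)) {x \<in> points (Z \<alpha>). (\<alpha>, x) \<in> W})"
  proof -
    have "openin (D_topology (Z \<alpha>)) {x \<in> points (Z \<alpha>). (\<alpha>, x) \<in> W} \<longleftrightarrow>
        (\<forall>m V P. plot (Z \<alpha>) m V P \<longrightarrow> openin (Euclidean_space m) {v \<in> V. (\<alpha>, P v) \<in> W})"
      if "\<alpha> \<in> I" for \<alpha>
    proof (intro iffI allI impI)
      fix m V P
      assume L: "openin (D_topology (Z \<alpha>)) {x \<in> points (Z \<alpha>). (\<alpha>, x) \<in> W}" and P: "plot (Z \<alpha>) m V P"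
      have "openin (Euclidean_space m) {v \<in> V. P v \<in> {x \<in> points (Z \<alpha>). (\<alpha>, x) \<in> W}}"
        using L P openin_D_topology[OF Z[OF that]] by blast
      then show "openin (Euclidean_space m) {v \<in> V. (\<alpha>, P v) \<in> W}"
        by (simp only: eq[OF that P])
    next
      assume R: "\<forall>m V P. plot (Z \<alpha>) m V P \<longrightarrow> openin (Euclidean_space m) {v \<in> V. (\<alpha>, P v) \<in> W}"
      show "openin (D_topology (Z \<alpha>)) {x \<in> points (Z \<alpha>). (\<alpha>, x) \<in> W}"
        unfolding openin_D_topology[OF Z[OF that]]
      proof (intro conjI allI impI)
        fix m V P assume P: "plot (Z \<alpha>) m V P"
        from R P have "openin (Euclidean_space m) {v \<in> V. (\<alpha>, P v) \<in> W}" by blast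
        then show "openin (Euclidean_space m) {v \<in> V. P v \<in> {x \<in> points (Z \<alpha>). (\<alpha>, x) \<in> W}}"
          by (simp only: eq[OF that P])
      qed auto
    qed
    then show ?thesis by blast
  qed
  finally show ?thesis .
qed

end

section \<open>Spheres as smooth retracts of punctured spaces\<close>

definition sphere_project :: "nat \<Rightarrow> (nat \<Rightarrow> real) \<Rightarrow> nat \<Rightarrow> real" where
  "sphere_project n x = (\<lambda>i. sqn (Suc n) x powr (- 1 / 2) * x i)"

definition punctured_space :: "nat \<Rightarrow> (nat \<Rightarrow> real) set" where
  "punctured_space n = {x \<in> topspace (Euclidean_space n). 0 < sqn n x}"

lemma openin_punctured_space: "openin (Euclidean_space n) (punctured_space n)"
proof -
  have "continuous_map (Euclidean_space n) euclideanreal (sqn n)"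
    using continuous_map_sqn[of "Euclidean_space n" n "\<lambda>x. x"] by simp
  from openin_continuous_map_preimage[OF this, of "{0<..}"] show ?thesis
    by (simp add: punctured_space_def)
qed

lemma sphere_project_in:
  assumes "x \<in> punctured_space (Suc n)"
  shows "sphere_project n x \<in> topspace (nsphere n)"
proof -
  have "(sqn (Suc n) x powr (- 1 / 2))\<^sup>2 * sqn (Suc n) x = 1"
    using assms unfolding punctured_space_def
    by (simp add: powr_minus_divide powr_half_sqrt power_divide del: sum.lessThan_Suc)
  then have "sqn (Suc n) (sphere_project n x) = 1"
    unfolding sphere_project_def sqn_scale .
  moreover have "sphere_project n x \<in> topspace (Euclidean_space (Suc n))"
    using assms by (simp add: sphere_project_def topspace_Euclidean_space punctured_space_def)
  ultimately show ?thesis by (simp add: topspace_nsphere del: sum.lessThan_Suc)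
qed

lemma sphere_project_id: "x \<in> topspace (nsphere n) \<Longrightarrow> sphere_project n x = x"
  by (simp add: sphere_project_def topspace_nsphere del: sum.lessThan_Suc)

lemma nsphere_subset_punctured: "topspace (nsphere n) \<subseteq> punctured_space (Suc n)"
  by (auto simp: topspace_nsphere punctured_space_def simp del: sum.lessThan_Suc)

text \<open>The sphere is not open in its ambient space, so a smooth map on it is not a plot;
  composed with this projection it becomes one on an open set.\<close>

lemma plot_sphere_project: "plot (smooth_sphere n) (Suc n) (punctured_space (Suc n)) (sphere_project n)"
proof -
  have "smooth_fun (Suc n) (punctured_space (Suc n)) (\<lambda>u. sphere_project n u i)" for i
    unfolding sphere_project_def
    by (intro smooth_fun_mult smooth_fun_powr smooth_fun_sqn smooth_fun_coordinate openin_punctured_space)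
       (simp add: punctured_space_def del: sum.lessThan_Suc)
  then show ?thesis
    unfolding plot_subset_diffeology using openin_punctured_space sphere_project_in by auto
qed

lemma continuous_map_sphere_project:
  "continuous_map (subtopology (Euclidean_space (Suc n)) (punctured_space (Suc n))) (nsphere n) (sphere_project n)"
proof -
  have t: "topspace (subtopology (Euclidean_space (Suc n)) (punctured_space (Suc n))) = punctured_space (Suc n)"
    by (auto simp: punctured_space_def)
  have "continuous_map (subtopology (Euclidean_space (Suc n)) (punctured_space (Suc n))) (Euclidean_space (Suc n)) (sphere_project n)"
    unfolding continuous_map_into_Euclidean t
    using plot_sphere_project[of n] sphere_project_in smooth_fun_continuous
    unfolding plot_subset_diffeology topspace_nsphere by blast
  then show ?thesis
    by (subst nsphere_eq_subtopology) (auto simp: continuous_map_in_subtopology t sphere_project_in)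
qed

lemma smooth_map_from_spheres:
  assumes X: "diffeological_space X"
  shows "smooth_map (coproduct_diffeology (\<lambda>_. smooth_sphere n) I) X h \<longleftrightarrow>
    (\<forall>\<alpha>\<in>I. smooth_map (smooth_sphere n) X (\<lambda>x. h (\<alpha>, x)))"
proof
  assume h: "smooth_map (coproduct_diffeology (\<lambda>_. smooth_sphere n) I) X h"
  then show "\<forall>\<alpha>\<in>I. smooth_map (smooth_sphere n) X (\<lambda>x. h (\<alpha>, x))"
    using plot_coproductI[of I "\<lambda>_. smooth_sphere n", OF diffeological_space_subset]
    unfolding smooth_map_def by (fastforce simp: o_def)
next
  assume h: "\<forall>\<alpha>\<in>I. smooth_map (smooth_sphere n) X (\<lambda>x. h (\<alpha>, x))"
  show "smooth_map (coproduct_diffeology (\<lambda>_. smooth_sphere n) I) X h"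
    unfolding coproduct_diffeology_def
  proof (rule smooth_map_generated[OF X])
    show "h \<in> (SIGMA \<alpha>:I. points (smooth_sphere n)) \<rightarrow> points X"
      using h by (auto simp: smooth_map_def)
    fix m U P assume P: "(m, U, P) \<in> {(m, U, \<lambda>u. (\<alpha>, P u)) | m U P \<alpha>. \<alpha> \<in> I \<and> plot (smooth_sphere n) m U P}"
    show "P \<in> U \<rightarrow> (SIGMA \<alpha>:I. points (smooth_sphere n)) \<and> plot X m U (h \<circ> P)"
      using P h plot_funcset[OF diffeological_space_subset] by (fastforce simp: smooth_map_def o_def)
  qed
qed

section \<open>Plots and D-topology of a smooth cell attachment\<close>

locale smooth_attachment =
  fixes n :: nat and I :: "'i set" and X X' :: "'a diffeology" and h \<Phi> :: "'i \<times> (nat \<Rightarrow> real) \<Rightarrow> 'a"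
  assumes X: "diffeological_space X"
    and h_smooth: "smooth_map (coproduct_diffeology (\<lambda>_. smooth_sphere n) I) X h"
    and push: "diffeological_pushout (coproduct_diffeology (\<lambda>_. smooth_sphere n) I) X
      (coproduct_diffeology (\<lambda>_. smooth_disk (Suc n)) I) h (\<lambda>x. x) X' (\<lambda>x. x) \<Phi>"
begin

abbreviation "\<D> \<equiv> unit_disk (Suc n)"
abbreviation "\<S> \<equiv> topspace (nsphere n)"

lemma h_in: "\<alpha> \<in> I \<Longrightarrow> x \<in> \<S> \<Longrightarrow> h (\<alpha>, x) \<in> points X"
  using h_smooth by (auto simp: smooth_map_def)

lemma pushout_facts:
  "points X' = points X \<union> \<Phi> ` (I \<times> \<D>)" "\<And>\<alpha> x. \<alpha> \<in> I \<Longrightarrow> x \<in> \<S> \<Longrightarrow> \<Phi> (\<alpha>, x) = h (\<alpha>, x)"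
  "inj_on \<Phi> (I \<times> (\<D> - \<S>))" "\<Phi> ` (I \<times> (\<D> - \<S>)) \<inter> points X = {}"
proof -
  have s: "set_pushout (I \<times> \<S>) (points X) (I \<times> \<D>) h (\<lambda>x. x) (points X') (\<lambda>x. x) \<Phi>"
    using push by (simp add: diffeological_pushout_def)
  have "I \<times> \<D> - I \<times> \<S> = I \<times> (\<D> - \<S>)" by blast
  moreover have "I \<times> \<S> \<subseteq> I \<times> \<D>" using nsphere_subset_unit_disk by blast
  ultimately show "points X' = points X \<union> \<Phi> ` (I \<times> \<D>)" "\<And>\<alpha> x. \<alpha> \<in> I \<Longrightarrow> x \<in> \<S> \<Longrightarrow> \<Phi> (\<alpha>, x) = h (\<alpha>, x)"
    "inj_on \<Phi> (I \<times> (\<D> - \<S>))" "\<Phi> ` (I \<times> (\<D> - \<S>)) \<inter> points X = {}"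
    using s h_in by (subst (asm) set_pushout_inclusion_iff; auto)+
qed

definition generators :: "(nat \<times> (nat \<Rightarrow> real) set \<times> ((nat \<Rightarrow> real) \<Rightarrow> 'a)) set" where
  "generators = {(m, U, (\<lambda>x. x) \<circ> P) | m U P. plot X m U P} \<union>
     {(m, U, \<Phi> \<circ> P) | m U P. plot (coproduct_diffeology (\<lambda>_. smooth_disk (Suc n)) I) m U P}"

lemma X'_generated: "X' = generated_diffeology (points X') generators"
  using push unfolding diffeological_pushout_def generators_def by blast

lemma X'_diffeological: "diffeological_space X'"
  by (subst X'_generated) (rule diffeological_space_generated)

lemma generators_in:
  assumes "(m, V, Q) \<in> generators"
  shows "openin (Euclidean_space m) V \<and> Q \<in> V \<rightarrow> points X'"
  using assms unfolding generators_def
proof (elim UnE CollectE exE conjE)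
  fix m' U P assume "(m, V, Q) = (m', U, (\<lambda>x. x) \<circ> P)" "plot X m' U P"
  then show ?thesis using plot_openin[OF X] plot_funcset[OF X] pushout_facts(1) by fastforce
next
  fix m' U P assume *: "(m, V, Q) = (m', U, \<Phi> \<circ> P)" "plot (coproduct_diffeology (\<lambda>_. smooth_disk (Suc n)) I) m' U P"
  then have "P \<in> U \<rightarrow> I \<times> \<D>" using plot_funcset[OF diffeological_space_coproduct *(2)] by simp
  then have "\<Phi> (P x) \<in> points X'" if "x \<in> U" for x
  proof -
    have "P x \<in> I \<times> \<D>" using \<open>P \<in> U \<rightarrow> I \<times> \<D>\<close> that by (rule funcset_mem)
    then have "\<Phi> (P x) \<in> \<Phi> ` (I \<times> \<D>)" by (rule imageI)
    then show ?thesis unfolding pushout_facts(1) by (rule UnI2)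
  qed
  then show ?thesis using plot_openin[OF diffeological_space_coproduct *(2)] *(1) by auto
qed

lemma plot_inclusion: "plot X m U P \<Longrightarrow> plot X' m U P"
  using generators_in[of m U P] plot_generator[of m U P generators]
  by (subst X'_generated) (fastforce simp: generators_def o_def)

lemma plot_cell:
  assumes "\<alpha> \<in> I" "plot (smooth_disk (Suc n)) m U y"
  shows "plot X' m U (\<lambda>u. \<Phi> (\<alpha>, y u))"
proof -
  have "plot (coproduct_diffeology (\<lambda>_. smooth_disk (Suc n)) I) m U (\<lambda>u. (\<alpha>, y u))"
    using assms diffeological_space_subset by (intro plot_coproductI)
  then have "(m, U, \<Phi> \<circ> (\<lambda>u. (\<alpha>, y u))) \<in> generators"
    unfolding generators_def by blast
  then have "(m, U, \<lambda>u. \<Phi> (\<alpha>, y u)) \<in> generators" by (simp add: o_def)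
  then show ?thesis
    using generators_in plot_generator X'_generated by metis
qed

text \<open>A generator comes from \<open>X\<close> or from the disks, and a plot of the disks stays
  locally in one of them. A constant piece is assigned to one of the two cases according to its
  value.\<close>

lemma plot_local:
  assumes P: "plot X' m U P" and u: "u \<in> U"
  obtains (base) W where "openin (Euclidean_space m) W" "u \<in> W" "W \<subseteq> U" "plot X m W P"
  | (cell) W \<alpha> y where "openin (Euclidean_space m) W" "u \<in> W" "W \<subseteq> U" "\<alpha> \<in> I"
      "plot (smooth_disk (Suc n)) m W y" "\<And>w. w \<in> W \<Longrightarrow> P w = \<Phi> (\<alpha>, y w)"
proof -
  obtain W where W: "openin (Euclidean_space m) W" "u \<in> W" "W \<subseteq> U" "locally_generated (points X') generators m W P"
  proof -
    have "plot (generated_diffeology (points X') generators) m U P"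
      by (simp only: X'_generated[symmetric] P)
    from plot_generated_local[OF generators_in this u] show thesis using that by blast
  qed
  from W(4) show ?thesis
    unfolding locally_generated_def
  proof (elim disjE exE bexE conjE)
    fix s assume s: "s \<in> points X'" "\<forall>w\<in>W. P w = s"
    show ?thesis
    proof (cases "s \<in> points X")
      case True
      have "plot X m W P"
        by (rule plot_cong[OF X plot_const[OF X W(1) True]]) (use s in auto)
      then show ?thesis using base W by blast
    next
      case False
      then obtain \<alpha> x where "\<alpha> \<in> I" "x \<in> \<D>" "s = \<Phi> (\<alpha>, x)" using s pushout_facts(1) by blast
      then show ?thesis
        using cell[OF W(1-3), of \<alpha> "\<lambda>_. x"] plot_const[OF diffeological_space_subset W(1), of x] s by auto
    qed
  next
    fix l V Q \<phi> assume *: "(l, V, Q) \<in> generators" "euclidean_smooth m W l V \<phi>" "\<forall>w\<in>W. P w = Q (\<phi> w)"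
    from *(1) consider "plot X l V Q"
      | R where "plot (coproduct_diffeology (\<lambda>_. smooth_disk (Suc n)) I) l V R" "Q = \<Phi> \<circ> R"
      unfolding generators_def by (auto simp: o_def)
    then show ?thesis
    proof cases
      case 1
      have "plot X m W P"
        by (rule plot_cong[OF X plot_comp[OF X 1 *(2)]]) (use *(3) in auto)
      then show ?thesis using base W by blast
    next
      case 2
      have "plot (coproduct_diffeology (\<lambda>_. smooth_disk (Suc n)) I) m W (R \<circ> \<phi>)"
        by (rule plot_comp[OF diffeological_space_coproduct 2(1) *(2)])
      from plot_coproduct_local[of I "\<lambda>_. smooth_disk (Suc n)", OF diffeological_space_subset this W(2)]
      obtain T \<alpha> y where T: "openin (Euclidean_space m) T" "u \<in> T" "T \<subseteq> W" "\<alpha> \<in> I"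
          "plot (smooth_disk (Suc n)) m T y" "\<And>w. w \<in> T \<Longrightarrow> (R \<circ> \<phi>) w = (\<alpha>, y w)"
        by blast
      have "P w = \<Phi> (\<alpha>, y w)" if "w \<in> T" for w
        using *(3) T(3) T(6)[OF that] that 2(2) by auto
      then show ?thesis using cell[OF T(1,2) _ T(4,5)] T(3) W(3) by blast
    qed
  qed
qed

lemma plot_attach:
  assumes "\<alpha> \<in> I" "plot (smooth_sphere n) m W y"
  shows "plot X m W (\<lambda>w. h (\<alpha>, y w))"
proof -
  have "smooth_map (smooth_sphere n) X (\<lambda>x. h (\<alpha>, x))"
    using smooth_map_from_spheres[OF X, of n I h] h_smooth assms(1) by blast
  then have "plot X m W ((\<lambda>x. h (\<alpha>, x)) \<circ> y)"
    using assms(2) unfolding smooth_map_def by blast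
  then show ?thesis by (simp add: o_def)
qed

text \<open>In the cell case the lift has to stay on the boundary sphere, because open cells do not
  meet \<open>X\<close>; the smooth attaching map then carries it to a plot of \<open>X\<close>.
  This lets the induction hypothesis for \<open>X\<close> see smoothness that was obtained in
  \<open>X'\<close>.\<close>

lemma plot_corestrict:
  assumes P: "plot X' m U P" and in_X: "P \<in> U \<rightarrow> points X"
  shows "plot X m U P"
proof (rule plot_locally[OF X])
  fix u assume "u \<in> U"
  with P show "\<exists>W. openin (Euclidean_space m) W \<and> u \<in> W \<and> W \<subseteq> U \<and> plot X m W P"
  proof (cases rule: plot_local)
    case (cell W \<alpha> y)
    have y: "y w \<in> \<S>" if "w \<in> W" for w
    proof (rule ccontr)
      assume "y w \<notin> \<S>"
      moreover have "y w \<in> \<D>" using cell(5) that by (auto simp: plot_subset_diffeology)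
      ultimately have "P w \<notin> points X" using pushout_facts(4) cell(4,6) that by fastforce
      then show False using in_X cell(3) that by auto
    qed
    then have "plot (smooth_sphere n) m W y"
      using cell(5) by (auto simp: plot_subset_diffeology)
    from plot_attach[OF cell(4) this] have "plot X m W (\<lambda>w. h (\<alpha>, y w))" .
    then have "plot X m W P"
      by (rule plot_cong[OF X]) (use cell y pushout_facts(2) in auto)
    then show ?thesis using cell by blast
  qed blast
qed

text \<open>On the sphere, the attaching map agrees with its composition with the projection of the
  punctured space. That composition is a plot, and plots are continuous.\<close>

lemma attach_continuous:
  assumes \<alpha>: "\<alpha> \<in> I"
  shows "continuous_map (nsphere n) (D_topology X) (\<lambda>x. h (\<alpha>, x))"
proof -
  from continuous_map_plot[OF X plot_attach[OF \<alpha> plot_sphere_project]]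
  have "continuous_map (subtopology (Euclidean_space (Suc n)) \<S>) (D_topology X) (\<lambda>x. h (\<alpha>, sphere_project n x))"
    by (rule continuous_map_from_subtopology_mono) (rule nsphere_subset_punctured)
  then have "continuous_map (nsphere n) (D_topology X) (\<lambda>x. h (\<alpha>, sphere_project n x))"
    by (simp flip: nsphere_eq_subtopology)
  then show ?thesis
    by (rule continuous_map_eq) (simp add: sphere_project_id)
qed

text \<open>The D-topology carries this pushout to a topological one. Openness is tested on the
  generators alone: those from \<open>X\<close> amount to openness in \<open>D_topology X\<close>,
  those from the disks to openness in the ordinary topology of each disk, by
  \<open>openin_D_disk\<close>.\<close>

sublocale cell_attachment "D_topology X" "D_topology X'" "disk_topology (Suc n)" \<S> I \<Phi>
proof
  show "closedin (disk_topology (Suc n)) \<S>" by (rule closedin_disk_nsphere)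
  show "topspace (D_topology X') = topspace (D_topology X) \<union> \<Phi> ` (I \<times> topspace (disk_topology (Suc n)))"
    using pushout_facts(1) X X'_diffeological by (simp del: topspace_subtopology)
  show "inj_on \<Phi> (I \<times> (topspace (disk_topology (Suc n)) - \<S>))"
    using pushout_facts(3) by (simp del: topspace_subtopology)
  show "\<Phi> ` (I \<times> (topspace (disk_topology (Suc n)) - \<S>)) \<inter> topspace (D_topology X) = {}"
    using pushout_facts(4) X by (simp del: topspace_subtopology)
  show "continuous_map (subtopology (disk_topology (Suc n)) \<S>) (D_topology X) (\<lambda>x. \<Phi> (\<alpha>, x))" if "\<alpha> \<in> I" for \<alpha>
    unfolding nsphere_eq[symmetric]
    by (rule continuous_map_eq[OF attach_continuous[OF that]]) (simp add: pushout_facts(2) that)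
  fix W
  have eq: "{x \<in> U. ((\<lambda>x. x) \<circ> P) x \<in> W} = {x \<in> U. P x \<in> W \<inter> points X}" if "plot X m U P" for m U P
    using plot_funcset[OF X that] by auto
  have 1: "(\<forall>m U P. plot X m U P \<longrightarrow> openin (Euclidean_space m) {x \<in> U. ((\<lambda>x. x) \<circ> P) x \<in> W}) \<longleftrightarrow>
      openin (D_topology X) (W \<inter> points X)"
    using eq by (simp add: openin_D_topology[OF X])
  let ?C = "coproduct_diffeology (\<lambda>_. smooth_disk (Suc n)) I"
  let ?W = "{c \<in> I \<times> \<D>. \<Phi> c \<in> W}"
  have eq2: "{x \<in> U. (\<Phi> \<circ> P) x \<in> W} = {x \<in> U. P x \<in> ?W}" if "plot ?C m U P" for m U P
    using plot_funcset[OF diffeological_space_coproduct that] by auto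
  have "(\<forall>m U P. plot ?C m U P \<longrightarrow> openin (Euclidean_space m) {x \<in> U. (\<Phi> \<circ> P) x \<in> W}) \<longleftrightarrow>
      openin (D_topology ?C) ?W"
    using eq2 by (auto simp: openin_D_topology[OF diffeological_space_coproduct])
  also have "\<dots> \<longleftrightarrow> (\<forall>\<alpha>\<in>I. openin (disk_topology (Suc n)) {x \<in> \<D>. \<Phi> (\<alpha>, x) \<in> W})"
    by (subst openin_D_coproduct[OF diffeological_space_subset]) (auto simp: openin_D_disk Collect_conj_eq)
  finally have 2: "(\<forall>m U P. plot ?C m U P \<longrightarrow> openin (Euclidean_space m) {x \<in> U. (\<Phi> \<circ> P) x \<in> W}) \<longleftrightarrow>
    (\<forall>\<alpha>\<in>I. openin (disk_topology (Suc n)) {x \<in> \<D>. \<Phi> (\<alpha>, x) \<in> W})" .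
  have "openin (D_topology X') W \<longleftrightarrow> W \<subseteq> points X' \<and>
      (\<forall>m V Q. (m, V, Q) \<in> generators \<longrightarrow> openin (Euclidean_space m) {v \<in> V. Q v \<in> W})"
    using openin_D_generated[of generators "points X'" W, OF generators_in] X'_generated
    by (simp only: X'_generated[symmetric])
  also have "(\<forall>m V Q. (m, V, Q) \<in> generators \<longrightarrow> openin (Euclidean_space m) {v \<in> V. Q v \<in> W}) \<longleftrightarrow>
     (\<forall>m U P. plot X m U P \<longrightarrow> openin (Euclidean_space m) {x \<in> U. ((\<lambda>x. x) \<circ> P) x \<in> W}) \<and>
     (\<forall>m U P. plot ?C m U P \<longrightarrow> openin (Euclidean_space m) {x \<in> U. (\<Phi> \<circ> P) x \<in> W})"
    unfolding generators_def by blast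
  finally show "openin (D_topology X') W \<longleftrightarrow> W \<subseteq> topspace (D_topology X') \<and>
      openin (D_topology X) (W \<inter> topspace (D_topology X)) \<and>
      (\<forall>\<alpha>\<in>I. openin (disk_topology (Suc n)) {x \<in> topspace (disk_topology (Suc n)). \<Phi> (\<alpha>, x) \<in> W})"
    using 1 2 X X'_diffeological by (simp del: topspace_subtopology)
qed

end

section \<open>Smoothing continuous maps\<close>

text \<open>The homotopy is supported in a compact set, and smoothness is never lost on \<open>V\<close>; this
  makes the property stable under attaching cells of the next dimension.\<close>

definition smoothable :: "'a diffeology \<Rightarrow> bool" where
  "smoothable X \<longleftrightarrow> (\<forall>m U V K f.
     openin (Euclidean_space m) U \<and> V \<subseteq> U \<and> plot X m V f \<and> compactin (Euclidean_space m) K \<and> K \<subseteq> U \<and>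
     continuous_map (subtopology (Euclidean_space m) U) (D_topology X) f \<longrightarrow>
     (\<exists>f' L V'. compactin (Euclidean_space m) L \<and> L \<subseteq> U \<and> V \<union> K \<subseteq> V' \<and> V' \<subseteq> U \<and> plot X m V' f' \<and>
        homotopic_with (\<lambda>g. \<forall>u\<in>U - L. g u = f u) (subtopology (Euclidean_space m) U) (D_topology X) f f'))"

lemma topspace_subtopology_open: "openin X U \<Longrightarrow> topspace (subtopology X U) = U"
  using openin_subset by fastforce

lemma D_topology_discrete: "D_topology (discrete_diffeology S) = discrete_topology S"
  unfolding topology_eq openin_D_topology[OF diffeological_space_discrete]
proof (intro allI iffI)
  fix W assume W: "openin (discrete_topology S) W"
  have "openin (Euclidean_space n) {u \<in> T. P u \<in> W}" if P: "plot (discrete_diffeology S) n T P" for n T P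
  proof (subst openin_subopen, intro ballI)
    fix x assume x: "x \<in> {u \<in> T. P u \<in> W}"
    then obtain O' where O: "openin (Euclidean_space n) O'" "x \<in> O'" "O' \<subseteq> T" "\<forall>w\<in>O'. P w = P x"
      using P unfolding plot_discrete_diffeology by blast
    have "P w \<in> W" if "w \<in> O'" for w
      using bspec[OF O(4) that] x by (metis (no_types, lifting) mem_Collect_eq)
    then show "\<exists>O'. openin (Euclidean_space n) O' \<and> x \<in> O' \<and> O' \<subseteq> {u \<in> T. P u \<in> W}"
      using O(1-3) by blast
  qed
  with W show "W \<subseteq> points (discrete_diffeology S) \<and> (\<forall>n U P. plot (discrete_diffeology S) n U P \<longrightarrow>
      openin (Euclidean_space n) {u \<in> U. P u \<in> W})"
    by (simp del: Collect_conj_eq)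
qed auto

text \<open>A continuous map into a discrete space is locally constant, hence a plot on all of
  \<open>U\<close>; the constant homotopy is supported in the empty set.\<close>

lemma smoothable_discrete: "smoothable (discrete_diffeology S)"
  unfolding smoothable_def
proof (intro allI impI; elim conjE)
  fix m U V K and f :: "(nat \<Rightarrow> real) \<Rightarrow> 'a"
  assume U: "openin (Euclidean_space m) U" and V: "V \<subseteq> U" and K: "K \<subseteq> U"
    and f: "continuous_map (subtopology (Euclidean_space m) U) (D_topology (discrete_diffeology S)) f"
  have fS: "f u \<in> S" if "u \<in> U" for u
    using f that diffeological_space_discrete[of S] openin_subset[OF U] by (auto simp: continuous_map_def Pi_iff)
  have "openin (D_topology (discrete_diffeology S)) {s}" if "s \<in> S" for s
    using that by (simp add: D_topology_discrete)
  then have "openin (Euclidean_space m) {w \<in> U. f w \<in> {f u}}" if "u \<in> U" for u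
    using openin_preimage[OF U f] fS[OF that] by blast
  then have "plot (discrete_diffeology S) m U f"
    unfolding plot_discrete_diffeology using U fS by blast
  moreover have "homotopic_with (\<lambda>g. \<forall>u\<in>U - {}. g u = f u) (subtopology (Euclidean_space m) U)
      (D_topology (discrete_diffeology S)) f f"
    using f by simp
  ultimately show "\<exists>f' L V'. compactin (Euclidean_space m) L \<and> L \<subseteq> U \<and> V \<union> K \<subseteq> V' \<and> V' \<subseteq> U \<and>
      plot (discrete_diffeology S) m V' f' \<and>
      homotopic_with (\<lambda>g. \<forall>u\<in>U - L. g u = f u) (subtopology (Euclidean_space m) U) (D_topology (discrete_diffeology S)) f f'"
    using V K by (intro exI[of _ f] exI[of _ "{}"] exI[of _ U]) auto
qed

lemma continuous_map_open_cover:
  assumes "\<And>W. W \<in> \<U> \<Longrightarrow> openin X W \<and> continuous_map (subtopology X W) Y f" "topspace X \<subseteq> \<Union>\<U>"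
  shows "continuous_map X Y f"
proof -
  have "continuous_map (subtopology X (\<Union>\<U>)) Y f"
    by (rule continuous_map_Union_open) (rule assms(1))
  then show ?thesis using assms(2) by (simp add: subtopology_superset)
qed

text \<open>As \<open>|b i| \<le> 1\<close> and \<open>e \<le> 1\<close>, the factor
  \<open>|a i + b i|\<close> in the difference of the squares is at most 3.\<close>

lemma sqn_perturb:
  assumes "\<And>i. i < d \<Longrightarrow> \<bar>a i - b i\<bar> \<le> e" "sqn d b \<le> 1" "0 \<le> e" "e \<le> 1"
  shows "\<bar>sqn d a - sqn d b\<bar> \<le> 3 * real d * e"
proof -
  have "\<bar>(a i)\<^sup>2 - (b i)\<^sup>2\<bar> \<le> 3 * e" if i: "i < d" for i
  proof -
    have "(b i)\<^sup>2 \<le> sqn d b" using i by (intro member_le_sum) auto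
    then have "(b i)\<^sup>2 \<le> 1" using assms(2) by linarith
    then have "\<bar>b i\<bar> \<le> 1" by (simp add: abs_square_le_1)
    then have "\<bar>a i + b i\<bar> \<le> 3" using assms(1)[OF i] assms(4) by linarith
    then have "\<bar>a i - b i\<bar> * \<bar>a i + b i\<bar> \<le> e * 3"
      using assms(1)[OF i] by (intro mult_mono) auto
    then show ?thesis by (simp add: power2_eq_square square_diff_square_factored abs_mult mult.commute)
  qed
  then have "(\<Sum>i<d. \<bar>(a i)\<^sup>2 - (b i)\<^sup>2\<bar>) \<le> (\<Sum>i<d. 3 * e)"
    by (intro sum_mono) auto
  then show ?thesis
    using sum_abs[of "\<lambda>i. (a i)\<^sup>2 - (b i)\<^sup>2" "{..<d}"] by (simp add: sum_subtractf algebra_simps)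
qed

lemma closedin_Euclidean_compactin: "compactin (Euclidean_space m) L \<Longrightarrow> closedin (Euclidean_space m) L"
  using compactin_imp_closedin Hausdorff_Euclidean_space by blast

context smooth_attachment
begin

text \<open>The squared radius of a point in its cell. Cell boundaries have squared radius 1, so
  with this value on \<open>X\<close> the function is continuous.\<close>

definition level :: "'a \<Rightarrow> real" where
  "level = cell_ext (\<lambda>_. 1) (\<lambda>c. sqn (Suc n) (snd c))"

lemma topspace_DX [simp]: "topspace (D_topology X) = points X"
  and topspace_DX' [simp]: "topspace (D_topology X') = points X'"
  using X X'_diffeological by auto

lemma level_cell: "\<alpha> \<in> I \<Longrightarrow> x \<in> \<D> \<Longrightarrow> level (\<Phi> (\<alpha>, x)) = sqn (Suc n) x"
  unfolding level_def by (subst cell_ext_cell) (auto simp: topspace_nsphere simp del: sum.lessThan_Suc topspace_subtopology)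

lemma level_base: "z \<in> points X \<Longrightarrow> level z = 1"
  by (simp add: level_def cell_ext_A)

lemma continuous_level: "continuous_map (D_topology X') euclideanreal level"
proof (rule continuous_mapI)
  show "continuous_map (D_topology X) euclideanreal level"
    by (rule continuous_map_eq[of _ _ "\<lambda>_. 1"]) (auto simp: level_base)
  fix \<alpha> assume "\<alpha> \<in> I"
  have "continuous_map (disk_topology (Suc n)) euclideanreal (sqn (Suc n))"
    using continuous_map_sqn[of "Euclidean_space (Suc n)" "Suc n" "\<lambda>x. x"]
    by (intro continuous_map_from_subtopology) (simp del: sum.lessThan_Suc)
  then show "continuous_map (disk_topology (Suc n)) euclideanreal (\<lambda>x. level (\<Phi> (\<alpha>, x)))"
    by (rule continuous_map_eq) (use \<open>\<alpha> \<in> I\<close> in \<open>simp add: level_cell del: sum.lessThan_Suc\<close>)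
qed

lemma level_interior:
  assumes "z \<in> points X' - points X"
  shows "level z < 1"
proof -
  have c: "coord z \<in> I \<times> (\<D> - \<S>)" "\<Phi> (coord z) = z"
    using coord_in[of z] cell_coord[of z] assms by (auto simp del: topspace_subtopology)
  then have "level z = sqn (Suc n) (snd (coord z))"
    using level_cell[of "fst (coord z)" "snd (coord z)"] by (auto simp: mem_Times_iff simp del: sum.lessThan_Suc)
  moreover have "sqn (Suc n) (snd (coord z)) \<noteq> 1" "sqn (Suc n) (snd (coord z)) \<le> 1"
    using c by (auto simp: mem_Times_iff topspace_nsphere unit_disk_def simp del: sum.lessThan_Suc)
  ultimately show ?thesis by simp
qed

text \<open>The collar pushes of all cells at once. Boundary points are fixed, so the identity on
  \<open>X\<close> fits with them.\<close>

definition push_out :: "real \<Rightarrow> 'a \<Rightarrow> 'a" where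
  "push_out t = cell_ext (\<lambda>z. z) (\<lambda>c. \<Phi> (fst c, collar_push (Suc n) t (snd c)))"

lemma push_out_base: "z \<in> points X \<Longrightarrow> push_out t z = z"
  by (simp add: push_out_def cell_ext_A)

lemma push_out_cell: "\<alpha> \<in> I \<Longrightarrow> x \<in> \<D> \<Longrightarrow> push_out t (\<Phi> (\<alpha>, x)) = \<Phi> (\<alpha>, collar_push (Suc n) t x)"
  unfolding push_out_def
  by (subst cell_ext_cell) (auto simp: topspace_nsphere collar_push_boundary simp del: sum.lessThan_Suc topspace_subtopology)

lemma push_out_0:
  assumes "z \<in> points X'"
  shows "push_out 0 z = z"
proof -
  have "z \<in> topspace (D_topology X')" using assms by simp
  then show ?thesis
  proof (cases rule: cell_cases)
    case (2 \<alpha> x)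
    then have "x \<in> \<D>" by (simp del: topspace_subtopology)
    then show ?thesis using 2 by (simp add: push_out_cell collar_push_0)
  qed (simp add: push_out_base)
qed

lemma continuous_push_out:
  "continuous_map (prod_topology (top_of_set {0..1}) (D_topology X')) (D_topology X') (\<lambda>p. push_out (fst p) (snd p))"
proof (rule continuous_map_prodI)
  have "continuous_map (prod_topology (top_of_set {0..1}) (D_topology X)) (D_topology X') (\<lambda>p. snd p)"
    using continuous_map_compose[OF continuous_map_snd continuous_inclusion] by (simp add: o_def)
  then show "continuous_map (prod_topology (top_of_set {0..1}) (D_topology X)) (D_topology X') (\<lambda>p. push_out (fst p) (snd p))"
    by (rule continuous_map_eq) (auto simp: push_out_base)
  fix \<alpha> assume \<alpha>: "\<alpha> \<in> I"
  let ?P = "prod_topology (top_of_set {0..1}) (disk_topology (Suc n))"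
  have "continuous_map ?P euclideanreal fst"
    by (meson continuous_map_fst continuous_map_in_subtopology)
  moreover have "continuous_map ?P (Euclidean_space (Suc n)) snd"
    by (meson continuous_map_snd continuous_map_in_subtopology)
  ultimately have "continuous_map ?P (Euclidean_space (Suc n)) (\<lambda>p. collar_push (Suc n) (fst p) (snd p))"
    by (rule continuous_map_collar_push)
  then have "continuous_map ?P (disk_topology (Suc n)) (\<lambda>p. collar_push (Suc n) (fst p) (snd p))"
    using collar_push_in_disk by (auto simp: continuous_map_in_subtopology)
  from continuous_map_compose[OF this continuous_cell[OF \<alpha>]]
  show "continuous_map ?P (D_topology X') (\<lambda>p. push_out (fst (fst p, \<Phi> (\<alpha>, snd p))) (snd (fst p, \<Phi> (\<alpha>, snd p))))"
    by (rule continuous_map_eq) (auto simp: push_out_cell \<alpha>)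
qed

text \<open>Inside the open cells \<open>f\<close> has coordinates in R^(n+1), and these are blended
  with smooth approximations by a cutoff function. Only the part of \<open>K\<close> with level at
  most 3/4 is treated, as it is compact inside the open set \<open>W\<close>; on the rest the level
  stays at least 1/2, ready for the collar push. Where \<open>f\<close> was a plot it remains one,
  since all ingredients of the blend are smooth there.\<close>

lemma approximate_in_cells:
  assumes U: "openin (Euclidean_space m) U" and V: "V \<subseteq> U" and fV: "plot X' m V f"
    and K: "compactin (Euclidean_space m) K" "K \<subseteq> U"
    and f: "continuous_map (subtopology (Euclidean_space m) U) (D_topology X') f"
  obtains f1 L V1 where "compactin (Euclidean_space m) L" "L \<subseteq> U" "V \<subseteq> V1" "V1 \<subseteq> U" "plot X' m V1 f1"
    "homotopic_with (\<lambda>g. \<forall>u\<in>U - L. g u = f u) (subtopology (Euclidean_space m) U) (D_topology X') f f1"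
    "\<And>u. u \<in> K \<Longrightarrow> u \<in> V1 \<or> level (f1 u) \<ge> 1/2"
proof -
  let ?d = "Suc n" and ?E = "topspace (Euclidean_space m)"
  note [simp del] = sum.lessThan_Suc topspace_subtopology and [simp] = topspace_subtopology_open
  define W where "W = {u \<in> U. f u \<in> points X' - points X}"
  have oW: "openin (Euclidean_space m) W"
    using openin_preimage[OF U f openin_interior] by (simp add: W_def)
  have WU: "W \<subseteq> U" by (auto simp: W_def)
  have UE: "U \<subseteq> ?E" using U openin_subset by blast
  have fU: "f u \<in> points X'" if "u \<in> U" for u
    using f that U by (auto simp: continuous_map_def Pi_iff)
  define a y where "a u = fst (coord (f u))" and "y u = snd (coord (f u))" for u
  have c: "a u \<in> I" "y u \<in> \<D>" "y u \<notin> \<S>" "\<Phi> (a u, y u) = f u" if "u \<in> W" for u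
    using coord_in[of "f u"] cell_coord[of "f u"] that by (auto simp: W_def a_def y_def mem_Times_iff)
  have sqn_y: "sqn ?d (y u) = level (f u)" if "u \<in> W" for u
    using level_cell[OF c(1,2)[OF that]] c(4)[OF that] by simp
  have lev_W: "level (f u) < 1" if "u \<in> W" for u
    using level_interior that by (auto simp: W_def)
  have fW: "continuous_map (subtopology (Euclidean_space m) W) (subtopology (D_topology X') (points X' - points X)) f"
    using continuous_map_from_subtopology_mono[OF f WU] oW
    by (auto simp: continuous_map_in_subtopology W_def)
  have oWb: "openin (Euclidean_space m) {u \<in> W. a u = b}" for b
  proof -
    have "openin (Euclidean_space m) {u \<in> U. f u \<in> {z \<in> points X' - points X. fst (coord z) = b}}"
      using openin_preimage[OF U f, OF openin_fst_coord[of b]] by simp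
    moreover have "{u \<in> U. f u \<in> {z \<in> points X' - points X. fst (coord z) = b}} = {u \<in> W. a u = b}"
      by (auto simp: W_def a_def)
    ultimately show ?thesis by simp
  qed
  have y_cont: "continuous_map (subtopology (Euclidean_space m) W) (disk_topology ?d) y"
    using continuous_map_compose[OF fW, of "disk_topology ?d" "\<lambda>z. snd (coord z)"] continuous_snd_coord
    by (simp add: o_def y_def[abs_def])
  then have y_cont_i: "continuous_map (subtopology (Euclidean_space m) W) euclideanreal (\<lambda>u. y u i)" if "i < ?d" for i
    using that by (auto simp: continuous_map_in_subtopology continuous_map_into_Euclidean)
  \<comment> \<open>The bound 3/4 exceeds 1/2 by more than the error 1/8 that is allowed
    below.\<close>
  define K1 where "K1 = {u \<in> K. level (f u) \<le> 3/4}"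
  have lf: "continuous_map (subtopology (Euclidean_space m) U) euclideanreal (\<lambda>u. level (f u))"
    using continuous_map_compose[OF f continuous_level] by (simp add: o_def)
  have "K1 = (?E - {u \<in> U. level (f u) \<in> {3/4<..}}) \<inter> K"
    using K UE by (auto simp: K1_def)
  moreover have "openin (Euclidean_space m) {u \<in> U. level (f u) \<in> {3/4<..}}"
    by (rule openin_preimage[OF U lf]) simp
  ultimately have K1: "compactin (Euclidean_space m) K1"
    using closed_Int_compactin[OF _ K(1)] by blast
  have "K1 \<subseteq> W"
    using K fU level_base by (fastforce simp: K1_def W_def)
  from smooth_cutoff[OF K1 oW this] obtain \<eta> N L where
    \<eta>: "smooth_fun m ?E \<eta>" "\<And>x. \<eta> x \<in> {0..1}"
    and N: "openin (Euclidean_space m) N" "K1 \<subseteq> N" "\<And>x. x \<in> N \<Longrightarrow> \<eta> x = 1"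
    and L: "compactin (Euclidean_space m) L" "L \<subseteq> W" "N \<subseteq> L" "\<And>x. x \<in> ?E - L \<Longrightarrow> \<eta> x = 0"
    by metis
  have LE: "L \<subseteq> ?E" using L(1) compactin_subset_topspace by blast
  have "continuous_on W (\<lambda>u. level (f u))"
    using continuous_map_from_subtopology_mono[OF lf WU] WU UE
    by (subst (asm) continuous_map_sub_Euclidean_iff) auto
  then have "continuous_on L (\<lambda>u. level (f u))" using L(2) continuous_on_subset by blast
  moreover have "compact L"
    using L(1) by (auto simp: Euclidean_space_eq_top_of_set compactin_subtopology)
  \<comment> \<open>A bound below 1 for the level on the compact set \<open>L\<close>: it measures
    the room for perturbation before the boundary sphere is reached. For empty \<open>L\<close> any
    value below 1 will do.\<close>
  ultimately obtain s where s: "s < 1" "\<And>u. u \<in> L \<Longrightarrow> level (f u) \<le> s"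
  proof (cases "L = {}")
    case False
    with \<open>compact L\<close> \<open>continuous_on L (\<lambda>u. level (f u))\<close>
    obtain u0 where "u0 \<in> L" "\<forall>u\<in>L. level (f u) \<le> level (f u0)"
      using continuous_attains_sup by blast
    then show ?thesis using that[of "level (f u0)"] lev_W L(2) by blast
  qed (use that[of 0] in auto)
  \<comment> \<open>Makes the error \<open>3 * real ?d * e\<close> of \<open>sqn_perturb\<close>
    equal to the minimum. The term 1/8 keeps levels above 3/4 from dropping below 1/2, and
    \<open>(1 - s) / 2\<close> keeps points inside the open disk.\<close>
  define e where "e = min (1/8) ((1 - s) / 2) / (3 * real ?d)"
  have e0: "0 < min (1/8) ((1 - s) / 2)" using s(1) by simp
  then have e: "0 < e" unfolding e_def by (intro divide_pos_pos) auto
  have e3: "3 * real ?d * e = min (1/8) ((1 - s) / 2)" by (simp add: e_def)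
  have e1: "e \<le> 1"
  proof -
    have "1 * e \<le> 3 * real ?d * e" using e by (intro mult_right_mono) auto
    then show ?thesis using e3 by linarith
  qed
  have "\<exists>p. smooth_fun m ?E p \<and> (\<forall>u\<in>L. \<bar>y u i - p u\<bar> < e)" if "i < ?d" for i
  proof -
    have "continuous_on W (\<lambda>u. y u i)"
      using y_cont_i[OF that] WU UE by (subst (asm) continuous_map_sub_Euclidean_iff) auto
    then have "continuous_on L (\<lambda>u. y u i)" using L(2) continuous_on_subset by blast
    show ?thesis by (rule smooth_approximation[OF L(1) \<open>continuous_on L (\<lambda>u. y u i)\<close> e]) blast
  qed
  then have "\<exists>p. \<forall>i. i < ?d \<longrightarrow> smooth_fun m ?E (p i) \<and> (\<forall>u\<in>L. \<bar>y u i - p i u\<bar> < e)"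
    by (intro choice) blast
  then obtain p where p: "\<And>i. i < ?d \<Longrightarrow> smooth_fun m ?E (p i)"
      "\<And>i u. i < ?d \<Longrightarrow> u \<in> L \<Longrightarrow> \<bar>y u i - p i u\<bar> < e"
    by blast
  \<comment> \<open>The straight-line homotopy from \<open>y\<close> towards \<open>p\<close>,
    damped by \<open>\<eta>\<close>. On \<open>W\<close> outside \<open>L\<close> it stays at
    \<open>y\<close>, so it fits with \<open>f\<close> outside \<open>W\<close>.\<close>
  define q where "q t u = (\<lambda>i. if i < ?d then (1 - t * \<eta> u) * y u i + (t * \<eta> u) * p i u else 0)" for t u
  have q_off: "q t u = y u" if "u \<in> W" "u \<notin> L" for t u
  proof -
    have "\<eta> u = 0" using L(4) that WU UE by auto
    moreover have "y u \<in> topspace (Euclidean_space ?d)" using c(2)[OF that(1)] unit_disk_subset by blast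
    ultimately show ?thesis by (auto simp: q_def topspace_Euclidean_space fun_eq_iff)
  qed
  have q_close: "\<bar>sqn ?d (q t u) - level (f u)\<bar> \<le> min (1/8) ((1 - s) / 2)" if "u \<in> W" "t \<in> {0..1}" for t u
  proof (cases "u \<in> L")
    case True
    have "\<bar>q t u i - y u i\<bar> \<le> e" if i: "i < ?d" for i
    proof -
      have "q t u i - y u i = (t * \<eta> u) * (p i u - y u i)" using i by (simp add: q_def algebra_simps)
      moreover have "0 \<le> t * \<eta> u" "t * \<eta> u \<le> 1"
        using \<eta>(2)[of u] \<open>t \<in> {0..1}\<close> by (auto intro: mult_le_one)
      ultimately have "\<bar>q t u i - y u i\<bar> \<le> 1 * \<bar>p i u - y u i\<bar>"
        by (simp only: abs_mult) (intro mult_right_mono, auto)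
      then show ?thesis using p(2)[OF i True] by (simp add: abs_minus_commute)
    qed
    moreover have "sqn ?d (y u) \<le> 1" using c(2)[OF that(1)] by (simp add: unit_disk_def)
    ultimately have "\<bar>sqn ?d (q t u) - sqn ?d (y u)\<bar> \<le> 3 * real ?d * e"
      using e e1 by (intro sqn_perturb) auto
    then show ?thesis using e3 sqn_y[OF that(1)] by simp
  next
    case False
    then show ?thesis using q_off[OF that(1)] sqn_y[OF that(1)] e0 by simp
  qed
  have q_lt: "sqn ?d (q t u) < 1" if "u \<in> W" "t \<in> {0..1}" for t u
  proof (cases "u \<in> L")
    case True
    have "sqn ?d (q t u) - level (f u) \<le> (1 - s) / 2"
      using q_close[OF that] min.cobounded2[of "1/8" "(1 - s) / 2"] by linarith
    then show ?thesis using s(2)[OF True] s(1) by (simp add: field_simps)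
  next
    case False
    then show ?thesis using q_off[OF that(1)] sqn_y[OF that(1)] lev_W[OF that(1)] by simp
  qed
  have qD: "q t u \<in> \<D>" if "u \<in> W" "t \<in> {0..1}" for t u
    using q_lt[OF that] by (simp add: unit_disk_def topspace_Euclidean_space q_def)
  define H where "H z = (if snd z \<in> W then \<Phi> (a (snd z), q (fst z) (snd z)) else f (snd z))" for z :: "real \<times> (nat \<Rightarrow> real)"
  have H_off: "H (t, u) = f u" if "u \<in> U - L" for t u
    using that q_off c(4) by (auto simp: H_def)
  let ?T = "prod_topology (top_of_set {0..1::real}) (subtopology (Euclidean_space m) U)"
  have oT: "openin ?T ({0..1} \<times> O')" if "openin (Euclidean_space m) O'" "O' \<subseteq> U" for O'
    using that U by (simp add: openin_prod_Times_iff openin_open_subtopology openin_subtopology_self)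
  have fst_cont: "continuous_map (subtopology ?T S) euclideanreal fst" for S
    by (meson continuous_map_from_subtopology continuous_map_fst continuous_map_in_subtopology)
  have snd_cont: "continuous_map (subtopology ?T ({0..1} \<times> O')) (subtopology (Euclidean_space m) O') snd"
    if "O' \<subseteq> U" for O'
    using that by (auto simp: continuous_map_in_subtopology topspace_subtopology intro: continuous_map_from_subtopology
        continuous_map_into_fulltopology[OF continuous_map_snd])
  have H_cont: "continuous_map ?T (D_topology X') H"
  proof (rule continuous_map_open_cover)
    \<comment> \<open>Off \<open>L\<close> the homotopy is constant. The other sets cover
      \<open>L\<close>; on each of them the cell index is fixed, and \<open>H\<close> is a
      characteristic map after \<open>q\<close>.\<close>
    let ?\<U> = "insert ({0..1::real} \<times> (U - L)) ((\<lambda>b. {0..1} \<times> {u \<in> W. a u = b}) ` I)"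
    show "topspace ?T \<subseteq> \<Union>?\<U>"
    proof
      fix z :: "real \<times> (nat \<Rightarrow> real)" assume "z \<in> topspace ?T"
      then have z: "fst z \<in> {0..1}" "snd z \<in> U" by (auto simp: topspace_subtopology)
      show "z \<in> \<Union>?\<U>"
      proof (cases "snd z \<in> L")
        case True
        then have "z \<in> {0..1} \<times> {u \<in> W. a u = a (snd z)}" "a (snd z) \<in> I"
          using z c(1) L(2) by (auto simp: mem_Times_iff)
        then show ?thesis by blast
      next
        case False
        then have "z \<in> {0..1} \<times> (U - L)" using z by (simp add: mem_Times_iff)
        then show ?thesis by blast
      qed
    qed
    fix O' :: "(real \<times> (nat \<Rightarrow> real)) set" assume "O' \<in> ?\<U>"
    then consider "O' = {0..1} \<times> (U - L)" | b where "b \<in> I" "O' = {0..1} \<times> {u \<in> W. a u = b}" by blast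
    then show "openin ?T O' \<and> continuous_map (subtopology ?T O') (D_topology X') H"
    proof cases
      case 1
      have "openin (Euclidean_space m) (U - L)"
        using U closedin_Euclidean_compactin[OF L(1)] by (rule openin_diff)
      moreover have "continuous_map (subtopology ?T O') (D_topology X') (\<lambda>z. f (snd z))"
        using continuous_map_compose[OF snd_cont[of "U - L"] continuous_map_from_subtopology_mono[OF f]] 1
        by (auto simp: o_def)
      then have "continuous_map (subtopology ?T O') (D_topology X') H"
        by (rule continuous_map_eq) (auto simp: 1 H_off topspace_subtopology)
      ultimately show ?thesis using oT 1 by simp
    next
      case 2
      let ?W = "{u \<in> W. a u = b}"
      have sW: "continuous_map (subtopology ?T O') (subtopology (Euclidean_space m) W) snd"
        using snd_cont[of ?W] WU 2(2) by (auto simp: continuous_map_in_subtopology)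
      have sE: "continuous_map (subtopology ?T O') (subtopology (Euclidean_space m) ?E) snd"
        using sW by (auto simp: continuous_map_in_subtopology)
      have "continuous_map (subtopology ?T O') euclideanreal (\<lambda>z. q (fst z) (snd z) i)" if i: "i < ?d" for i
      proof -
        have \<eta>': "continuous_map (subtopology ?T O') euclideanreal (\<lambda>z. \<eta> (snd z))"
          using continuous_map_compose[OF sE smooth_fun_continuous[OF \<eta>(1)]] by (simp add: o_def)
        have p': "continuous_map (subtopology ?T O') euclideanreal (\<lambda>z. p i (snd z))"
          using continuous_map_compose[OF sE smooth_fun_continuous[OF p(1)[OF i]]] by (simp add: o_def)
        have y': "continuous_map (subtopology ?T O') euclideanreal (\<lambda>z. y (snd z) i)"
          using continuous_map_compose[OF sW y_cont_i[OF i]] by (simp add: o_def)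
        show ?thesis
          unfolding q_def using i
          by (auto intro!: continuous_map_add continuous_map_real_mult continuous_map_diff \<eta>' p' y' fst_cont)
      qed
      then have "continuous_map (subtopology ?T O') (disk_topology ?d) (\<lambda>z. q (fst z) (snd z))"
        using qD unit_disk_subset 2(2)
        by (auto simp: continuous_map_in_subtopology continuous_map_into_Euclidean topspace_subtopology subset_iff)
      from continuous_map_compose[OF this continuous_cell[OF 2(1)]]
      have "continuous_map (subtopology ?T O') (D_topology X') H"
        by (rule continuous_map_eq) (auto simp: H_def 2(2) topspace_subtopology)
      moreover have "openin ?T O'" using oT[OF oWb[of b]] WU 2(2) by auto
      ultimately show ?thesis by simp
    qed
  qed
  define f1 where "f1 u = H (1, u)" for u
  have H0: "H (0, u) = f u" for u
  proof (cases "u \<in> W")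
    case True
    have "y u \<in> topspace (Euclidean_space ?d)" using c(2)[OF True] unit_disk_subset by blast
    then have "q 0 u = y u" by (auto simp: q_def topspace_Euclidean_space fun_eq_iff)
    then show ?thesis using c(4)[OF True] True by (simp add: H_def)
  qed (simp add: H_def)
  have hom: "homotopic_with (\<lambda>g. \<forall>u\<in>U - L. g u = f u) (subtopology (Euclidean_space m) U) (D_topology X') f f1"
    unfolding homotopic_with_def using H_cont H0 H_off by (intro exI[of _ H]) (auto simp: f1_def)
  have oV: "openin (Euclidean_space m) V" using plot_openin[OF X'_diffeological fV] .
  have q1: "q 1 u = (\<lambda>i. if i < ?d then (1 - \<eta> u) * y u i + \<eta> u * p i u else 0)" for u
    unfolding q_def by (rule ext) simp
  have plot_cellwise: "plot X' m O' f1"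
    if O': "openin (Euclidean_space m) O'" "O' \<subseteq> W" "\<And>u. u \<in> O' \<Longrightarrow> a u = b" "b \<in> I"
      "\<And>i. i < ?d \<Longrightarrow> smooth_fun m O' (\<lambda>u. q 1 u i)" for O' b
  proof -
    have "plot (smooth_disk ?d) m O' (q 1)"
      unfolding plot_subset_diffeology using O' qD by auto
    from plot_cell[OF O'(4) this] show ?thesis
      by (rule plot_cong[OF X'_diffeological]) (use O' in \<open>auto simp: f1_def H_def\<close>)
  qed
  have "plot X' m (V \<union> N) f1"
  proof (rule plot_locally[OF X'_diffeological])
    fix u assume "u \<in> V \<union> N"
    \<comment> \<open>On \<open>N\<close> the blend is just the smooth \<open>p\<close>. On
      \<open>V\<close> inside \<open>W\<close> it mixes \<open>p\<close> with the smooth coordinates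
      of the plot \<open>f\<close>. On \<open>V\<close> outside \<open>W\<close> the map is
      unchanged near \<open>u\<close>, as the closed set \<open>L\<close> lies in
      \<open>W\<close>.\<close>
    then consider "u \<in> N" | "u \<in> V" "u \<in> W" | "u \<in> V" "u \<notin> W" by blast
    then show "\<exists>T. openin (Euclidean_space m) T \<and> u \<in> T \<and> T \<subseteq> V \<union> N \<and> plot X' m T f1"
    proof cases
      case 1
      then have uW: "u \<in> W" using L by blast
      let ?T = "N \<inter> {v \<in> W. a v = a u}"
      have oT: "openin (Euclidean_space m) ?T" using N(1) oWb by blast
      have "smooth_fun m ?T (\<lambda>v. q 1 v i)" if "i < ?d" for i
      proof (rule smooth_fun_cong[OF oT])
        show "smooth_fun m ?T (p i)" by (rule smooth_fun_mono[OF p(1)[OF that]]) (use WU UE in auto)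
      qed (use N(3) that in \<open>auto simp: q1\<close>)
      then have "plot X' m ?T f1"
        by (intro plot_cellwise[OF oT _ _ c(1)[OF uW]]) auto
      then show ?thesis using oT 1 uW by blast
    next
      case 2
      from fV 2(1) show ?thesis
      proof (cases rule: plot_local)
        case (base T)
        then have "f u \<in> points X" using plot_funcset[OF X] by blast
        then show ?thesis using 2(2) by (simp add: W_def)
      next
        case (cell T b y')
        let ?T = "T \<inter> W"
        have oT: "openin (Euclidean_space m) ?T" using cell(1) oW by blast
        \<comment> \<open>The lift of the plot to the cell is the coordinate map itself, because the
          characteristic map is injective on open cells. So the coordinates of \<open>f\<close> are
          smooth here.\<close>
        have y': "a v = b \<and> y v = y' v" if "v \<in> ?T" for v
        proof -
          have v: "v \<in> T" "f v = \<Phi> (b, y' v)" "f v \<notin> points X" using that cell(6) by (auto simp: W_def)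
          moreover have "y' v \<in> \<D>" using cell(5) v(1) by (auto simp: plot_subset_diffeology)
          moreover from this have "y' v \<notin> \<S>" using v(2,3) attach_in[OF cell(4)] by auto
          ultimately have "coord (f v) = (b, y' v)" using coord_cell[OF cell(4)] by simp
          then show ?thesis by (simp add: a_def y_def)
        qed
        have "smooth_fun m ?T (\<lambda>v. q 1 v i)" if i: "i < ?d" for i
        proof (rule smooth_fun_cong[OF oT])
          have 1: "smooth_fun m ?T \<eta>" "smooth_fun m ?T (p i)"
            using \<eta>(1) p(1)[OF i] WU UE by (auto elim!: smooth_fun_mono)
          have 2: "smooth_fun m ?T (\<lambda>v. y' v i)"
            using cell(5) i by (auto simp: plot_subset_diffeology elim!: smooth_fun_mono)
          show "smooth_fun m ?T (\<lambda>v. (1 - \<eta> v) * y' v i + \<eta> v * p i v)"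
            by (intro smooth_fun_add smooth_fun_mult smooth_fun_diff smooth_fun_const 1 2)
        qed (use y' i in \<open>auto simp: q1\<close>)
        then have "plot X' m ?T f1"
          using y' by (intro plot_cellwise[OF oT _ _ cell(4)]) auto
        then show ?thesis using oT 2 cell by blast
      qed
    next
      case 3
      let ?T = "V - L"
      have oT: "openin (Euclidean_space m) ?T"
        using oV closedin_Euclidean_compactin[OF L(1)] by (rule openin_diff)
      have "plot X' m ?T f1"
        by (rule plot_cong[OF X'_diffeological plot_mono[OF X'_diffeological fV oT]]) (use H_off V in \<open>auto simp: f1_def\<close>)
      then show ?thesis using oT 3 L(2) by blast
    qed
  qed
  moreover have "u \<in> V \<union> N \<or> level (f1 u) \<ge> 1/2" if u: "u \<in> K" for u
  proof (cases "u \<in> W")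
    case True
    have "level (f1 u) = sqn ?d (q 1 u)"
      using level_cell[OF c(1)[OF True] qD[OF True, of 1]] True by (simp add: f1_def H_def)
    moreover have "\<bar>sqn ?d (q 1 u) - level (f u)\<bar> \<le> 1/8" using q_close[OF True, of 1] by simp
    moreover have "u \<in> N \<or> level (f u) > 3/4" using N(2) u by (auto simp: K1_def)
    ultimately show ?thesis by (elim disjE) auto
  next
    case False
    then have "f u \<in> points X" using u K fU by (auto simp: W_def)
    then show ?thesis using False by (simp add: f1_def H_def level_base)
  qed
  ultimately show ?thesis
    using that[OF L(1) _ _ _ _ hom] L WU V by blast
qed

text \<open>The push is run up to time \<open>\<eta> u\<close>, so it is complete near
  \<open>K\<close> and does not move points outside \<open>L\<close>. Plots stay plots because
  \<open>collar_push\<close> is smooth in time and place together. Where the push is complete and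
  starts in the collar, \<open>continuous_collar_retract\<close> gives continuity in the topology of
  \<open>X\<close>.\<close>

lemma push_to_skeleton:
  assumes U: "openin (Euclidean_space m) U" and fV: "plot X' m V f"
    and K: "compactin (Euclidean_space m) K" "K \<subseteq> U"
    and f: "continuous_map (subtopology (Euclidean_space m) U) (D_topology X') f"
  obtains f' L U' where "compactin (Euclidean_space m) L" "L \<subseteq> U" "plot X' m V f'"
    "homotopic_with (\<lambda>g. \<forall>u\<in>U - L. g u = f u) (subtopology (Euclidean_space m) U) (D_topology X') f f'"
    "openin (Euclidean_space m) U'" "U' \<subseteq> U"
    "continuous_map (subtopology (Euclidean_space m) U') (D_topology X) f'"
    "\<And>u. u \<in> U' \<Longrightarrow> f' u \<in> points X" "\<And>u. u \<in> K \<Longrightarrow> level (f u) \<ge> 1/2 \<Longrightarrow> u \<in> U'"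
proof -
  let ?d = "Suc n" and ?E = "topspace (Euclidean_space m)"
  note [simp del] = sum.lessThan_Suc topspace_subtopology and [simp] = topspace_subtopology_open
  have UE: "U \<subseteq> ?E" using U openin_subset by blast
  have fU: "f u \<in> points X'" if "u \<in> U" for u
    using f that U by (auto simp: continuous_map_def Pi_iff)
  obtain \<eta> N L where
    \<eta>: "smooth_fun m ?E \<eta>" "\<And>x. \<eta> x \<in> {0..1}"
    and N: "openin (Euclidean_space m) N" "K \<subseteq> N" "\<And>x. x \<in> N \<Longrightarrow> \<eta> x = 1"
    and L: "compactin (Euclidean_space m) L" "L \<subseteq> U" "N \<subseteq> L" "\<And>x. x \<in> ?E - L \<Longrightarrow> \<eta> x = 0"
    by (rule smooth_cutoff[OF K(1) U K(2)]) metis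
  define f' where "f' u = push_out (\<eta> u) (f u)" for u
  let ?T = "prod_topology (top_of_set {0..1::real}) (subtopology (Euclidean_space m) U)"
  define H where "H z = push_out (fst z * \<eta> (snd z)) (f (snd z))" for z :: "real \<times> (nat \<Rightarrow> real)"
  have snd_cont: "continuous_map ?T (subtopology (Euclidean_space m) U) snd"
    by (rule continuous_map_snd)
  have "continuous_map ?T (subtopology (Euclidean_space m) ?E) snd"
    using snd_cont by (auto simp: continuous_map_in_subtopology)
  from continuous_map_compose[OF this smooth_fun_continuous[OF \<eta>(1)]]
  have \<eta>': "continuous_map ?T euclideanreal (\<lambda>z. \<eta> (snd z))" by (simp add: o_def)
  have fst_cont: "continuous_map ?T euclideanreal fst"
    by (meson continuous_map_fst continuous_map_in_subtopology)
  have "continuous_map ?T euclideanreal (\<lambda>z. fst z * \<eta> (snd z))"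
    by (intro continuous_map_real_mult fst_cont \<eta>')
  moreover have "fst z * \<eta> (snd z) \<in> {0..1}" if "z \<in> topspace ?T" for z
    using that \<eta>(2)[of "snd z"] by (auto intro: mult_le_one)
  ultimately have "continuous_map ?T (top_of_set {0..1}) (\<lambda>z. fst z * \<eta> (snd z))"
    by (auto simp: continuous_map_in_subtopology)
  moreover have "continuous_map ?T (D_topology X') (\<lambda>z. f (snd z))"
    using continuous_map_compose[OF snd_cont f] by (simp add: o_def)
  ultimately have "continuous_map ?T (prod_topology (top_of_set {0..1}) (D_topology X')) (\<lambda>z. (fst z * \<eta> (snd z), f (snd z)))"
    by (simp add: continuous_map_pairwise o_def)
  from continuous_map_compose[OF this continuous_push_out]
  have H: "continuous_map ?T (D_topology X') H"
    by (simp add: o_def H_def[abs_def])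
  have H_off: "H (t, u) = f u" if "u \<in> U - L" for t u
    using that L(4)[of u] UE push_out_0[OF fU[of u]] by (auto simp: H_def)
  have hom: "homotopic_with (\<lambda>g. \<forall>u\<in>U - L. g u = f u) (subtopology (Euclidean_space m) U) (D_topology X') f f'"
  proof (subst homotopic_with)
    show "\<exists>h. continuous_map ?T (D_topology X') h \<and>
        (\<forall>x\<in>topspace (subtopology (Euclidean_space m) U). h (0, x) = f x) \<and>
        (\<forall>x\<in>topspace (subtopology (Euclidean_space m) U). h (1, x) = f' x) \<and>
        (\<forall>t\<in>{0..1}. \<forall>u\<in>U - L. h (t, u) = f u)"
      using H H_off U push_out_0[OF fU] by (intro exI[of _ H]) (auto simp: H_def f'_def)
  qed (use U in auto)
  \<comment> \<open>From level 1/4 on, the push at time 1 reaches the sphere. The strict inequality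
    makes the set open, and it still contains all points of \<open>N\<close> of level at least
    1/2.\<close>
  define U' where "U' = {u \<in> N. level (f u) \<in> {1/4<..}}"
  have NU: "N \<subseteq> U" using L by blast
  have fN: "continuous_map (subtopology (Euclidean_space m) N) (D_topology X') f"
    by (rule continuous_map_from_subtopology_mono[OF f NU])
  then have "continuous_map (subtopology (Euclidean_space m) N) euclideanreal (\<lambda>u. level (f u))"
    using continuous_map_compose[OF fN continuous_level] by (simp add: o_def)
  then have oU': "openin (Euclidean_space m) U'"
    unfolding U'_def by (rule openin_preimage[OF N(1)]) simp
  have U'U: "U' \<subseteq> U" using NU by (auto simp: U'_def)
  define T where "T = {x \<in> \<D>. sqn ?d x \<in> {1/4<..}}"
  have sq: "continuous_map (disk_topology ?d) euclideanreal (sqn ?d)"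
    using continuous_map_sqn[of "Euclidean_space ?d" ?d "\<lambda>x. x"]
    by (intro continuous_map_from_subtopology) simp
  have T: "openin (disk_topology ?d) T"
    using openin_continuous_map_preimage[OF sq, of "{1/4<..}"] by (simp add: T_def)
  have ST: "\<S> \<subseteq> T"
    using nsphere_subset_unit_disk by (auto simp: T_def topspace_nsphere)
  have "continuous_map (subtopology (disk_topology ?d) T) (Euclidean_space ?d) (collar_push ?d 1)"
    by (rule continuous_map_collar_push)
       (auto simp: subtopology_subtopology intro: continuous_map_from_subtopology)
  moreover have pS: "collar_push ?d 1 x \<in> \<S>" if "x \<in> T" for x
    using that sqn_collar_push_1[of x ?d] collar_push_in_Euclidean unit_disk_subset
    by (auto simp: T_def topspace_nsphere subset_iff)
  ultimately have \<rho>: "continuous_map (subtopology (disk_topology ?d) T) (subtopology (disk_topology ?d) \<S>) (collar_push ?d 1)"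
    using nsphere_subset_unit_disk T
    by (auto simp: continuous_map_in_subtopology)
  have "continuous_map (subtopology (D_topology X') (topspace (D_topology X) \<union> \<Phi> ` (I \<times> T))) (D_topology X) (push_out 1)"
    unfolding push_out_def
    by (rule continuous_collar_retract[OF T ST \<rho>]) (simp add: collar_push_boundary topspace_nsphere)
  moreover have fT: "f u \<in> points X \<union> \<Phi> ` (I \<times> T)" if u: "u \<in> U'" for u
  proof -
    have "f u \<in> topspace (D_topology X')" using fU u U'U by auto
    then show ?thesis
    proof (cases rule: cell_cases)
      case (2 \<alpha> x)
      then have "x \<in> T" using level_cell[of \<alpha> x] u by (simp add: T_def U'_def)
      then show ?thesis using 2 by blast
    qed simp
  qed
  moreover have "continuous_map (subtopology (Euclidean_space m) U') (subtopology (D_topology X') (topspace (D_topology X) \<union> \<Phi> ` (I \<times> T))) f"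
    using continuous_map_from_subtopology_mono[OF f U'U] fT oU' by (auto simp: continuous_map_in_subtopology)
  ultimately have "continuous_map (subtopology (Euclidean_space m) U') (D_topology X) (push_out 1 \<circ> f)"
    using continuous_map_compose by blast
  then have fX: "continuous_map (subtopology (Euclidean_space m) U') (D_topology X) f'"
    by (rule continuous_map_eq) (use oU' N(3) in \<open>auto simp: f'_def U'_def\<close>)
  have in_X: "f' u \<in> points X" if "u \<in> U'" for u
    using fX that oU' by (auto simp: continuous_map_def Pi_iff)
  have "plot X' m V f'"
  proof (rule plot_locally[OF X'_diffeological])
    fix u assume "u \<in> V"
    with fV show "\<exists>W. openin (Euclidean_space m) W \<and> u \<in> W \<and> W \<subseteq> V \<and> plot X' m W f'"
    proof (cases rule: plot_local)
      case (base W)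
      have "plot X' m W f'"
        by (rule plot_cong[OF X'_diffeological plot_inclusion[OF base(4)]])
           (use funcset_mem[OF plot_funcset[OF X base(4)]] in \<open>simp add: f'_def push_out_base\<close>)
      then show ?thesis using base by blast
    next
      case (cell W \<alpha> y)
      have WE: "W \<subseteq> ?E" using cell(1) openin_subset by blast
      have y: "y w \<in> \<D>" if "w \<in> W" for w using cell(5) that by (auto simp: plot_subset_diffeology)
      have "collar_push ?d (\<eta> w) (y w) \<in> \<D>" if "w \<in> W" for w
        using \<eta>(2)[of w] y[OF that] by (intro collar_push_in_disk) auto
      moreover have "smooth_fun m W (\<lambda>w. collar_push ?d (\<eta> w) (y w) i)" if "i < ?d" for i
        using cell(5) that by (intro smooth_fun_collar_push cell(1) smooth_fun_mono[OF \<eta>(1) WE])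
          (auto simp: plot_subset_diffeology)
      ultimately have "plot (smooth_disk ?d) m W (\<lambda>w. collar_push ?d (\<eta> w) (y w))"
        using cell(1) by (auto simp: plot_subset_diffeology)
      from plot_cell[OF cell(4) this] have "plot X' m W f'"
        by (rule plot_cong[OF X'_diffeological]) (use cell(4,6) y in \<open>simp add: f'_def push_out_cell\<close>)
      then show ?thesis using cell by blast
    qed
  qed
  moreover have "u \<in> U'" if "u \<in> K" "level (f u) \<ge> 1/2" for u
    using that N(2) by (auto simp: U'_def)
  ultimately show ?thesis
    using that[OF L(1,2) _ hom oU' U'U fX in_X] by blast
qed

text \<open>After approximation and push, the points of \<open>K\<close> outside the plot domain
  \<open>V1\<close> lie in the open set \<open>U'\<close>, where the map takes values in
  \<open>X\<close>. The induction hypothesis smooths it there and preserves what is already smooth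
  on \<open>V1\<close>. Since its homotopy is supported in a compact \<open>L3\<close> inside
  \<open>U'\<close>, the result extends by the old map.\<close>

lemma smoothable_attach:
  assumes IH: "smoothable X"
  shows "smoothable X'"
  unfolding smoothable_def
proof (intro allI impI; elim conjE)
  fix m U V K f
  assume U: "openin (Euclidean_space m) U" and V: "V \<subseteq> U" and fV: "plot X' m V f"
    and K: "compactin (Euclidean_space m) K" "K \<subseteq> U"
    and f: "continuous_map (subtopology (Euclidean_space m) U) (D_topology X') f"
  note [simp del] = sum.lessThan_Suc topspace_subtopology and [simp] = topspace_subtopology_open
  let ?U = "subtopology (Euclidean_space m) U" and ?E = "topspace (Euclidean_space m)"
  let ?st = "\<lambda>f L g. \<forall>u\<in>U - L. g u = f u"
  have UE: "U \<subseteq> ?E" using U openin_subset by blast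
  obtain f1 L1 V1 where L1: "compactin (Euclidean_space m) L1" "L1 \<subseteq> U"
    and V1: "V \<subseteq> V1" "V1 \<subseteq> U" "plot X' m V1 f1"
    and hom1: "homotopic_with (?st f L1) ?U (D_topology X') f f1"
    and K1: "\<And>u. u \<in> K \<Longrightarrow> u \<in> V1 \<or> level (f1 u) \<ge> 1/2"
    by (rule approximate_in_cells[OF U V fV K f]) (rule that)
  have f1: "continuous_map ?U (D_topology X') f1"
    using homotopic_with_imp_continuous_maps[OF hom1] by blast
  obtain f2 L2 U' where L2: "compactin (Euclidean_space m) L2" "L2 \<subseteq> U" and f2: "plot X' m V1 f2"
    and hom2: "homotopic_with (?st f1 L2) ?U (D_topology X') f1 f2"
    and U': "openin (Euclidean_space m) U'" "U' \<subseteq> U"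
    and f2X: "continuous_map (subtopology (Euclidean_space m) U') (D_topology X) f2"
      "\<And>u. u \<in> U' \<Longrightarrow> f2 u \<in> points X"
    and K2: "\<And>u. u \<in> K \<Longrightarrow> level (f1 u) \<ge> 1/2 \<Longrightarrow> u \<in> U'"
    by (rule push_to_skeleton[OF U V1(3) K f1]) (rule that)
  have f2c: "continuous_map ?U (D_topology X') f2"
    using homotopic_with_imp_continuous_maps[OF hom2] by blast
  define K' where "K' = {u \<in> K. level (f1 u) \<ge> 1/2}"
  have "K' = (?E - {u \<in> U. level (f1 u) \<in> {..<1/2}}) \<inter> K"
    using K UE by (auto simp: K'_def)
  moreover have "openin (Euclidean_space m) {u \<in> U. level (f1 u) \<in> {..<1/2}}"
    using continuous_map_compose[OF f1 continuous_level]
    by (intro openin_preimage[OF U]) (auto simp: o_def)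
  ultimately have K': "compactin (Euclidean_space m) K'"
    using closed_Int_compactin[OF _ K(1)] by blast
  have "K' \<subseteq> U'" using K2 by (auto simp: K'_def)
  have oV1: "openin (Euclidean_space m) V1" using plot_openin[OF X'_diffeological V1(3)] .
  have "openin (Euclidean_space m) (V1 \<inter> U')" using oV1 U'(1) by blast
  \<comment> \<open>As a plot of \<open>X\<close>, the restriction to the overlap can play the part
    of \<open>V\<close> in the induction hypothesis.\<close>
  from plot_mono[OF X'_diffeological f2 this] have "plot X m (V1 \<inter> U') f2"
    by (intro plot_corestrict) (use f2X(2) in auto)
  then obtain f3 L3 V3 where L3: "compactin (Euclidean_space m) L3" "L3 \<subseteq> U'"
    and V3: "(V1 \<inter> U') \<union> K' \<subseteq> V3" "V3 \<subseteq> U'" "plot X m V3 f3"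
    and hom3: "homotopic_with (\<lambda>g. \<forall>u\<in>U' - L3. g u = f2 u) (subtopology (Euclidean_space m) U') (D_topology X) f2 f3"
    using IH[unfolded smoothable_def, rule_format, of m U' "V1 \<inter> U'" f2 K'] U'(1) K' \<open>K' \<subseteq> U'\<close> f2X(1) by blast
  from hom3[unfolded homotopic_with_def] obtain h where
    hc: "continuous_map (prod_topology (top_of_set {0..1::real}) (subtopology (Euclidean_space m) U')) (D_topology X) h"
    and h0: "\<forall>u. h (0, u) = f2 u" and h1: "\<forall>u. h (1, u) = f3 u"
    and hL: "\<forall>t\<in>{0..1}. \<forall>u\<in>U' - L3. h (t, u) = f2 u"
    by blast
  have h: "h (0, u) = f2 u" "h (1, u) = f3 u" "t \<in> {0..1} \<Longrightarrow> u \<in> U' - L3 \<Longrightarrow> h (t, u) = f2 u" for t u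
    using h0 h1 hL by blast+
  define f4 where "f4 u = (if u \<in> U' then f3 u else f2 u)" for u
  define H where "H z = (if snd z \<in> U' then h z else f2 (snd z))" for z :: "real \<times> (nat \<Rightarrow> real)"
  let ?T = "prod_topology (top_of_set {0..1::real}) ?U"
  have oT: "openin ?T ({0..1} \<times> O')" if "openin (Euclidean_space m) O'" "O' \<subseteq> U" for O'
    using that U by (simp add: openin_prod_Times_iff openin_open_subtopology openin_subtopology_self)
  have sub: "subtopology ?T ({0..1} \<times> O') = prod_topology (top_of_set {0..1}) (subtopology (Euclidean_space m) O')"
    if "O' \<subseteq> U" for O'
    using that by (simp add: subtopology_Times subtopology_subtopology Int_absorb1)
  have "continuous_map ?T (D_topology X') H"
  proof (rule continuous_map_open_cover)
    \<comment> \<open>The homotopy \<open>h\<close> is constant outside \<open>L3\<close>, so the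
      two clauses of \<open>H\<close> agree where these open sets overlap.\<close>
    let ?\<U> = "{{0..1::real} \<times> U', {0..1} \<times> (U - L3)}"
    show "topspace ?T \<subseteq> \<Union>?\<U>" using L3(2) by (auto simp: topspace_subtopology)
    fix O' :: "(real \<times> (nat \<Rightarrow> real)) set" assume "O' \<in> ?\<U>"
    then consider "O' = {0..1} \<times> U'" | "O' = {0..1} \<times> (U - L3)" by blast
    then show "openin ?T O' \<and> continuous_map (subtopology ?T O') (D_topology X') H"
    proof cases
      case 1
      have "continuous_map (subtopology ?T O') (D_topology X') h"
        using continuous_map_compose[OF hc continuous_inclusion] 1 sub[OF U'(2)] by (simp add: o_def)
      then have "continuous_map (subtopology ?T O') (D_topology X') H"
        by (rule continuous_map_eq) (auto simp: 1 H_def topspace_subtopology)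
      then show ?thesis using oT U' 1 by simp
    next
      case 2
      have "openin (Euclidean_space m) (U - L3)"
        using U closedin_Euclidean_compactin[OF L3(1)] by (rule openin_diff)
      moreover have "continuous_map (subtopology ?T O') ?U snd"
        unfolding 2 by (rule continuous_map_from_subtopology) (rule continuous_map_snd)
      from continuous_map_compose[OF this f2c]
      have "continuous_map (subtopology ?T O') (D_topology X') H"
        by (rule continuous_map_eq) (auto simp: 2 H_def h(3) topspace_subtopology)
      ultimately show ?thesis using oT 2 by simp
    qed
  qed
  then have hom4: "homotopic_with (?st f2 L3) ?U (D_topology X') f2 f4"
    unfolding homotopic_with_def using h by (intro exI[of _ H]) (auto simp: H_def f4_def)
  let ?L = "L1 \<union> L2 \<union> L3"
  have e1: "\<forall>u\<in>U - ?L. f1 u = f u" and e2: "\<forall>u\<in>U - ?L. f2 u = f1 u"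
    using homotopic_with_imp_property[OF hom1] homotopic_with_imp_property[OF hom2] by auto
  have "homotopic_with (?st f ?L) ?U (D_topology X') f f1"
    by (rule homotopic_with_mono[OF hom1]) auto
  moreover have "homotopic_with (?st f ?L) ?U (D_topology X') f1 f2"
    by (rule homotopic_with_mono[OF hom2]) (use e1 in auto)
  moreover have "homotopic_with (?st f ?L) ?U (D_topology X') f2 f4"
    by (rule homotopic_with_mono[OF hom4]) (use e1 e2 in auto)
  ultimately have hom: "homotopic_with (?st f ?L) ?U (D_topology X') f f4"
    using homotopic_with_trans by blast
  have L: "compactin (Euclidean_space m) ?L" "?L \<subseteq> U"
    using L1 L2 L3 U'(2) by (auto intro: compactin_Un)
  have oV1L: "openin (Euclidean_space m) (V1 - L3)"
    using oV1 closedin_Euclidean_compactin[OF L3(1)] by (rule openin_diff)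
  have "f4 u = f2 u" if "u \<in> V1 - L3" for u
    using that h(2)[of u] h(3)[of 1 u] by (auto simp: f4_def)
  then have "plot X' m (V1 - L3) f4"
    using plot_cong[OF X'_diffeological plot_mono[OF X'_diffeological f2 oV1L]] by auto
  moreover have "plot X' m V3 f4"
    by (rule plot_cong[OF X'_diffeological plot_inclusion[OF V3(3)]]) (use V3(2) in \<open>auto simp: f4_def\<close>)
  ultimately have "plot X' m (\<Union>{V1 - L3, V3}) f4"
    using oV1L plot_openin[OF X V3(3)] by (intro plot_cover[OF X'_diffeological]) auto
  \<comment> \<open>A point of \<open>V1\<close> that is removed with \<open>L3\<close> lies in
    \<open>V1 \<inter> U'\<close>, and so in \<open>V3\<close>.\<close>
  moreover have "V \<union> K \<subseteq> \<Union>{V1 - L3, V3}"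
  proof
    fix u assume u: "u \<in> V \<union> K"
    show "u \<in> \<Union>{V1 - L3, V3}"
    proof (cases "u \<in> V1")
      case True
      then show ?thesis using V3(1) L3(2) by auto
    next
      case False
      then have "u \<in> K'" using u V1(1) K1[of u] unfolding K'_def by blast
      then show ?thesis using V3(1) by auto
    qed
  qed
  moreover have "\<Union>{V1 - L3, V3} \<subseteq> U" using V1(2) V3(2) U'(2) by auto
  ultimately show "\<exists>f' L V'. compactin (Euclidean_space m) L \<and> L \<subseteq> U \<and> V \<union> K \<subseteq> V' \<and> V' \<subseteq> U \<and> plot X' m V' f' \<and>
      homotopic_with (?st f L) ?U (D_topology X') f f'"
    using hom L by blast
qed

end

section \<open>Deforming a cylinder onto an end\<close>

abbreviation unit_interval :: "real topology" where
  "unit_interval \<equiv> top_of_set {0..1}"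

lemma continuous_map_closed_cover:
  assumes "finite \<C>" "\<And>C. C \<in> \<C> \<Longrightarrow> closedin X C \<and> continuous_map (subtopology X C) Y f" "topspace X \<subseteq> \<Union>\<C>"
  shows "continuous_map X Y f"
  using assms by (intro pasting_lemma_closed[of \<C> X "\<lambda>C. C" Y "\<lambda>_. f" f]) auto

lemma continuous_map_real_of_interval:
  "continuous_map X unit_interval f \<longleftrightarrow> continuous_map X euclideanreal f \<and> f \<in> topspace X \<rightarrow> {0..1}"
  by (simp add: continuous_map_in_subtopology)

text \<open>The formula projects the cylinder radially from the point at height \<open>2\<close> on its axis.\<close>

lemma cylinder_retract_bottom:
  fixes n :: nat
  defines "J \<equiv> prod_topology unit_interval (disk_topology (Suc n))"
  obtains \<rho> :: "real \<times> real \<times> (nat \<Rightarrow> real) \<Rightarrow> real \<times> (nat \<Rightarrow> real)"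
  where "continuous_map (prod_topology unit_interval J) J \<rho>"
    "\<And>c. c \<in> topspace J \<Longrightarrow> \<rho> (0, c) = c"
    "\<And>t c. t \<in> {0..1} \<Longrightarrow> c \<in> topspace J \<Longrightarrow> fst c = 0 \<or> snd c \<in> topspace (nsphere n) \<Longrightarrow> \<rho> (t, c) = c"
    "\<And>c. c \<in> topspace J \<Longrightarrow> fst (\<rho> (1, c)) = 0 \<or> snd (\<rho> (1, c)) \<in> topspace (nsphere n)"
proof -
  note [simp del] = sum.lessThan_Suc topspace_subtopology
  let ?d = "Suc n"
  \<comment> \<open>The ray from \<open>(2, 0)\<close> through \<open>(s, x)\<close> is followed to
    \<open>(2 - (2 - s) / m, x / m)\<close>. It meets the wall when \<open>m\<close> is the radius
    of \<open>x\<close> and the bottom when \<open>m = 1 - s / 2\<close>; the larger value belongs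
    to the first hit.\<close>
  define m where "m c = max (sqrt (sqn ?d (snd c))) (1 - fst c / 2)" for c :: "real \<times> (nat \<Rightarrow> real)"
  define \<rho> where "\<rho> p = ((1 - fst p) * fst (snd p) + fst p * (2 - (2 - fst (snd p)) / m (snd p)),
      \<lambda>i. (1 - fst p + fst p / m (snd p)) * snd (snd p) i)" for p :: "real \<times> real \<times> (nat \<Rightarrow> real)"
  have tJ: "topspace J = {0..1} \<times> unit_disk ?d" by (simp add: J_def)
  have norm_le: "sqrt (sqn ?d x) \<le> 1" if "x \<in> unit_disk ?d" for x
    using that by (simp add: unit_disk_def)
  have m: "m c > 0" "m c \<le> 1" "sqrt (sqn ?d (snd c)) \<le> m c" "1 - fst c / 2 \<le> m c" if "c \<in> topspace J" for c
    using that norm_le[of "snd c"] by (auto simp: m_def tJ less_max_iff_disj)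
  have \<rho>_in: "\<rho> (t, s, x) \<in> topspace J" if t: "t \<in> {0..1}" and c: "(s, x) \<in> topspace J" for t s x
  proof -
    note m' = m[OF c]
    have s: "0 \<le> s" "s \<le> 1" and x: "x \<in> unit_disk ?d" using c by (auto simp: tJ)
    have a: "2 - (2 - s) / m (s, x) \<ge> 0" using m' by (simp add: field_simps)
    have "(2 - s) / m (s, x) \<ge> 2 - s"
      using m' s mult_left_mono[of "m (s, x)" 1 "2 - s"] by (simp add: field_simps)
    then have b: "2 - (2 - s) / m (s, x) \<le> 1" using s by linarith
    have 1: "(1 - t) * s + t * (2 - (2 - s) / m (s, x)) \<ge> 0"
      using t s a by (intro add_nonneg_nonneg mult_nonneg_nonneg) auto
    have 2: "(1 - t) * s + t * (2 - (2 - s) / m (s, x)) \<le> 1"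
      using t s b by (intro convex_bound_le) auto
    define q where "q = sqrt (sqn ?d x)"
    have q: "q \<le> 1" "0 \<le> q" "q \<le> m (s, x)" using norm_le[OF x] m'(3) sqn_nonneg by (auto simp: q_def)
    have "(1 - t) * q + t * (q / m (s, x)) \<le> 1"
      using t q m' by (intro convex_bound_le) auto
    moreover have "(1 - t + t / m (s, x)) * q = (1 - t) * q + t * (q / m (s, x))"
      by (simp add: algebra_simps)
    moreover have "0 \<le> (1 - t + t / m (s, x)) * q"
      using t q m' by (intro mult_nonneg_nonneg add_nonneg_nonneg) auto
    ultimately have "((1 - t + t / m (s, x)) * q)\<^sup>2 \<le> 1" by (simp add: power_le_one)
    then have "sqn ?d (\<lambda>i. (1 - t + t / m (s, x)) * x i) \<le> 1"
      unfolding sqn_scale by (simp add: power_mult_distrib q_def sqn_nonneg)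
    then have "(\<lambda>i. (1 - t + t / m (s, x)) * x i) \<in> unit_disk ?d"
      using x by (simp add: unit_disk_def topspace_Euclidean_space)
    then show ?thesis using 1 2 by (simp add: \<rho>_def tJ)
  qed
  have stay: "\<rho> (t, c) = c" if "c \<in> topspace J" "fst c = 0 \<or> snd c \<in> topspace (nsphere n)" for t c
  proof -
    have "m c = 1"
      using that norm_le[of "snd c"] by (auto simp: m_def tJ topspace_nsphere)
    then show ?thesis by (simp add: \<rho>_def algebra_simps prod_eq_iff)
  qed
  have final: "fst (\<rho> (1, c)) = 0 \<or> snd (\<rho> (1, c)) \<in> topspace (nsphere n)" if c: "c \<in> topspace J" for c
  proof (cases "sqrt (sqn ?d (snd c)) \<le> 1 - fst c / 2")
    case True
    then have "m c = 1 - fst c / 2" by (simp add: m_def)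
    moreover have "1 - fst c / 2 \<noteq> 0" using c by (auto simp: tJ)
    ultimately show ?thesis by (simp add: \<rho>_def field_simps)
  next
    case False
    then have "m c = sqrt (sqn ?d (snd c))" by (simp add: m_def)
    then have "(1 / m c)\<^sup>2 * sqn ?d (snd c) = 1"
      using m(1)[OF c] by (simp add: power_divide sqn_nonneg)
    then have "sqn ?d (\<lambda>i. (1 / m c) * snd c i) = 1"
      unfolding sqn_scale .
    moreover have "(\<lambda>i. (1 / m c) * snd c i) \<in> topspace (Euclidean_space ?d)"
      using c by (auto simp: tJ unit_disk_def topspace_Euclidean_space)
    ultimately show ?thesis by (simp add: \<rho>_def topspace_nsphere)
  qed
  let ?P = "prod_topology unit_interval J"
  have f1: "continuous_map ?P euclideanreal fst"
    by (meson continuous_map_fst continuous_map_in_subtopology)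
  have f2: "continuous_map ?P J snd" by (rule continuous_map_snd)
  have f3: "continuous_map J euclideanreal fst"
    unfolding J_def by (meson continuous_map_fst continuous_map_in_subtopology)
  have f4: "continuous_map J (Euclidean_space ?d) snd"
    unfolding J_def by (meson continuous_map_snd continuous_map_in_subtopology)
  have f23: "continuous_map ?P euclideanreal (\<lambda>p. fst (snd p))"
    using continuous_map_compose[OF f2 f3] by (simp add: o_def)
  have f24: "continuous_map ?P euclideanreal (\<lambda>p. snd (snd p) i)" if "i < ?d" for i
    using continuous_map_compose[OF f2 f4] that by (simp add: o_def continuous_map_into_Euclidean)
  have "continuous_map J euclideanreal m"
    unfolding m_def
    by (intro continuous_map_real_max continuous_map_sqrt continuous_map_diff continuous_map_real_divide
        continuous_map_sqn f3 f4) auto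
  then have fm: "continuous_map ?P euclideanreal (\<lambda>p. m (snd p))"
    using continuous_map_compose[OF f2] by (fastforce simp: o_def)
  have m0: "m (snd p) \<noteq> 0" if "p \<in> topspace ?P" for p
    using m(1)[of "snd p"] that by auto
  have "continuous_map ?P euclideanreal (\<lambda>p. fst (\<rho> p))"
    unfolding \<rho>_def fst_conv
    by (intro continuous_map_add continuous_map_real_mult continuous_map_diff continuous_map_real_divide f1 f23 fm m0) auto
  moreover have "continuous_map ?P euclideanreal (\<lambda>p. snd (\<rho> p) i)" if "i < ?d" for i
    unfolding \<rho>_def snd_conv
    by (intro continuous_map_add continuous_map_real_mult continuous_map_diff continuous_map_real_divide f1 f24 fm m0 that) auto
  moreover have "fst (\<rho> p) \<in> {0..1} \<and> snd (\<rho> p) \<in> unit_disk ?d" if "p \<in> topspace ?P" for p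
    using \<rho>_in[of "fst p" "fst (snd p)" "snd (snd p)"] that by (auto simp: tJ mem_Times_iff)
  ultimately have "continuous_map ?P J (\<lambda>p. (fst (\<rho> p), snd (\<rho> p)))"
    unfolding J_def using unit_disk_subset
    by (intro continuous_map_pairedI)
       (auto simp: continuous_map_in_subtopology continuous_map_into_Euclidean J_def[symmetric] subset_iff)
  then have "continuous_map ?P J \<rho>" by simp
  moreover have "\<rho> (0, c) = c" for c by (simp add: \<rho>_def)
  ultimately show ?thesis using that[of \<rho>] stay final by blast
qed

text \<open>Reflecting the heights exchanges the two ends, which reduces \<open>e = 1\<close> to the
  retraction onto bottom and wall.\<close>

lemma cylinder_retract:
  fixes n :: nat
  defines "J \<equiv> prod_topology unit_interval (disk_topology (Suc n))"
  assumes e: "e \<in> {0, 1}"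
  obtains \<rho> :: "real \<times> real \<times> (nat \<Rightarrow> real) \<Rightarrow> real \<times> (nat \<Rightarrow> real)"
  where "continuous_map (prod_topology unit_interval J) J \<rho>"
    "\<And>c. c \<in> topspace J \<Longrightarrow> \<rho> (0, c) = c"
    "\<And>t c. t \<in> {0..1} \<Longrightarrow> c \<in> topspace J \<Longrightarrow> fst c = e \<or> snd c \<in> topspace (nsphere n) \<Longrightarrow> \<rho> (t, c) = c"
    "\<And>c. c \<in> topspace J \<Longrightarrow> fst (\<rho> (1, c)) = e \<or> snd (\<rho> (1, c)) \<in> topspace (nsphere n)"
proof -
  note [simp del] = topspace_subtopology
  obtain \<rho> where \<rho>: "continuous_map (prod_topology unit_interval J) J \<rho>"
    "\<And>c. c \<in> topspace J \<Longrightarrow> \<rho> (0, c) = c"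
    "\<And>t c. t \<in> {0..1} \<Longrightarrow> c \<in> topspace J \<Longrightarrow> fst c = 0 \<or> snd c \<in> topspace (nsphere n) \<Longrightarrow> \<rho> (t, c) = c"
    "\<And>c. c \<in> topspace J \<Longrightarrow> fst (\<rho> (1, c)) = 0 \<or> snd (\<rho> (1, c)) \<in> topspace (nsphere n)"
    using cylinder_retract_bottom[of n] unfolding J_def by blast
  show ?thesis
  proof (cases "e = 0")
    case True
    then show ?thesis using that \<rho> by blast
  next
    case False
    then have e1: "e = 1" using e by simp
    define fl where "fl c = (1 - fst c, snd c)" for c :: "real \<times> (nat \<Rightarrow> real)"
    have flJ: "fl c \<in> topspace J" if "c \<in> topspace J" for c
      using that by (auto simp: J_def fl_def)
    have flfl: "fl (fl c) = c" for c by (simp add: fl_def)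
    have fl: "continuous_map J J fl"
    proof -
      have "continuous_map J unit_interval (\<lambda>c. 1 - fst c)"
        unfolding continuous_map_real_of_interval
        by (auto simp: J_def intro!: continuous_map_diff) (meson continuous_map_fst continuous_map_in_subtopology)
      then show ?thesis
        unfolding fl_def[abs_def] J_def by (intro continuous_map_pairedI continuous_map_snd)
    qed
    define \<sigma> where "\<sigma> p = fl (\<rho> (fst p, fl (snd p)))" for p
    have "continuous_map (prod_topology unit_interval J) (prod_topology unit_interval J) (\<lambda>p. (fst p, fl (snd p)))"
      using continuous_map_compose[OF continuous_map_snd fl]
      by (intro continuous_map_pairedI continuous_map_fst) (simp add: o_def)
    from continuous_map_compose[OF continuous_map_compose[OF this \<rho>(1)] fl]
    have "continuous_map (prod_topology unit_interval J) J \<sigma>"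
      by (simp add: o_def \<sigma>_def[abs_def])
    then show ?thesis
    proof (rule that)
      show "\<sigma> (0, c) = c" if "c \<in> topspace J" for c
        using \<rho>(2)[OF flJ[OF that]] flfl by (simp add: \<sigma>_def)
      show "\<sigma> (t, c) = c" if "t \<in> {0..1}" "c \<in> topspace J" "fst c = e \<or> snd c \<in> topspace (nsphere n)" for t c
        using \<rho>(3)[OF that(1) flJ[OF that(2)]] that(3) flfl by (auto simp: \<sigma>_def fl_def e1)
      show "fst (\<sigma> (1, c)) = e \<or> snd (\<sigma> (1, c)) \<in> topspace (nsphere n)" if "c \<in> topspace J" for c
        using \<rho>(4)[OF flJ[OF that]] by (auto simp: \<sigma>_def fl_def e1)
    qed
  qed
qed

text \<open>The initial period in which \<open>R\<close> stands still leaves time to retract new cells first, so that a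
  deformation can be extended strictly when cells are attached.\<close>

definition deforms_onto_end :: "'a topology \<Rightarrow> ('a \<times> real) topology \<Rightarrow> real \<Rightarrow> (real \<times> 'a \<times> real \<Rightarrow> 'a \<times> real) \<Rightarrow> bool" where
  "deforms_onto_end A Z e R \<longleftrightarrow>
     continuous_map (prod_topology unit_interval Z) Z R \<and>
     (\<exists>c>0. c \<le> 1 \<and> (\<forall>t\<in>{0..c}. \<forall>z\<in>topspace Z. R (t, z) = z)) \<and>
     (\<forall>t\<in>{0..1}. \<forall>a\<in>topspace A. R (t, (a, e)) = (a, e)) \<and>
     (\<forall>z\<in>topspace Z. snd (R (1, z)) = e) \<and>
     continuous_map Z A (\<lambda>z. fst (R (1, z))) \<and>
     continuous_map A Z (\<lambda>a. (a, e))"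

text \<open>While \<open>R\<close> rests, the new cylinder is retracted by \<open>\<rho>\<close>
  onto its side wall and its end at height \<open>e\<close>. Afterwards the wall, whose image lies
  in \<open>Z\<close>, moves with \<open>R\<close>, and the end stays fixed; the two agree where
  they meet because \<open>R\<close> fixes the points \<open>(a, e)\<close>.\<close>

lemma deforms_onto_end_attach:
  fixes A A' :: "'a topology" and Z Z' :: "('a \<times> real) topology"
  assumes A: "cell_attachment A A' (disk_topology (Suc n)) (topspace (nsphere n)) I \<phi>"
    and Z: "cell_attachment Z Z' (prod_topology unit_interval (disk_topology (Suc n)))
      ({0..1} \<times> topspace (nsphere n)) I \<Psi>"
    and interior: "\<And>\<alpha> s x. \<alpha> \<in> I \<Longrightarrow> s \<in> {0..1} \<Longrightarrow> x \<in> unit_disk (Suc n) \<Longrightarrow> x \<notin> topspace (nsphere n) \<Longrightarrow> \<Psi> (\<alpha>, s, x) = (\<phi> (\<alpha>, x), s)"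
    and boundary: "\<And>\<alpha> x. \<alpha> \<in> I \<Longrightarrow> x \<in> topspace (nsphere n) \<Longrightarrow> \<Psi> (\<alpha>, e, x) = (\<phi> (\<alpha>, x), e)"
    and e: "e \<in> {0, 1}" and R: "deforms_onto_end A Z e R"
  obtains R' where "deforms_onto_end A' Z' e R'" "\<And>t z. z \<in> topspace Z \<Longrightarrow> R' (t, z) = R (t, z)"
proof -
  note [simp del] = sum.lessThan_Suc topspace_subtopology
  let ?S = "topspace (nsphere n)" and ?D = "unit_disk (Suc n)"
  define J where "J = prod_topology unit_interval (disk_topology (Suc n))"
  interpret A: cell_attachment A A' "disk_topology (Suc n)" ?S I \<phi> by (rule A)
  interpret Z: cell_attachment Z Z' J "{0..1} \<times> ?S" I \<Psi> unfolding J_def by (rule Z)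
  have tJ: "topspace J = {0..1} \<times> ?D" by (simp add: J_def)
  have SD: "?S \<subseteq> ?D" by (rule nsphere_subset_unit_disk)
  obtain \<rho> where \<rho>: "continuous_map (prod_topology unit_interval J) J \<rho>"
    "\<And>c. c \<in> topspace J \<Longrightarrow> \<rho> (0, c) = c"
    "\<And>t c. t \<in> {0..1} \<Longrightarrow> c \<in> topspace J \<Longrightarrow> fst c = e \<or> snd c \<in> ?S \<Longrightarrow> \<rho> (t, c) = c"
    "\<And>c. c \<in> topspace J \<Longrightarrow> fst (\<rho> (1, c)) = e \<or> snd (\<rho> (1, c)) \<in> ?S"
    using cylinder_retract[OF e, of n] unfolding J_def by blast
  have R1: "continuous_map (prod_topology unit_interval Z) Z R"
    and R3: "\<And>t a. t \<in> {0..1} \<Longrightarrow> a \<in> topspace A \<Longrightarrow> R (t, (a, e)) = (a, e)"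
    and R4: "\<And>z. z \<in> topspace Z \<Longrightarrow> snd (R (1, z)) = e"
    and R5: "continuous_map Z A (\<lambda>z. fst (R (1, z)))"
    and R6: "continuous_map A Z (\<lambda>a. (a, e))"
    using R unfolding deforms_onto_end_def by blast+
  obtain c0 where c0: "0 < c0" "c0 \<le> 1" "\<And>t z. t \<in> {0..c0} \<Longrightarrow> z \<in> topspace Z \<Longrightarrow> R (t, z) = z"
    using R unfolding deforms_onto_end_def by blast
  have \<Psi>e: "\<Psi> (\<alpha>, e, x) = (\<phi> (\<alpha>, x), e)" if "\<alpha> \<in> I" "x \<in> ?D" for \<alpha> x
    using interior[of \<alpha> e x] boundary[of \<alpha> x] that e by fastforce
  \<comment> \<open>Runs from 0 to 1 while \<open>t\<close> goes from \<open>c0 / 2\<close> to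
    \<open>c0\<close>. Until \<open>c0 / 2\<close> the extended deformation rests too, as the next
    attachment requires.\<close>
  define \<tau> where "\<tau> t = max 0 (min 1 (2 * t / c0 - 1))" for t
  have \<tau>: "\<tau> t \<in> {0..1}" for t by (auto simp: \<tau>_def)
  have \<tau>0: "\<tau> t = 0" if "t \<le> c0 / 2" for t using that c0(1) by (auto simp: \<tau>_def field_simps)
  have \<tau>1: "\<tau> t = 1" if "t \<ge> c0" for t using that c0(1) by (auto simp: \<tau>_def field_simps)
  \<comment> \<open>On the wall both clauses give the same value while \<open>R\<close> rests, and
    at all times at height \<open>e\<close>. This makes the closed pieces below compatible.\<close>
  define G where "G t \<alpha> c = (if snd c \<in> ?S then R (t, \<Psi> (\<alpha>, c)) else \<Psi> (\<alpha>, c))" for t \<alpha> and c :: "real \<times> (nat \<Rightarrow> real)"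
  have bdZ: "\<Psi> (\<alpha>, c) \<in> topspace Z" if "\<alpha> \<in> I" "c \<in> topspace J" "snd c \<in> ?S" for \<alpha> c
    using Z.attach_in[of \<alpha> c] that by (auto simp: tJ)
  have G_early: "G t \<alpha> c = \<Psi> (\<alpha>, c)" if "t \<in> {0..c0}" "\<alpha> \<in> I" "c \<in> topspace J" for t \<alpha> c
    using that c0(3) bdZ by (simp add: G_def)
  have G_end: "G t \<alpha> c = \<Psi> (\<alpha>, c)" if "t \<in> {0..1}" "\<alpha> \<in> I" "c \<in> topspace J" "fst c = e" for t \<alpha> c
  proof (cases "snd c \<in> ?S")
    case True
    have c: "c = (e, snd c)" using that(4) by (metis prod.collapse)
    have "\<Psi> (\<alpha>, c) = (\<phi> (\<alpha>, snd c), e)" using boundary[OF that(2) True] c by simp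
    then show ?thesis using True R3[OF that(1) A.attach_in[OF that(2) True]] by (simp add: G_def)
  qed (simp add: G_def)
  \<comment> \<open>On the boundary of the cylinder \<open>\<rho>\<close> is the identity and
    \<open>G\<close> is \<open>R\<close>, so the two clauses of \<open>cell_ext\<close> fit
    together.\<close>
  define R' where "R' p = Z.cell_ext (\<lambda>z. R (fst p, z)) (\<lambda>q. G (fst p) (fst q) (\<rho> (\<tau> (fst p), snd q))) (snd p)" for p
  have R'Z: "R' (t, z) = R (t, z)" if "z \<in> topspace Z" for t z
    using that by (simp add: R'_def Z.cell_ext_A)
  have R'cell: "R' (t, \<Psi> (\<alpha>, c)) = G t \<alpha> (\<rho> (\<tau> t, c))" if "\<alpha> \<in> I" "c \<in> topspace J" for t \<alpha> c
    unfolding R'_def fst_conv snd_conv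
    by (subst Z.cell_ext_cell[OF that]) (use \<rho>(3)[OF \<tau> that(2)] in \<open>auto simp: G_def\<close>)
  let ?P = "prod_topology unit_interval J"
  have fst_cont: "continuous_map ?P euclideanreal fst"
    by (meson continuous_map_fst continuous_map_in_subtopology)
  have "continuous_map ?P euclideanreal (\<lambda>p. \<tau> (fst p))"
    unfolding \<tau>_def using c0(1)
    by (intro continuous_map_real_max continuous_map_real_min continuous_map_diff continuous_map_real_divide
        continuous_map_real_mult fst_cont) auto
  then have "continuous_map ?P ?P (\<lambda>p. (\<tau> (fst p), snd p))"
    using \<tau> by (intro continuous_map_pairedI continuous_map_snd) (auto simp: continuous_map_real_of_interval)
  from continuous_map_compose[OF this \<rho>(1)]
  have \<rho>\<tau>: "continuous_map ?P J (\<lambda>p. \<rho> (\<tau> (fst p), snd p))" by (simp add: o_def)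
  have \<rho>\<tau>_in: "\<rho> (\<tau> (fst p), snd p) \<in> topspace J" if "p \<in> topspace ?P" for p
    using \<rho>\<tau> that by (auto simp: continuous_map_def Pi_iff)
  have closedS: "closedin (disk_topology (Suc n)) ?S" by (rule A.boundary_closed)
  have J_fst: "continuous_map J euclideanreal fst" and J_snd: "continuous_map J (disk_topology (Suc n)) snd"
    unfolding J_def by (meson continuous_map_fst continuous_map_in_subtopology, rule continuous_map_snd)
  have clS: "closedin J {c \<in> topspace J. snd c \<in> ?S}"
    using closedin_continuous_map_preimage[OF J_snd closedS] .
  have clE: "closedin J {c \<in> topspace J. fst c = e}"
    using closedin_continuous_map_preimage[OF J_fst, of "{e}"] by simp
  have sub\<Psi>: "continuous_map (subtopology J {c \<in> topspace J. snd c \<in> ?S}) Z (\<lambda>c. \<Psi> (\<alpha>, c))" if "\<alpha> \<in> I" for \<alpha>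
  proof -
    have "{c \<in> topspace J. snd c \<in> ?S} = {0..1} \<times> ?S" using SD by (auto simp: tJ)
    then show ?thesis using Z.attach[OF that] by simp
  qed
  have cont_cell: "continuous_map ?P Z' (\<lambda>p. G (fst p) \<alpha> (\<rho> (\<tau> (fst p), snd p)))" if \<alpha>: "\<alpha> \<in> I" for \<alpha>
  proof (rule continuous_map_closed_cover)
    let ?early = "{p \<in> topspace ?P. fst p \<in> {..c0}}"
    let ?side = "{p \<in> topspace ?P. \<rho> (\<tau> (fst p), snd p) \<in> {c \<in> topspace J. snd c \<in> ?S}}"
    let ?end = "{p \<in> topspace ?P. \<rho> (\<tau> (fst p), snd p) \<in> {c \<in> topspace J. fst c = e}}"
    \<comment> \<open>After time \<open>c0\<close> the retraction is complete, so its value lies on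
      the wall or at the end: the three pieces cover.\<close>
    let ?\<C> = "{?early, ?side, ?end}"
    have full: "continuous_map (subtopology ?P T) Z' (\<lambda>p. \<Psi> (\<alpha>, \<rho> (\<tau> (fst p), snd p)))" for T
      using continuous_map_compose[OF \<rho>\<tau> Z.continuous_cell[OF \<alpha>]]
      by (intro continuous_map_from_subtopology) (simp add: o_def)
    show "finite ?\<C>" by simp
    show "topspace ?P \<subseteq> \<Union>?\<C>"
    proof
      fix p assume p: "p \<in> topspace ?P"
      show "p \<in> \<Union>?\<C>"
      proof (cases "fst p \<le> c0")
        case False
        then have "\<tau> (fst p) = 1" using \<tau>1 by simp
        moreover have "snd p \<in> topspace J" using p by auto
        ultimately show ?thesis using \<rho>(4)[of "snd p"] p \<rho>\<tau>_in[OF p] by auto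
      qed (use p in simp)
    qed
    fix C assume "C \<in> ?\<C>"
    then consider "C = ?early" | "C = ?side" | "C = ?end" by blast
    then show "closedin ?P C \<and> continuous_map (subtopology ?P C) Z' (\<lambda>p. G (fst p) \<alpha> (\<rho> (\<tau> (fst p), snd p)))"
    proof cases
      case 1
      have "closedin ?P C"
        unfolding 1 by (rule closedin_continuous_map_preimage[OF fst_cont]) simp
      moreover have "continuous_map (subtopology ?P C) Z' (\<lambda>p. G (fst p) \<alpha> (\<rho> (\<tau> (fst p), snd p)))"
        by (rule continuous_map_eq[OF full]) (use 1 G_early[OF _ \<alpha> \<rho>\<tau>_in] in \<open>auto simp: topspace_subtopology\<close>)
      ultimately show ?thesis by blast
    next
      case 2
      have "closedin ?P C"
        unfolding 2 by (rule closedin_continuous_map_preimage[OF \<rho>\<tau> clS])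
      moreover have "continuous_map (subtopology ?P C) (subtopology J {c \<in> topspace J. snd c \<in> ?S}) (\<lambda>p. \<rho> (\<tau> (fst p), snd p))"
        using continuous_map_from_subtopology[OF \<rho>\<tau>, of C] 2
        by (auto simp: continuous_map_in_subtopology topspace_subtopology)
      from continuous_map_compose[OF this sub\<Psi>[OF \<alpha>]]
      have "continuous_map (subtopology ?P C) Z (\<lambda>p. \<Psi> (\<alpha>, \<rho> (\<tau> (fst p), snd p)))" by (simp add: o_def)
      then have "continuous_map (subtopology ?P C) (prod_topology unit_interval Z) (\<lambda>p. (fst p, \<Psi> (\<alpha>, \<rho> (\<tau> (fst p), snd p))))"
        by (intro continuous_map_pairedI continuous_map_from_subtopology[OF continuous_map_fst])
      from continuous_map_compose[OF continuous_map_compose[OF this R1] Z.continuous_inclusion]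
      have "continuous_map (subtopology ?P C) Z' (\<lambda>p. G (fst p) \<alpha> (\<rho> (\<tau> (fst p), snd p)))"
        by (rule continuous_map_eq) (auto simp: 2 G_def topspace_subtopology)
      ultimately show ?thesis by blast
    next
      case 3
      have "closedin ?P C"
        unfolding 3 by (rule closedin_continuous_map_preimage[OF \<rho>\<tau> clE])
      moreover have "continuous_map (subtopology ?P C) Z' (\<lambda>p. G (fst p) \<alpha> (\<rho> (\<tau> (fst p), snd p)))"
      proof (rule continuous_map_eq[OF full])
        fix p assume "p \<in> topspace (subtopology ?P C)"
        then have "fst p \<in> {0..1}" "\<rho> (\<tau> (fst p), snd p) \<in> topspace J" "fst (\<rho> (\<tau> (fst p), snd p)) = e"
          using 3 by (auto simp: topspace_subtopology)
        from G_end[OF this(1) \<alpha> this(2,3)]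
        show "\<Psi> (\<alpha>, \<rho> (\<tau> (fst p), snd p)) = G (fst p) \<alpha> (\<rho> (\<tau> (fst p), snd p))" by (rule sym)
      qed
      ultimately show ?thesis by blast
    qed
  qed
  have "continuous_map (prod_topology unit_interval Z') Z' R'"
  proof (rule Z.continuous_map_prodI)
    show "continuous_map (prod_topology unit_interval Z) Z' R'"
      using continuous_map_compose[OF R1 Z.continuous_inclusion]
      by (rule continuous_map_eq) (auto simp: R'Z)
    show "continuous_map ?P Z' (\<lambda>p. R' (fst p, \<Psi> (\<alpha>, snd p)))" if "\<alpha> \<in> I" for \<alpha>
      by (rule continuous_map_eq[OF cont_cell[OF that]]) (auto simp: R'cell that)
  qed
  moreover have "\<forall>t\<in>{0..c0/2}. \<forall>z\<in>topspace Z'. R' (t, z) = z"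
  proof (intro ballI)
    fix t z assume t: "t \<in> {0..c0/2}" and z: "z \<in> topspace Z'"
    have t': "t \<in> {0..c0}" using t c0(1) by auto
    from z show "R' (t, z) = z"
    proof (cases rule: Z.cell_cases)
      case 1
      then show ?thesis using R'Z c0(3) t' by simp
    next
      case (2 \<alpha> c)
      then have "R' (t, z) = G t \<alpha> c" using R'cell \<rho>(2) \<tau>0[of t] t by simp
      then show ?thesis using G_early[OF t' 2(1,2)] 2 by simp
    qed
  qed
  moreover have "\<forall>t\<in>{0..1}. \<forall>a\<in>topspace A'. R' (t, (a, e)) = (a, e)"
  proof (intro ballI)
    fix t a assume t: "t \<in> {0..1::real}" and a: "a \<in> topspace A'"
    from a show "R' (t, (a, e)) = (a, e)"
    proof (cases rule: A.cell_cases)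
      case 1
      then have "(a, e) \<in> topspace Z" using R6 by (auto simp: continuous_map_def)
      then show ?thesis using R'Z R3[OF t 1] by simp
    next
      case (2 \<alpha> x)
      then have x: "x \<in> ?D" by simp
      have c: "(e, x) \<in> topspace J" using x e by (auto simp: tJ)
      have "R' (t, \<Psi> (\<alpha>, e, x)) = \<Psi> (\<alpha>, e, x)"
        using R'cell[OF 2(1) c] \<rho>(3)[OF \<tau> c] G_end[OF t 2(1) c] by simp
      then show ?thesis using \<Psi>e[OF 2(1) x] 2(4) by simp
    qed
  qed
  moreover have "\<forall>z\<in>topspace Z'. snd (R' (1, z)) = e"
  proof
    fix z assume "z \<in> topspace Z'"
    then show "snd (R' (1, z)) = e"
    proof (cases rule: Z.cell_cases)
      case 1
      then show ?thesis using R'Z R4 by simp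
    next
      case (2 \<alpha> c)
      let ?c = "\<rho> (1, c)"
      have cJ: "?c \<in> topspace J" using \<rho>\<tau>_in[of "(1, c)"] \<tau>1[of 1] c0(2) 2(2) by simp
      have eq: "R' (1, z) = G 1 \<alpha> ?c" using R'cell[OF 2(1,2), of 1] \<tau>1[of 1] c0(2) 2(4) by simp
      show ?thesis
      proof (cases "snd ?c \<in> ?S")
        case True
        then show ?thesis using eq R4 bdZ[OF 2(1) cJ True] by (simp add: G_def)
      next
        case False
        then have "fst ?c = e" using \<rho>(4)[OF 2(2)] by blast
        then have "?c = (e, snd ?c)" by (metis prod.collapse)
        moreover have "snd ?c \<in> ?D" using cJ by (auto simp: tJ mem_Times_iff)
        ultimately have "\<Psi> (\<alpha>, ?c) = (\<phi> (\<alpha>, snd ?c), e)" using \<Psi>e[OF 2(1)] by metis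
        then show ?thesis using eq False by (simp add: G_def)
      qed
    qed
  qed
  \<comment> \<open>The ends carry topologies of their own, so continuity into \<open>A'\<close> is
    shown separately, on the wall and on the end.\<close>
  moreover have "continuous_map Z' A' (\<lambda>z. fst (R' (1, z)))"
  proof (rule Z.continuous_mapI)
    show "continuous_map Z A' (\<lambda>z. fst (R' (1, z)))"
      using continuous_map_compose[OF R5 A.continuous_inclusion]
      by (rule continuous_map_eq) (auto simp: R'Z)
    fix \<alpha> assume \<alpha>: "\<alpha> \<in> I"
    have \<tau>11: "\<tau> 1 = 1" using \<tau>1 c0(2) by simp
    have "continuous_map J ?P (\<lambda>c. (1, c))"
      by (intro continuous_map_pairedI) auto
    from continuous_map_compose[OF this \<rho>(1)]
    have r: "continuous_map J J (\<lambda>c. \<rho> (1, c))" by (simp add: o_def)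
    have r_in: "\<rho> (1, c) \<in> topspace J" if "c \<in> topspace J" for c
      using r that by (auto simp: continuous_map_def Pi_iff)
    have "continuous_map J A' (\<lambda>c. fst (G 1 \<alpha> (\<rho> (1, c))))"
    proof (rule continuous_map_closed_cover)
      let ?side = "{p \<in> topspace J. \<rho> (1, p) \<in> {c \<in> topspace J. snd c \<in> ?S}}"
      let ?end = "{p \<in> topspace J. \<rho> (1, p) \<in> {c \<in> topspace J. fst c = e}}"
      show "finite {?side, ?end}" by simp
      show "topspace J \<subseteq> \<Union>{?side, ?end}" using \<rho>(4) r_in by auto
      fix C assume "C \<in> {?side, ?end}"
      then consider "C = ?side" | "C = ?end" by blast
      then show "closedin J C \<and> continuous_map (subtopology J C) A' (\<lambda>c. fst (G 1 \<alpha> (\<rho> (1, c))))"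
      proof cases
        case 1
        have "closedin J C"
          unfolding 1 by (rule closedin_continuous_map_preimage[OF r clS])
        moreover have "continuous_map (subtopology J C) (subtopology J {c \<in> topspace J. snd c \<in> ?S}) (\<lambda>c. \<rho> (1, c))"
          using continuous_map_from_subtopology[OF r, of C] 1
          by (auto simp: continuous_map_in_subtopology topspace_subtopology)
        from continuous_map_compose[OF continuous_map_compose[OF continuous_map_compose[OF this sub\<Psi>[OF \<alpha>]] R5] A.continuous_inclusion]
        have "continuous_map (subtopology J C) A' (\<lambda>c. fst (G 1 \<alpha> (\<rho> (1, c))))"
          by (rule continuous_map_eq) (auto simp: 1 G_def topspace_subtopology)
        ultimately show ?thesis by blast
      next
        case 2
        have "closedin J C"
          unfolding 2 by (rule closedin_continuous_map_preimage[OF r clE])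
        moreover have "continuous_map (subtopology J C) (disk_topology (Suc n)) (\<lambda>c. snd (\<rho> (1, c)))"
          using continuous_map_from_subtopology[OF continuous_map_compose[OF r J_snd], of C] by (simp add: o_def)
        from continuous_map_compose[OF this A.continuous_cell[OF \<alpha>]]
        have "continuous_map (subtopology J C) A' (\<lambda>c. fst (G 1 \<alpha> (\<rho> (1, c))))"
        proof (rule continuous_map_eq)
          fix c assume "c \<in> topspace (subtopology J C)"
          then have c: "\<rho> (1, c) \<in> topspace J" "fst (\<rho> (1, c)) = e" using 2 by (auto simp: topspace_subtopology)
          then have "\<rho> (1, c) = (e, snd (\<rho> (1, c)))" by (metis prod.collapse)
          moreover have "snd (\<rho> (1, c)) \<in> ?D" using c(1) by (auto simp: tJ mem_Times_iff)
          ultimately have "\<Psi> (\<alpha>, \<rho> (1, c)) = (\<phi> (\<alpha>, snd (\<rho> (1, c))), e)" using \<Psi>e[OF \<alpha>] by metis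
          then show "((\<lambda>x. \<phi> (\<alpha>, x)) \<circ> (\<lambda>c. snd (\<rho> (1, c)))) c = fst (G 1 \<alpha> (\<rho> (1, c)))"
            using G_end[OF _ \<alpha> c, of 1] by simp
        qed
        ultimately show ?thesis by blast
      qed
    qed
    then show "continuous_map J A' (\<lambda>x. fst (R' (1, \<Psi> (\<alpha>, x))))"
      by (rule continuous_map_eq) (simp add: R'cell \<alpha> \<tau>11)
  qed
  moreover have "continuous_map A' Z' (\<lambda>a. (a, e))"
  proof (rule A.continuous_mapI)
    show "continuous_map A Z' (\<lambda>a. (a, e))"
      using continuous_map_compose[OF R6 Z.continuous_inclusion] by (simp add: o_def)
    fix \<alpha> assume \<alpha>: "\<alpha> \<in> I"
    have "continuous_map (disk_topology (Suc n)) J (\<lambda>x. (e, x))"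
      unfolding J_def using e by (intro continuous_map_pairedI) auto
    from continuous_map_compose[OF this Z.continuous_cell[OF \<alpha>]]
    show "continuous_map (disk_topology (Suc n)) Z' (\<lambda>x. (\<phi> (\<alpha>, x), e))"
      by (rule continuous_map_eq) (simp add: \<Psi>e[OF \<alpha>])
  qed
  moreover have "\<exists>c>0. c \<le> 1 \<and> (\<forall>t\<in>{0..c}. \<forall>z\<in>topspace Z'. R' (t, z) = z)"
    using calculation(2) c0(1,2) by (intro exI[of _ "c0/2"]) auto
  ultimately have "deforms_onto_end A' Z' e R'"
    unfolding deforms_onto_end_def by blast
  then show ?thesis using that R'Z by blast
qed

section \<open>Unions of sequences of spaces\<close>

locale union_space =
  fixes Zs :: "nat \<Rightarrow> 'a topology" and Z :: "'a topology"
  assumes openin_union: "openin Z W \<longleftrightarrow> W \<subseteq> (\<Union>n. topspace (Zs n)) \<and> (\<forall>n. openin (Zs n) (W \<inter> topspace (Zs n)))"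
begin

lemma topspace_union: "topspace Z = (\<Union>n. topspace (Zs n))"
proof
  show "topspace Z \<subseteq> (\<Union>n. topspace (Zs n))" using openin_union[of "topspace Z"] by simp
  have "(\<Union>n. topspace (Zs n)) \<inter> topspace (Zs m) = topspace (Zs m)" for m by blast
  then have "openin Z (\<Union>n. topspace (Zs n))" by (simp add: openin_union)
  then show "(\<Union>n. topspace (Zs n)) \<subseteq> topspace Z" by (rule openin_subset)
qed

lemma continuous_into_union: "continuous_map (Zs n) Z (\<lambda>z. z)"
proof -
  have "{x \<in> topspace (Zs n). x \<in> W} = W \<inter> topspace (Zs n)" for W by blast
  then show ?thesis
    unfolding continuous_map by (auto simp: topspace_union openin_union)
qed

lemma continuous_map_unionI:
  assumes "\<And>n. continuous_map (Zs n) T f"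
  shows "continuous_map Z T f"
  unfolding continuous_map
proof (intro conjI allI impI)
  show "f ` topspace Z \<subseteq> topspace T"
    using assms unfolding topspace_union continuous_map_def by blast
  fix W assume W: "openin T W"
  have "{x \<in> topspace Z. f x \<in> W} \<inter> topspace (Zs n) = {x \<in> topspace (Zs n). f x \<in> W}" for n
    unfolding topspace_union by blast
  then show "openin Z {x \<in> topspace Z. f x \<in> W}"
    unfolding openin_union using openin_continuous_map_preimage[OF assms W] by (auto simp: topspace_union)
qed

text \<open>The slice and tube conditions of \<open>openin_prod_interval\<close> can be tested on
  each \<open>Zs n\<close>, as for cell attachments.\<close>

lemma continuous_map_prod_unionI:
  assumes f: "\<And>n. continuous_map (prod_topology unit_interval (Zs n)) T f"
  shows "continuous_map (prod_topology unit_interval Z) T f"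
  unfolding continuous_map
proof (intro conjI allI impI)
  show "f ` topspace (prod_topology unit_interval Z) \<subseteq> topspace T"
    using f unfolding continuous_map_def by (fastforce simp: topspace_union)
  fix W assume W: "openin T W"
  let ?P = "{p \<in> topspace (prod_topology unit_interval Z). f p \<in> W}"
  let ?Pn = "\<lambda>n. {p \<in> topspace (prod_topology unit_interval (Zs n)). f p \<in> W}"
  have Pn: "openin (prod_topology unit_interval (Zs n)) (?Pn n)" for n
    by (rule openin_continuous_map_preimage[OF f W])
  show "openin (prod_topology unit_interval Z) ?P"
  proof (rule openin_prod_interval)
    fix z assume "z \<in> topspace Z"
    then obtain n where n: "z \<in> topspace (Zs n)" by (auto simp: topspace_union)
    have "{t. (t, z) \<in> ?P} = {t. (t, z) \<in> ?Pn n}" using n by (auto simp: topspace_union)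
    then show "openin unit_interval {t. (t, z) \<in> ?P}" using openin_slice[OF Pn n] by simp
  next
    fix C :: "real set" assume C: "compactin unit_interval C"
    then have C01: "C \<subseteq> {0..1}" using compactin_subset_topspace by fastforce
    have "{z \<in> topspace Z. C \<times> {z} \<subseteq> ?P} \<inter> topspace (Zs n) = {z \<in> topspace (Zs n). C \<times> {z} \<subseteq> ?Pn n}" for n
      using C01 by (auto simp: topspace_union)
    then show "openin Z {z \<in> topspace Z. C \<times> {z} \<subseteq> ?P}"
      unfolding openin_union using openin_tube[OF Pn C] by (auto simp: topspace_union)
  qed auto
qed

end

definition union_topology :: "(nat \<Rightarrow> 'a topology) \<Rightarrow> 'a topology" where
  "union_topology Zs = topology (\<lambda>W. W \<subseteq> (\<Union>n. topspace (Zs n)) \<and> (\<forall>n. openin (Zs n) (W \<inter> topspace (Zs n))))"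

lemma union_space_union_topology: "union_space Zs (union_topology Zs)"
proof
  have "istopology (\<lambda>W. W \<subseteq> (\<Union>n. topspace (Zs n)) \<and> (\<forall>n. openin (Zs n) (W \<inter> topspace (Zs n))))"
    unfolding istopology_def
  proof (intro conjI allI impI; (elim conjE)?)
    fix S T n assume "\<forall>n. openin (Zs n) (S \<inter> topspace (Zs n))" "\<forall>n. openin (Zs n) (T \<inter> topspace (Zs n))"
    then have "openin (Zs n) ((S \<inter> topspace (Zs n)) \<inter> (T \<inter> topspace (Zs n)))" by blast
    then show "openin (Zs n) (S \<inter> T \<inter> topspace (Zs n))" by (simp add: Int_ac)
  next
    fix \<K> n assume "\<forall>K\<in>\<K>. K \<subseteq> (\<Union>n. topspace (Zs n)) \<and> (\<forall>n. openin (Zs n) (K \<inter> topspace (Zs n)))"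
    then have "openin (Zs n) (\<Union>K\<in>\<K>. K \<inter> topspace (Zs n))" by blast
    then show "openin (Zs n) (\<Union>\<K> \<inter> topspace (Zs n))" by (simp add: Int_UN_distrib Sup_inf_eq_bot_iff UN_simps)
  qed auto
  then show "openin (union_topology Zs) W \<longleftrightarrow> W \<subseteq> (\<Union>n. topspace (Zs n)) \<and> (\<forall>n. openin (Zs n) (W \<inter> topspace (Zs n)))" for W
    by (simp add: union_topology_def topology_inverse')
qed

text \<open>The inclusion at height \<open>e\<close> and the final stage of the deformation are
  homotopy inverse: one composition is the identity of \<open>T\<close>, and \<open>R\<close> joins
  the other to the identity of \<open>Z\<close>.\<close>

lemma union_homotopy_equivalent:
  fixes Ts :: "nat \<Rightarrow> 'a topology" and Zs :: "nat \<Rightarrow> ('a \<times> real) topology"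
  assumes T: "union_space Ts T" and Z: "union_space Zs Z"
    and def: "\<And>n. deforms_onto_end (Ts n) (Zs n) e (Rs n)"
    and mono: "\<And>n. topspace (Zs n) \<subseteq> topspace (Zs (Suc n))"
    and ext: "\<And>n t z. z \<in> topspace (Zs n) \<Longrightarrow> Rs (Suc n) (t, z) = Rs n (t, z)"
  shows "T homotopy_equivalent_space Z"
proof -
  interpret T: union_space Ts T by (rule T)
  interpret Z: union_space Zs Z by (rule Z)
  have mono': "topspace (Zs m) \<subseteq> topspace (Zs n)" if "m \<le> n" for m n
    using that mono by (rule lift_Suc_mono_le[rotated])
  have ext': "Rs n (t, z) = Rs m (t, z)" if "m \<le> n" "z \<in> topspace (Zs m)" for m n t z
    using that(1)
  proof (induction n rule: dec_induct)
    case (step k)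
    then show ?case using ext[of z k t] mono'[of m k] that(2) by auto
  qed simp
  \<comment> \<open>Any stage that contains the point gives the same value, by
    \<open>ext'\<close>.\<close>
  define R where "R p = Rs (LEAST n. snd p \<in> topspace (Zs n)) p" for p
  have R: "R (t, z) = Rs n (t, z)" if "z \<in> topspace (Zs n)" for t z n
  proof -
    have "z \<in> topspace (Zs (LEAST n. z \<in> topspace (Zs n)))" using that by (rule LeastI)
    moreover have "(LEAST n. z \<in> topspace (Zs n)) \<le> n" using that by (rule Least_le)
    ultimately show ?thesis using ext' by (simp add: R_def)
  qed
  have Rcont: "continuous_map (prod_topology unit_interval Z) Z R"
  proof (rule Z.continuous_map_prod_unionI)
    fix n
    have "continuous_map (prod_topology unit_interval (Zs n)) (Zs n) (Rs n)"
      using def[of n] by (simp add: deforms_onto_end_def)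
    from continuous_map_compose[OF this Z.continuous_into_union]
    show "continuous_map (prod_topology unit_interval (Zs n)) Z R"
      by (rule continuous_map_eq) (auto simp: R)
  qed
  have i: "continuous_map T Z (\<lambda>a. (a, e))"
  proof (rule T.continuous_map_unionI)
    fix n
    have "continuous_map (Ts n) (Zs n) (\<lambda>a. (a, e))" using def[of n] by (simp add: deforms_onto_end_def)
    from continuous_map_compose[OF this Z.continuous_into_union]
    show "continuous_map (Ts n) Z (\<lambda>a. (a, e))" by (simp add: o_def)
  qed
  have r: "continuous_map Z T (\<lambda>z. fst (R (1, z)))"
  proof (rule Z.continuous_map_unionI)
    fix n
    have "continuous_map (Zs n) (Ts n) (\<lambda>z. fst (Rs n (1, z)))" using def[of n] by (simp add: deforms_onto_end_def)
    from continuous_map_compose[OF this T.continuous_into_union]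
    show "continuous_map (Zs n) T (\<lambda>z. fst (R (1, z)))"
      by (rule continuous_map_eq) (auto simp: R)
  qed
  have ri: "fst (R (1, (a, e))) = a" if a: "a \<in> topspace T" for a
  proof -
    obtain n where n: "a \<in> topspace (Ts n)" using a by (auto simp: T.topspace_union)
    moreover have "continuous_map (Ts n) (Zs n) (\<lambda>a. (a, e))" using def[of n] by (simp add: deforms_onto_end_def)
    ultimately have "(a, e) \<in> topspace (Zs n)" by (auto simp: continuous_map_def)
    moreover have "Rs n (1, (a, e)) = (a, e)" using def[of n] n by (simp add: deforms_onto_end_def)
    ultimately show ?thesis by (simp add: R)
  qed
  have R1: "(fst (R (1, z)), e) = R (1, z)" and R0: "R (0, z) = z" if z: "z \<in> topspace Z" for z
  proof -
    obtain n where n: "z \<in> topspace (Zs n)" using z by (auto simp: Z.topspace_union)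
    then have "snd (Rs n (1, z)) = e" using def[of n] by (simp add: deforms_onto_end_def)
    then show "(fst (R (1, z)), e) = R (1, z)" using n by (simp add: R prod_eq_iff)
    have "Rs n (0, z) = z" using def[of n] n unfolding deforms_onto_end_def by force
    then show "R (0, z) = z" using n by (simp add: R)
  qed
  have "homotopic_with (\<lambda>_. True) T T ((\<lambda>z. fst (R (1, z))) \<circ> (\<lambda>a. (a, e))) id"
    by (rule homotopic_with_equal) (use ri continuous_map_compose[OF i r] in auto)
  moreover have "homotopic_with (\<lambda>_. True) Z Z id ((\<lambda>a. (a, e)) \<circ> (\<lambda>z. fst (R (1, z))))"
    by (subst homotopic_with) (use Rcont R0 R1 in \<open>auto intro!: exI[of _ R]\<close>)
  ultimately show ?thesis
    unfolding homotopy_equivalent_space_def using i r homotopic_with_symD by blast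
qed

section \<open>Numerically generated spaces\<close>

text \<open>Plots are continuous, so they are among the maps that test numerical generation.\<close>

lemma numerically_generated_D_topology:
  assumes X: "diffeological_space X"
  shows "numerically_generated (D_topology X)"
  unfolding numerically_generated_def
proof (intro allI iffI)
  fix W assume "openin (D_topology X) W"
  then show "W \<subseteq> topspace (D_topology X) \<and> (\<forall>n U g. openin (Euclidean_space n) U \<and>
      continuous_map (subtopology (Euclidean_space n) U) (D_topology X) g \<longrightarrow> openin (Euclidean_space n) {u \<in> U. g u \<in> W})"
    using openin_preimage openin_subset by blast
next
  fix W assume W: "W \<subseteq> topspace (D_topology X) \<and> (\<forall>n U g. openin (Euclidean_space n) U \<and>
      continuous_map (subtopology (Euclidean_space n) U) (D_topology X) g \<longrightarrow> openin (Euclidean_space n) {u \<in> U. g u \<in> W})"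
  show "openin (D_topology X) W"
    unfolding openin_D_topology[OF X]
  proof (intro conjI allI impI)
    show "W \<subseteq> points X" using W X by simp
    fix n U P assume P: "plot X n U P"
    show "openin (Euclidean_space n) {u \<in> U. P u \<in> W}"
      by (rule W[THEN conjunct2, rule_format, OF conjI[OF plot_openin[OF X P] continuous_map_plot[OF X P]]])
  qed
qed

text \<open>Induction over the skeleta. The test map for a cell is its characteristic map after
  \<open>collar_push\<close> at time 1, which is defined on all of R^(n+1);
  \<open>openin_disk_if_push\<close> turns the open preimage into openness in the closed
  disk.\<close>

lemma numerically_generated_union:
  assumes Y: "union_space Ys Y" and discrete: "Ys 0 = discrete_topology (topspace (Ys 0))"
    and att: "\<And>n. cell_attachment (Ys n) (Ys (Suc n)) (disk_topology (Suc n)) (topspace (nsphere n)) (I n) (\<Phi> n)"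
  shows "numerically_generated Y"
  unfolding numerically_generated_def
proof (intro allI iffI)
  fix W assume "openin Y W"
  then show "W \<subseteq> topspace Y \<and> (\<forall>n U g. openin (Euclidean_space n) U \<and>
      continuous_map (subtopology (Euclidean_space n) U) Y g \<longrightarrow> openin (Euclidean_space n) {u \<in> U. g u \<in> W})"
    using openin_preimage openin_subset by blast
next
  fix W assume W: "W \<subseteq> topspace Y \<and> (\<forall>n U g. openin (Euclidean_space n) U \<and>
      continuous_map (subtopology (Euclidean_space n) U) Y g \<longrightarrow> openin (Euclidean_space n) {u \<in> U. g u \<in> W})"
  interpret Y: union_space Ys Y by (rule Y)
  have "openin (Ys n) (W \<inter> topspace (Ys n))" for n
  proof (induction n)
    case 0
    show ?case by (subst discrete) simp
  next
    case (Suc n)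
    interpret c: cell_attachment "Ys n" "Ys (Suc n)" "disk_topology (Suc n)" "topspace (nsphere n)" "I n" "\<Phi> n"
      by (rule att)
    have "openin (disk_topology (Suc n)) {x \<in> unit_disk (Suc n). \<Phi> n (\<alpha>, x) \<in> W}" if \<alpha>: "\<alpha> \<in> I n" for \<alpha>
    proof (rule openin_disk_if_push)
      let ?E = "Euclidean_space (Suc n)"
      have "continuous_map ?E ?E (collar_push (Suc n) 1)"
        by (rule continuous_map_collar_push) auto
      then have "continuous_map ?E (disk_topology (Suc n)) (collar_push (Suc n) 1)"
        using collar_push_1_in_disk by (auto simp: continuous_map_in_subtopology)
      from continuous_map_compose[OF continuous_map_compose[OF this c.continuous_cell[OF \<alpha>]] Y.continuous_into_union]
      have "continuous_map (subtopology ?E (topspace ?E)) Y (\<lambda>x. \<Phi> n (\<alpha>, collar_push (Suc n) 1 x))"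
        by (simp add: o_def)
      then have "openin ?E {x \<in> topspace ?E. \<Phi> n (\<alpha>, collar_push (Suc n) 1 x) \<in> W}"
        using W by blast
      moreover have "{x \<in> topspace ?E. \<Phi> n (\<alpha>, collar_push (Suc n) 1 x) \<in> W} =
          {x \<in> topspace ?E. collar_push (Suc n) 1 x \<in> {x \<in> unit_disk (Suc n). \<Phi> n (\<alpha>, x) \<in> W}}"
        using collar_push_1_in_disk by blast
      ultimately show "openin ?E {x \<in> topspace ?E. collar_push (Suc n) 1 x \<in> {x \<in> unit_disk (Suc n). \<Phi> n (\<alpha>, x) \<in> W}}"
        by (simp only:)
    qed auto
    moreover have "{x \<in> topspace (disk_topology (Suc n)). \<Phi> n (\<alpha>, x) \<in> W \<inter> topspace (Ys (Suc n))} =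
        {x \<in> unit_disk (Suc n). \<Phi> n (\<alpha>, x) \<in> W}" if "\<alpha> \<in> I n" for \<alpha>
      using c.cell_in[OF that] by (simp del: topspace_subtopology) blast
    moreover have "W \<inter> topspace (Ys (Suc n)) \<inter> topspace (Ys n) = W \<inter> topspace (Ys n)"
      using c.A_subset by blast
    ultimately show ?case
      unfolding c.openin_Z using Suc by (simp del: topspace_subtopology)
  qed
  then show "openin Y W" using W by (simp add: Y.openin_union Y.topspace_union)
qed

section \<open>The inductive step\<close>

lemma topological_pushout_imp_cell_attachment:
  assumes h: "continuous_map (sum_topology (\<lambda>_. nsphere n) I) A h"
    and push: "topological_pushout (sum_topology (\<lambda>_. nsphere n) I) A (sum_topology (\<lambda>_. disk_topology (Suc n)) I)
      h (\<lambda>x. x) Z (\<lambda>x. x) \<Phi>"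
  shows "cell_attachment A Z (disk_topology (Suc n)) (topspace (nsphere n)) I \<Phi>"
proof -
  note [simp del] = topspace_subtopology
  let ?S = "topspace (nsphere n)" and ?D = "unit_disk (Suc n)"
  have sp: "set_pushout (I \<times> ?S) (topspace A) (I \<times> ?D) h (\<lambda>x. x) (topspace Z) (\<lambda>x. x) \<Phi>"
    and op: "\<And>W. openin Z W \<longleftrightarrow> W \<subseteq> topspace Z \<and> openin A {a \<in> topspace A. a \<in> W} \<and>
      openin (sum_topology (\<lambda>_. disk_topology (Suc n)) I) {b \<in> I \<times> ?D. \<Phi> b \<in> W}"
    using push by (simp_all add: topological_pushout_def o_def)
  have SD: "?S \<subseteq> ?D" by (rule nsphere_subset_unit_disk)
  have hA: "h \<in> I \<times> ?S \<rightarrow> topspace A" using h by (simp add: continuous_map_def o_def)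
  have "I \<times> ?D - I \<times> ?S = I \<times> (?D - ?S)" by blast
  moreover have "I \<times> ?S \<subseteq> I \<times> ?D" using SD by blast
  ultimately have facts: "topspace Z = topspace A \<union> \<Phi> ` (I \<times> ?D)" "\<forall>c\<in>I \<times> ?S. \<Phi> c = h c"
      "inj_on \<Phi> (I \<times> (?D - ?S))" "\<Phi> ` (I \<times> (?D - ?S)) \<inter> topspace A = {}"
    using sp set_pushout_inclusion_iff[OF _ hA, of "I \<times> ?D"] by auto
  show ?thesis
  proof
    show "closedin (disk_topology (Suc n)) ?S" by (rule closedin_disk_nsphere)
    show "topspace Z = topspace A \<union> \<Phi> ` (I \<times> topspace (disk_topology (Suc n)))"
      "inj_on \<Phi> (I \<times> (topspace (disk_topology (Suc n)) - ?S))"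
      "\<Phi> ` (I \<times> (topspace (disk_topology (Suc n)) - ?S)) \<inter> topspace A = {}"
      using facts by simp_all
    show "continuous_map (subtopology (disk_topology (Suc n)) ?S) A (\<lambda>x. \<Phi> (\<alpha>, x))" if "\<alpha> \<in> I" for \<alpha>
      unfolding nsphere_eq[symmetric]
      using continuous_map_compose[OF continuous_map_component_injection[OF that, of "\<lambda>_. nsphere n"] h]
      by (rule continuous_map_eq) (use facts(2) that in auto)
    fix W
    have "{a \<in> topspace A. a \<in> W} = W \<inter> topspace A" by blast
    moreover have "openin (sum_topology (\<lambda>_. disk_topology (Suc n)) I) {b \<in> I \<times> ?D. \<Phi> b \<in> W} \<longleftrightarrow>
        (\<forall>\<alpha>\<in>I. openin (disk_topology (Suc n)) {x \<in> ?D. \<Phi> (\<alpha>, x) \<in> W})"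
      by (subst openin_sum_topology) (auto simp: o_def cong: conj_cong)
    ultimately show "openin Z W \<longleftrightarrow> W \<subseteq> topspace Z \<and> openin A (W \<inter> topspace A) \<and>
        (\<forall>\<alpha>\<in>I. openin (disk_topology (Suc n)) {x \<in> topspace (disk_topology (Suc n)). \<Phi> (\<alpha>, x) \<in> W})"
      using op by simp
  qed
qed

text \<open>In its use, \<open>\<Phi>\<close> already has its boundary values in \<open>A\<close>.
  The pushout can therefore live on a given set \<open>T\<close> instead of a quotient, and only its
  final topology has to be constructed.\<close>

definition attach_topology :: "'a topology \<Rightarrow> 'a set \<Rightarrow> 'b topology \<Rightarrow> 'i set \<Rightarrow> ('i \<times> 'b \<Rightarrow> 'a) \<Rightarrow> 'a topology" where
  "attach_topology A T B I \<Phi> = topology (\<lambda>W. W \<subseteq> T \<and> openin A (W \<inter> topspace A) \<and>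
     (\<forall>\<alpha>\<in>I. openin B {x \<in> topspace B. \<Phi> (\<alpha>, x) \<in> W}))"

lemma openin_attach_topology:
  "openin (attach_topology A T B I \<Phi>) W \<longleftrightarrow> W \<subseteq> T \<and> openin A (W \<inter> topspace A) \<and>
     (\<forall>\<alpha>\<in>I. openin B {x \<in> topspace B. \<Phi> (\<alpha>, x) \<in> W})"
proof -
  have "istopology (\<lambda>W. W \<subseteq> T \<and> openin A (W \<inter> topspace A) \<and> (\<forall>\<alpha>\<in>I. openin B {x \<in> topspace B. \<Phi> (\<alpha>, x) \<in> W}))"
    unfolding istopology_def
  proof (intro conjI allI impI ballI; (elim conjE)?)
    fix S T assume "openin A (S \<inter> topspace A)" "openin A (T \<inter> topspace A)"
    then have "openin A ((S \<inter> topspace A) \<inter> (T \<inter> topspace A))" by blast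
    then show "openin A (S \<inter> T \<inter> topspace A)" by (simp add: Int_ac)
  next
    fix S T \<alpha> assume "\<alpha> \<in> I" "\<forall>\<alpha>\<in>I. openin B {x \<in> topspace B. \<Phi> (\<alpha>, x) \<in> S}" "\<forall>\<alpha>\<in>I. openin B {x \<in> topspace B. \<Phi> (\<alpha>, x) \<in> T}"
    then have "openin B ({x \<in> topspace B. \<Phi> (\<alpha>, x) \<in> S} \<inter> {x \<in> topspace B. \<Phi> (\<alpha>, x) \<in> T})" by blast
    moreover have "{x \<in> topspace B. \<Phi> (\<alpha>, x) \<in> S} \<inter> {x \<in> topspace B. \<Phi> (\<alpha>, x) \<in> T} = {x \<in> topspace B. \<Phi> (\<alpha>, x) \<in> S \<inter> T}" by blast
    ultimately show "openin B {x \<in> topspace B. \<Phi> (\<alpha>, x) \<in> S \<inter> T}" by simp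
  next
    fix \<K> assume "\<forall>K\<in>\<K>. K \<subseteq> T \<and> openin A (K \<inter> topspace A) \<and> (\<forall>\<alpha>\<in>I. openin B {x \<in> topspace B. \<Phi> (\<alpha>, x) \<in> K})"
    then have "openin A (\<Union>K\<in>\<K>. K \<inter> topspace A)" by blast
    moreover have "(\<Union>K\<in>\<K>. K \<inter> topspace A) = \<Union>\<K> \<inter> topspace A" by blast
    ultimately show "openin A (\<Union>\<K> \<inter> topspace A)" by simp
  next
    fix \<K> \<alpha> assume "\<forall>K\<in>\<K>. K \<subseteq> T \<and> openin A (K \<inter> topspace A) \<and> (\<forall>\<alpha>\<in>I. openin B {x \<in> topspace B. \<Phi> (\<alpha>, x) \<in> K})" "\<alpha> \<in> I"
    then have "openin B (\<Union>K\<in>\<K>. {x \<in> topspace B. \<Phi> (\<alpha>, x) \<in> K})" by blast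
    moreover have "(\<Union>K\<in>\<K>. {x \<in> topspace B. \<Phi> (\<alpha>, x) \<in> K}) = {x \<in> topspace B. \<Phi> (\<alpha>, x) \<in> \<Union>\<K>}" by blast
    ultimately show "openin B {x \<in> topspace B. \<Phi> (\<alpha>, x) \<in> \<Union>\<K>}" by simp
  qed auto
  then show ?thesis by (simp add: attach_topology_def topology_inverse')
qed

lemma cell_attachment_attach_topology:
  assumes "closedin B S" and T: "T = topspace A \<union> \<Phi> ` (I \<times> topspace B)"
    and att: "\<And>\<alpha>. \<alpha> \<in> I \<Longrightarrow> continuous_map (subtopology B S) A (\<lambda>x. \<Phi> (\<alpha>, x))"
    and "inj_on \<Phi> (I \<times> (topspace B - S))" and disj: "\<Phi> ` (I \<times> (topspace B - S)) \<inter> topspace A = {}"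
  shows "cell_attachment A (attach_topology A T B I \<Phi>) B S I \<Phi> \<and> topspace (attach_topology A T B I \<Phi>) = T"
proof -
  have "openin (attach_topology A T B I \<Phi>) T"
  proof -
    have "T \<inter> topspace A = topspace A" using T by blast
    moreover have "{x \<in> topspace B. \<Phi> (\<alpha>, x) \<in> T} = topspace B" if "\<alpha> \<in> I" for \<alpha> using T that by blast
    ultimately show ?thesis by (simp add: openin_attach_topology)
  qed
  then have t: "topspace (attach_topology A T B I \<Phi>) = T"
    by (metis openin_attach_topology openin_subset openin_topspace subset_antisym)
  moreover have "cell_attachment A (attach_topology A T B I \<Phi>) B S I \<Phi>"
    by (rule cell_attachment.intro) (use assms t in \<open>simp_all add: openin_attach_topology\<close>)
  ultimately show ?thesis by blast
qed

lemma smooth_sphere_approximation: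
  assumes X: "diffeological_space X" "smoothable X" and g: "continuous_map (nsphere n) (D_topology X) g"
  obtains h where "smooth_map (smooth_sphere n) X h" "homotopic_with (\<lambda>_. True) (nsphere n) (D_topology X) g h"
proof -
  let ?U = "punctured_space (Suc n)" and ?S = "topspace (nsphere n)" and ?E = "Euclidean_space (Suc n)"
  have f: "continuous_map (subtopology ?E ?U) (D_topology X) (g \<circ> sphere_project n)"
    by (rule continuous_map_compose[OF continuous_map_sphere_project g])
  have "compactin ?E (?S \<inter> unit_disk (Suc n))"
    by (rule closed_Int_compactin[OF closedin_nsphere compactin_unit_disk])
  then have "compactin ?E ?S"
    using nsphere_subset_unit_disk[of n] by (simp add: Int_absorb2)
  \<comment> \<open>Nothing is smooth yet, so \<open>V\<close> is empty; the empty map is a plot by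
    the covering axiom for the empty cover.\<close>
  have "plot X (Suc n) {} (g \<circ> sphere_project n)"
    using plot_cover[OF X(1), of "{}" "Suc n"] by simp
  then obtain f' L V' where V': "{} \<union> ?S \<subseteq> V'" "plot X (Suc n) V' f'"
    and hom: "homotopic_with (\<lambda>k. \<forall>u\<in>?U - L. k u = (g \<circ> sphere_project n) u) (subtopology ?E ?U) (D_topology X) (g \<circ> sphere_project n) f'"
    using X(2)[unfolded smoothable_def, rule_format, of "Suc n" ?U "{}" "g \<circ> sphere_project n" ?S]
      openin_punctured_space \<open>compactin ?E ?S\<close> nsphere_subset_punctured f by blast
  show ?thesis
  proof (rule that[of f'])
    show "smooth_map (smooth_sphere n) X f'"
      unfolding smooth_map_def
    proof (intro conjI allI impI)
      show "f' \<in> points (smooth_sphere n) \<rightarrow> points X"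
        using plot_funcset[OF X(1) V'(2)] V'(1) by auto
      fix m U P assume P: "plot (smooth_sphere n) m U P"
      have "euclidean_smooth m U (Suc n) V' P"
        using P V' plot_openin[OF X(1) V'(2)] by (auto simp: euclidean_smooth_def plot_subset_diffeology)
      then show "plot X m U (f' \<circ> P)" by (rule plot_comp[OF X(1) V'(2)])
    qed
    have "continuous_map (nsphere n) (subtopology ?E ?U) (\<lambda>x. x)"
      by (subst nsphere_eq_subtopology)
         (use nsphere_subset_punctured in \<open>auto simp: continuous_map_in_subtopology intro: continuous_map_from_subtopology\<close>)
    from homotopic_with_compose_continuous_map_right[OF hom this, of "\<lambda>_. True"]
    have "homotopic_with (\<lambda>_. True) (nsphere n) (D_topology X) (g \<circ> sphere_project n \<circ> (\<lambda>x. x)) (f' \<circ> (\<lambda>x. x))"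
      by simp
    then show "homotopic_with (\<lambda>_. True) (nsphere n) (D_topology X) g f'"
      by (rule homotopic_with_eq) (auto simp: sphere_project_id)
  qed
qed

lemma deforms_onto_end_cylinder:
  assumes e: "e \<in> {0, 1}"
  obtains R where "deforms_onto_end A (prod_topology A unit_interval) e R"
proof -
  let ?Z = "prod_topology A unit_interval" and ?P = "prod_topology unit_interval (prod_topology A unit_interval)"
  \<comment> \<open>Rests at 0 until time 1/2, as \<open>deforms_onto_end\<close> demands, and then
    drives the height linearly to \<open>e\<close>.\<close>
  define l where "l t = max 0 (2 * t - 1)" for t :: real
  define R where "R p = (fst (snd p), (1 - l (fst p)) * snd (snd p) + l (fst p) * e)" for p :: "real \<times> 'a \<times> real"
  have l: "0 \<le> l t" "l t \<le> 1" if "t \<in> {0..1}" for t using that by (auto simp: l_def)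
  have f1: "continuous_map ?P euclideanreal fst"
    by (meson continuous_map_fst continuous_map_in_subtopology)
  have f2: "continuous_map ?P A (\<lambda>p. fst (snd p))"
    using continuous_map_compose[OF continuous_map_snd continuous_map_fst] by (simp add: o_def)
  have f3: "continuous_map ?P unit_interval (\<lambda>p. snd (snd p))"
    using continuous_map_compose[OF continuous_map_snd continuous_map_snd] by (simp add: o_def)
  then have f3': "continuous_map ?P euclideanreal (\<lambda>p. snd (snd p))"
    by (simp add: continuous_map_real_of_interval)
  have "continuous_map ?P euclideanreal (\<lambda>p. (1 - l (fst p)) * snd (snd p) + l (fst p) * e)"
    unfolding l_def
    by (intro continuous_map_add continuous_map_real_mult continuous_map_diff continuous_map_real_max f1 f3') auto
  moreover have "(1 - l (fst p)) * snd (snd p) + l (fst p) * e \<in> {0..1}" if "p \<in> topspace ?P" for p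
  proof -
    have p: "fst p \<in> {0..1}" "snd (snd p) \<in> {0..1}" using that by auto
    then have "(1 - l (fst p)) * snd (snd p) + l (fst p) * e \<le> 1"
      using l[OF p(1)] e by (intro convex_bound_le) auto
    moreover have "0 \<le> (1 - l (fst p)) * snd (snd p) + l (fst p) * e"
      using l[OF p(1)] p e by (intro add_nonneg_nonneg mult_nonneg_nonneg) auto
    ultimately show ?thesis by simp
  qed
  ultimately have R: "continuous_map ?P ?Z R"
    unfolding R_def[abs_def] by (intro continuous_map_pairedI f2) (auto simp: continuous_map_real_of_interval)
  have "continuous_map A ?Z (\<lambda>a. (a, e))"
    using e by (intro continuous_map_pairedI) auto
  moreover have "continuous_map ?Z A (\<lambda>z. fst (R (1, z)))"
    by (simp add: R_def continuous_map_fst)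
  moreover have "\<exists>c>0. c \<le> 1 \<and> (\<forall>t\<in>{0..c}. \<forall>z\<in>topspace ?Z. R (t, z) = z)"
    by (intro exI[of _ "1/2"]) (auto simp: R_def l_def)
  moreover have "R (t, (a, e)) = (a, e)" for t a
    by (simp add: R_def algebra_simps)
  moreover have "snd (R (1, z)) = e" for z
    by (simp add: R_def l_def)
  ultimately have "deforms_onto_end A ?Z e R"
    using R unfolding deforms_onto_end_def by blast
  then show ?thesis by (rule that)
qed

text \<open>The cells \<open>{0..1} \<times> D\<close> of the new cylinder are glued along homotopies in \<open>Z\<close> between the
  topological attaching maps at the end \<open>0\<close> and the smooth ones at the end \<open>1\<close>.\<close>

lemma smooth_model_attach:
  fixes A A' :: "'a topology" and X :: "'a diffeology" and Z :: "('a \<times> real) topology"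
    and \<phi> :: "'i \<times> (nat \<Rightarrow> real) \<Rightarrow> 'a"
  assumes att: "cell_attachment A A' (disk_topology (Suc n)) (topspace (nsphere n)) I \<phi>"
    and X: "diffeological_space X" and pts: "points X = topspace A" and sm: "smoothable X"
    and tZ: "topspace Z = topspace A \<times> {0..1}"
    and d0: "deforms_onto_end A Z 0 R0" and d1: "deforms_onto_end (D_topology X) Z 1 R1"
  shows "\<exists>X' Z' R0' R1' h \<Phi>. diffeological_space X' \<and> points X' = topspace A' \<and> smoothable X' \<and>
    topspace Z' = topspace A' \<times> {0..1} \<and>
    deforms_onto_end A' Z' 0 R0' \<and> deforms_onto_end (D_topology X') Z' 1 R1' \<and>
    smooth_map (coproduct_diffeology (\<lambda>_. smooth_sphere n) I) X h \<and>
    diffeological_pushout (coproduct_diffeology (\<lambda>_. smooth_sphere n) I) X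
      (coproduct_diffeology (\<lambda>_. smooth_disk (Suc n)) I) h (\<lambda>x. x) X' (\<lambda>x. x) \<Phi> \<and>
    (\<forall>t. \<forall>z\<in>topspace Z. R0' (t, z) = R0 (t, z) \<and> R1' (t, z) = R1 (t, z))"
proof -
  note [simp del] = sum.lessThan_Suc topspace_subtopology
  let ?S = "topspace (nsphere n)" and ?D = "unit_disk (Suc n)"
  interpret A: cell_attachment A A' "disk_topology (Suc n)" ?S I \<phi> by (rule att)
  have SD: "?S \<subseteq> ?D" by (rule nsphere_subset_unit_disk)
  have \<phi>A: "continuous_map (nsphere n) A (\<lambda>x. \<phi> (\<alpha>, x))" if "\<alpha> \<in> I" for \<alpha>
    using A.attach[OF that] by (simp flip: nsphere_eq)
  have A0: "continuous_map A Z (\<lambda>a. (a, 0))"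
    using d0 by (simp add: deforms_onto_end_def)
  have R1: "continuous_map (prod_topology unit_interval Z) Z R1"
    and R1_0: "\<And>z. z \<in> topspace Z \<Longrightarrow> R1 (0, z) = z"
    and R1_1: "\<And>z. z \<in> topspace Z \<Longrightarrow> snd (R1 (1, z)) = 1"
    and R1_X: "continuous_map Z (D_topology X) (\<lambda>z. fst (R1 (1, z)))"
    and X1: "continuous_map (D_topology X) Z (\<lambda>a. (a, 1))"
    using d1 unfolding deforms_onto_end_def by force+
  have b0: "continuous_map (nsphere n) Z (\<lambda>x. (\<phi> (\<alpha>, x), 0))" if "\<alpha> \<in> I" for \<alpha>
    using continuous_map_compose[OF \<phi>A[OF that] A0] by (simp add: o_def)
  have "\<exists>p. \<alpha> \<in> I \<longrightarrow> smooth_map (smooth_sphere n) X (fst p) \<and>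
      continuous_map (prod_topology unit_interval (nsphere n)) Z (snd p) \<and>
      (\<forall>x. snd p (0, x) = (\<phi> (\<alpha>, x), 0)) \<and> (\<forall>x. snd p (1, x) = (fst p x, 1))" for \<alpha>
  proof (cases "\<alpha> \<in> I")
    case \<alpha>: True
    \<comment> \<open>The attaching map placed at height 0 and carried by \<open>R1\<close> to the
      other end: a continuous map into the smooth skeleton that is homotopic in \<open>Z\<close> to
      the original and ready to be smoothed.\<close>
    define g where "g x = fst (R1 (1, (\<phi> (\<alpha>, x), 0)))" for x
    have "continuous_map (nsphere n) (D_topology X) g"
      using continuous_map_compose[OF b0[OF \<alpha>] R1_X] by (simp add: o_def g_def[abs_def])
    then obtain h where h: "smooth_map (smooth_sphere n) X h"
        "homotopic_with (\<lambda>_. True) (nsphere n) (D_topology X) g h"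
      by (rule smooth_sphere_approximation[OF X sm])
    have "homotopic_with (\<lambda>_. True) (nsphere n) Z (\<lambda>x. (\<phi> (\<alpha>, x), 0)) (\<lambda>x. (g x, 1))"
    proof (subst homotopic_with)
      have "continuous_map (prod_topology unit_interval (nsphere n)) (prod_topology unit_interval Z)
          (\<lambda>p. (fst p, (\<phi> (\<alpha>, snd p), 0)))"
        using continuous_map_compose[OF continuous_map_snd b0[OF \<alpha>]]
        by (intro continuous_map_pairedI continuous_map_fst) (simp add: o_def)
      from continuous_map_compose[OF this R1]
      have "continuous_map (prod_topology unit_interval (nsphere n)) Z (\<lambda>p. R1 (fst p, (\<phi> (\<alpha>, snd p), 0)))"
        by (simp add: o_def)
      moreover have "(\<phi> (\<alpha>, x), 0) \<in> topspace Z" if "x \<in> ?S" for x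
        using b0[OF \<alpha>] that by (auto simp: continuous_map_def)
      ultimately show "\<exists>k. continuous_map (prod_topology unit_interval (nsphere n)) Z k \<and>
          (\<forall>x\<in>topspace (nsphere n). k (0, x) = (\<phi> (\<alpha>, x), 0)) \<and>
          (\<forall>x\<in>topspace (nsphere n). k (1, x) = (g x, 1)) \<and> (\<forall>t\<in>{0..1}. True)"
        using R1_0 R1_1 by (intro exI[of _ "\<lambda>p. R1 (fst p, (\<phi> (\<alpha>, snd p), 0))"]) (auto simp: g_def prod_eq_iff)
    qed auto
    moreover have "homotopic_with (\<lambda>_. True) (nsphere n) Z ((\<lambda>a. (a, 1)) \<circ> g) ((\<lambda>a. (a, 1)) \<circ> h)"
      by (rule homotopic_with_compose_continuous_map_left[OF h(2) X1]) auto
    ultimately have "homotopic_with (\<lambda>_. True) (nsphere n) Z (\<lambda>x. (\<phi> (\<alpha>, x), 0)) (\<lambda>x. (h x, 1))"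
      using homotopic_with_trans by (fastforce simp: o_def)
    \<comment> \<open>\<open>homotopic_with_def\<close> fixes the end values at every argument, on
      the sphere or off it, which keeps the equations for \<open>k\<close> free of side
      conditions.\<close>
    then obtain k where "continuous_map (prod_topology unit_interval (nsphere n)) Z k"
        "\<forall>x. k (0, x) = (\<phi> (\<alpha>, x), 0)" "\<forall>x. k (1, x) = (h x, 1)"
      unfolding homotopic_with_def by blast
    then show ?thesis using h(1) by (intro exI[of _ "(h, k)"]) simp
  qed simp
  then have "\<exists>p. \<forall>\<alpha>. \<alpha> \<in> I \<longrightarrow> smooth_map (smooth_sphere n) X (fst (p \<alpha>)) \<and>
      continuous_map (prod_topology unit_interval (nsphere n)) Z (snd (p \<alpha>)) \<and>
      (\<forall>x. snd (p \<alpha>) (0, x) = (\<phi> (\<alpha>, x), 0)) \<and> (\<forall>x. snd (p \<alpha>) (1, x) = (fst (p \<alpha>) x, 1))"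
    by (intro choice allI)
  then obtain p where p: "\<forall>\<alpha>. \<alpha> \<in> I \<longrightarrow> smooth_map (smooth_sphere n) X (fst (p \<alpha>)) \<and>
      continuous_map (prod_topology unit_interval (nsphere n)) Z (snd (p \<alpha>)) \<and>
      (\<forall>x. snd (p \<alpha>) (0, x) = (\<phi> (\<alpha>, x), 0)) \<and> (\<forall>x. snd (p \<alpha>) (1, x) = (fst (p \<alpha>) x, 1))"
    by blast
  define h where "h c = fst (p (fst c)) (snd c)" for c
  define k where "k \<alpha> = snd (p \<alpha>)" for \<alpha>
  have h: "smooth_map (smooth_sphere n) X (\<lambda>x. h (\<alpha>, x))" and kc: "continuous_map (prod_topology unit_interval (nsphere n)) Z (k \<alpha>)"
    and k0: "k \<alpha> (0, x) = (\<phi> (\<alpha>, x), 0)" and k1: "k \<alpha> (1, x) = (h (\<alpha>, x), 1)" if "\<alpha> \<in> I" for \<alpha> x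
    using p that by (simp_all add: h_def k_def)
  \<comment> \<open>Inside the cells the old characteristic map is kept, so that \<open>X'\<close>
    gets the points of \<open>A'\<close>.\<close>
  define \<Phi> where "\<Phi> c = (if snd c \<in> ?S then h c else \<phi> c)" for c
  have hX: "h (\<alpha>, x) \<in> points X" if "\<alpha> \<in> I" "x \<in> ?S" for \<alpha> x
    using h[OF that(1)] that(2) by (auto simp: smooth_map_def)
  have \<Phi>int: "\<Phi> c = \<phi> c" if "c \<in> I \<times> (?D - ?S)" for c
    using that by (auto simp: \<Phi>_def)
  let ?P' = "points X \<union> \<Phi> ` (I \<times> ?D)"
  define X' where "X' = generated_diffeology ?P'
    ({(m, U, (\<lambda>x. x) \<circ> P) | m U P. plot X m U P} \<union>
     {(m, U, \<Phi> \<circ> P) | m U P. plot (coproduct_diffeology (\<lambda>_. smooth_disk (Suc n)) I) m U P})"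
  have pX': "points X' = ?P'" by (simp add: X'_def)
  have h_smooth: "smooth_map (coproduct_diffeology (\<lambda>_. smooth_sphere n) I) X h"
    using h by (simp add: smooth_map_from_spheres[OF X])
  have push: "diffeological_pushout (coproduct_diffeology (\<lambda>_. smooth_sphere n) I) X
      (coproduct_diffeology (\<lambda>_. smooth_disk (Suc n)) I) h (\<lambda>x. x) X' (\<lambda>x. x) \<Phi>"
    unfolding diffeological_pushout_def
  proof
    have "I \<times> ?D - I \<times> ?S = I \<times> (?D - ?S)" by blast
    moreover have "inj_on \<Phi> (I \<times> (?D - ?S))"
      by (subst inj_on_cong[OF \<Phi>int]) (use A.inj in simp_all)
    moreover have "\<Phi> ` (I \<times> (?D - ?S)) \<inter> points X = {}"
    proof -
      have "\<phi> ` (I \<times> (?D - ?S)) \<inter> points X = {}" using A.disjoint pts by simp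
      moreover have "\<Phi> ` (I \<times> (?D - ?S)) = \<phi> ` (I \<times> (?D - ?S))" by (rule image_cong[OF refl \<Phi>int])
      ultimately show ?thesis by simp
    qed
    moreover have "h \<in> I \<times> ?S \<rightarrow> points X" using hX by auto
    ultimately have "set_pushout (I \<times> ?S) (points X) (I \<times> ?D) h (\<lambda>x. x) ?P' (\<lambda>x. x) \<Phi>"
      using SD by (subst set_pushout_inclusion_iff) (auto simp: \<Phi>_def)
    then show "set_pushout (points (coproduct_diffeology (\<lambda>_. smooth_sphere n) I)) (points X)
        (points (coproduct_diffeology (\<lambda>_. smooth_disk (Suc n)) I)) h (\<lambda>x. x) (points X') (\<lambda>x. x) \<Phi>"
      by (simp add: pX')
  qed (simp add: pX', simp add: X'_def)
  interpret N: smooth_attachment n I X X' h \<Phi>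
    by unfold_locales (rule X h_smooth push)+
  have pA': "points X' = topspace A'"
  proof -
    have "I \<times> ?D = I \<times> ?S \<union> I \<times> (?D - ?S)" using SD by blast
    then have split: "g ` (I \<times> ?D) = g ` (I \<times> ?S) \<union> g ` (I \<times> (?D - ?S))" for g :: "'i \<times> (nat \<Rightarrow> real) \<Rightarrow> 'a"
      by (simp only: image_Un)
    have int: "\<Phi> ` (I \<times> (?D - ?S)) = \<phi> ` (I \<times> (?D - ?S))"
      by (rule image_cong[OF refl \<Phi>int])
    have bd: "\<Phi> ` (I \<times> ?S) \<subseteq> points X" "\<phi> ` (I \<times> ?S) \<subseteq> points X"
      using hX A.attach_in by (auto simp: \<Phi>_def pts)
    have "topspace A' = points X \<union> \<phi> ` (I \<times> ?D)"
      using A.topspace_Z pts by simp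
    then show ?thesis
      unfolding pX' split int Un_assoc[symmetric] Un_absorb2[OF bd(1)] Un_absorb2[OF bd(2)] by simp
  qed
  define J where "J = prod_topology unit_interval (disk_topology (Suc n))"
  have tJ: "topspace J = {0..1} \<times> ?D" by (simp add: J_def)
  \<comment> \<open>Interior points keep their height in \<open>topspace A' \<times> {0..1}\<close>,
    and the wall follows the homotopy \<open>k\<close>. At heights 0 and 1 the wall agrees with
    \<open>\<phi>\<close> and with \<open>h\<close>, as the two uses of
    \<open>deforms_onto_end_attach\<close> require.\<close>
  define \<Psi> where "\<Psi> c = (if snd (snd c) \<in> ?S then k (fst c) (snd c) else (\<phi> (fst c, snd (snd c)), fst (snd c)))" for c
  have \<Psi>_int: "\<Psi> (\<alpha>, s, x) = (\<phi> (\<alpha>, x), s)" if "x \<notin> ?S" for \<alpha> s x using that by (simp add: \<Psi>_def)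
  have \<Psi>_bd: "\<Psi> (\<alpha>, s, x) = k \<alpha> (s, x)" if "x \<in> ?S" for \<alpha> s x using that by (simp add: \<Psi>_def)
  have kZ: "k \<alpha> (s, x) \<in> topspace Z" if "\<alpha> \<in> I" "s \<in> {0..1}" "x \<in> ?S" for \<alpha> s x
    using kc[OF that(1)] that by (auto simp: continuous_map_def)
  have closedS: "closedin (disk_topology (Suc n)) ?S" by (rule A.boundary_closed)
  have "closedin J ({0..1} \<times> ?S)"
    unfolding J_def closedin_prod_Times_iff using closedS by auto
  moreover have "topspace A' \<times> {0..1} = topspace Z \<union> \<Psi> ` (I \<times> topspace J)"
  proof (intro equalityI subsetI)
    fix z assume z: "z \<in> topspace A' \<times> {0..1::real}"
    then have "fst z \<in> topspace A'" by auto
    then show "z \<in> topspace Z \<union> \<Psi> ` (I \<times> topspace J)"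
    proof (cases rule: A.cell_cases)
      case 1
      then show ?thesis using z by (auto simp: tZ)
    next
      case (2 \<alpha> x)
      then have "z = \<Psi> (\<alpha>, snd z, x)" by (simp add: \<Psi>_int prod_eq_iff)
      moreover have "(\<alpha>, snd z, x) \<in> I \<times> topspace J" using 2 z by (auto simp: tJ)
      ultimately show ?thesis by blast
    qed
  next
    fix z assume "z \<in> topspace Z \<union> \<Psi> ` (I \<times> topspace J)"
    then consider "z \<in> topspace Z" | \<alpha> s x where "\<alpha> \<in> I" "s \<in> {0..1}" "x \<in> ?D" "z = \<Psi> (\<alpha>, s, x)"
      by (auto simp: tJ)
    then show "z \<in> topspace A' \<times> {0..1}"
    proof cases
      case 1
      then show ?thesis using A.A_subset by (auto simp: tZ)
    next
      case 2
      then show ?thesis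
        using kZ[of \<alpha> s x] A.cell_in[of \<alpha> x] A.A_subset by (cases "x \<in> ?S") (auto simp: \<Psi>_int \<Psi>_bd tZ)
    qed
  qed
  moreover have "continuous_map (subtopology J ({0..1} \<times> ?S)) Z (\<lambda>c. \<Psi> (\<alpha>, c))" if "\<alpha> \<in> I" for \<alpha>
  proof -
    have eq: "subtopology J ({0..1} \<times> ?S) = prod_topology unit_interval (nsphere n)"
    proof -
      have "subtopology unit_interval {0..1} = unit_interval" by (simp add: subtopology_subtopology)
      then show ?thesis unfolding J_def subtopology_Times by (simp only: nsphere_eq[symmetric])
    qed
    show ?thesis
      unfolding eq by (rule continuous_map_eq[OF kc[OF that]]) (auto simp: \<Psi>_bd)
  qed
  moreover have "inj_on \<Psi> (I \<times> (topspace J - {0..1} \<times> ?S))"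
  proof (rule inj_onI)
    fix c c' assume c: "c \<in> I \<times> (topspace J - {0..1} \<times> ?S)" "c' \<in> I \<times> (topspace J - {0..1} \<times> ?S)" "\<Psi> c = \<Psi> c'"
    obtain \<alpha> s x \<beta> t y where cc: "c = (\<alpha>, s, x)" "c' = (\<beta>, t, y)" by (metis prod.collapse)
    then have *: "(\<alpha>, x) \<in> I \<times> (topspace (disk_topology (Suc n)) - ?S)" "(\<beta>, y) \<in> I \<times> (topspace (disk_topology (Suc n)) - ?S)"
      using c by (auto simp: tJ)
    then have "\<phi> (\<alpha>, x) = \<phi> (\<beta>, y)" "s = t" using c(3) cc by (auto simp: \<Psi>_int)
    then show "c = c'" using inj_onD[OF A.inj _ *] cc by auto
  qed
  moreover have "\<Psi> ` (I \<times> (topspace J - {0..1} \<times> ?S)) \<inter> topspace Z = {}"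
  proof -
    have "\<Psi> (\<alpha>, s, x) \<notin> topspace Z" if "\<alpha> \<in> I" "(s, x) \<in> topspace J - {0..1} \<times> ?S" for \<alpha> s x
    proof -
      have "x \<in> ?D" "x \<notin> ?S" using that by (auto simp: tJ)
      then show ?thesis using A.interior_notin[OF that(1), of x] by (simp add: \<Psi>_int tZ)
    qed
    moreover have "\<exists>\<alpha> s x. c = (\<alpha>, s, x) \<and> \<alpha> \<in> I \<and> (s, x) \<in> topspace J - {0..1} \<times> ?S"
      if "c \<in> I \<times> (topspace J - {0..1} \<times> ?S)" for c
      using that by (cases c rule: prod_cases3) blast
    ultimately show ?thesis by blast
  qed
  ultimately have "cell_attachment Z (attach_topology Z (topspace A' \<times> {0..1}) J I \<Psi>) J ({0..1} \<times> ?S) I \<Psi> \<and>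
      topspace (attach_topology Z (topspace A' \<times> {0..1}) J I \<Psi>) = topspace A' \<times> {0..1}"
    by (rule cell_attachment_attach_topology)
  then have Z': "cell_attachment Z (attach_topology Z (topspace A' \<times> {0..1}) J I \<Psi>) J ({0..1} \<times> ?S) I \<Psi>"
    "topspace (attach_topology Z (topspace A' \<times> {0..1}) J I \<Psi>) = topspace A' \<times> {0..1}"
    by blast+
  define Z' where "Z' = attach_topology Z (topspace A' \<times> {0..1}) J I \<Psi>"
  obtain R0' where R0': "deforms_onto_end A' Z' 0 R0'" "\<And>t z. z \<in> topspace Z \<Longrightarrow> R0' (t, z) = R0 (t, z)"
    by (rule deforms_onto_end_attach[OF att Z'(1)[folded Z'_def, unfolded J_def] _ _ _ d0])
       (auto simp: \<Psi>_int \<Psi>_bd k0)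
  obtain R1' where R1': "deforms_onto_end (D_topology X') Z' 1 R1'" "\<And>t z. z \<in> topspace Z \<Longrightarrow> R1' (t, z) = R1 (t, z)"
    by (rule deforms_onto_end_attach[OF N.cell_attachment_axioms Z'(1)[folded Z'_def, unfolded J_def] _ _ _ d1])
       (auto simp: \<Psi>_int \<Psi>_bd k1 \<Phi>_def)
  show ?thesis
    using N.X'_diffeological pA' N.smoothable_attach[OF sm] Z'(2)[folded Z'_def] R0' R1' h_smooth push by blast
qed

section \<open>Assembling the skeleta and comparing the two unions\<close>

theorem theorem2p4:
  fixes Y :: "'a topology"
  assumes "CW_complex TYPE('i) Y"
  shows "\<exists>X :: 'a diffeology.
           smooth_CW_complex TYPE('i) X \<and> NG_homotopy_equivalent Y (D_topology X)"
proof -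
  obtain Ys :: "nat \<Rightarrow> 'a topology" and I :: "nat \<Rightarrow> 'i set" and h \<Phi> where
    discrete: "Ys 0 = discrete_topology (topspace (Ys 0))"
    and push: "\<And>n. continuous_map (sum_topology (\<lambda>_. nsphere n) (I n)) (Ys n) (h n) \<and>
             topological_pushout
               (sum_topology (\<lambda>_. nsphere n) (I n))
               (Ys n)
               (sum_topology (\<lambda>_. subtopology (Euclidean_space (Suc n)) (unit_disk (Suc n))) (I n))
               (h n) (\<lambda>x. x) (Ys (Suc n)) (\<lambda>x. x) (\<Phi> n)"
    and tY: "topspace Y = (\<Union>n. topspace (Ys n))"
    and oY: "\<And>W. openin Y W \<longleftrightarrow> W \<subseteq> topspace Y \<and> (\<forall>n. openin (Ys n) {y \<in> topspace (Ys n). y \<in> W})"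
    using assms unfolding CW_complex_def by blast
  have att: "cell_attachment (Ys n) (Ys (Suc n)) (disk_topology (Suc n)) (topspace (nsphere n)) (I n) (\<Phi> n)" for n
    using push by (intro topological_pushout_imp_cell_attachment[of n "I n" "Ys n" "h n"]) blast+
  have Y: "union_space Ys Y"
  proof
    have "{y \<in> topspace (Ys n). y \<in> W} = W \<inter> topspace (Ys n)" for n W by blast
    then show "openin Y W \<longleftrightarrow> W \<subseteq> (\<Union>n. topspace (Ys n)) \<and> (\<forall>n. openin (Ys n) (W \<inter> topspace (Ys n)))" for W
      using oY tY by simp
  qed
  \<comment> \<open>The deformations belong to the chosen data, rather than being existentially
    quantified, because those of the next stage have to extend these very maps.\<close>
  define Inv where "Inv n s \<longleftrightarrow> (case s of (X, Z, R0, R1) \<Rightarrow>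
      diffeological_space X \<and> points X = topspace (Ys n) \<and> smoothable X \<and>
      topspace Z = topspace (Ys n) \<times> {0..1} \<and>
      deforms_onto_end (Ys n) Z 0 R0 \<and> deforms_onto_end (D_topology X) Z 1 R1)"
    for n and s :: "'a diffeology \<times> ('a \<times> real) topology \<times> (real \<times> 'a \<times> real \<Rightarrow> 'a \<times> real) \<times> (real \<times> 'a \<times> real \<Rightarrow> 'a \<times> real)"
  define Step where "Step n s s' \<longleftrightarrow> (case s of (X, Z, R0, R1) \<Rightarrow> case s' of (X', Z', R0', R1') \<Rightarrow>
      (\<exists>h \<Phi>. smooth_map (coproduct_diffeology (\<lambda>_. smooth_sphere n) (I n)) X h \<and>
        diffeological_pushout (coproduct_diffeology (\<lambda>_. smooth_sphere n) (I n)) X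
          (coproduct_diffeology (\<lambda>_. smooth_disk (Suc n)) (I n)) h (\<lambda>x. x) X' (\<lambda>x. x) \<Phi>) \<and>
      (\<forall>t. \<forall>z\<in>topspace Z. R0' (t, z) = R0 (t, z) \<and> R1' (t, z) = R1 (t, z)))"
    for n and s s' :: "'a diffeology \<times> ('a \<times> real) topology \<times> (real \<times> 'a \<times> real \<Rightarrow> 'a \<times> real) \<times> (real \<times> 'a \<times> real \<Rightarrow> 'a \<times> real)"
  define X0 where "X0 = discrete_diffeology (topspace (Ys 0))"
  have DX0: "D_topology X0 = Ys 0"
    using discrete by (simp add: X0_def D_topology_discrete)
  obtain R00 where R00: "deforms_onto_end (Ys 0) (prod_topology (Ys 0) unit_interval) 0 R00"
    using deforms_onto_end_cylinder[of 0 "Ys 0"] by auto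
  obtain R10 where R10: "deforms_onto_end (Ys 0) (prod_topology (Ys 0) unit_interval) 1 R10"
    using deforms_onto_end_cylinder[of 1 "Ys 0"] by auto
  have base: "Inv 0 s \<and> fst s = X0" if "s = (X0, prod_topology (Ys 0) unit_interval, R00, R10)" for s
    using R00 R10 that
    by (simp add: Inv_def DX0) (simp add: X0_def diffeological_space_discrete smoothable_discrete)
  have step: "\<exists>s'. Inv (Suc n) s' \<and> Step n s s'" if "Inv n s" for n s
  proof -
    obtain X Z R0 R1 where s: "s = (X, Z, R0, R1)" by (metis prod.collapse)
    have inv: "diffeological_space X" "points X = topspace (Ys n)" "smoothable X" "topspace Z = topspace (Ys n) \<times> {0..1}"
        "deforms_onto_end (Ys n) Z 0 R0" "deforms_onto_end (D_topology X) Z 1 R1"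
      using that by (simp_all add: Inv_def s)
    obtain X' Z' R0' R1' h' \<Phi>' where *: "diffeological_space X'" "points X' = topspace (Ys (Suc n))" "smoothable X'"
      "topspace Z' = topspace (Ys (Suc n)) \<times> {0..1}"
      "deforms_onto_end (Ys (Suc n)) Z' 0 R0'" "deforms_onto_end (D_topology X') Z' 1 R1'"
      "smooth_map (coproduct_diffeology (\<lambda>_. smooth_sphere n) (I n)) X h'"
      "diffeological_pushout (coproduct_diffeology (\<lambda>_. smooth_sphere n) (I n)) X
        (coproduct_diffeology (\<lambda>_. smooth_disk (Suc n)) (I n)) h' (\<lambda>x. x) X' (\<lambda>x. x) \<Phi>'"
      "\<forall>t. \<forall>z\<in>topspace Z. R0' (t, z) = R0 (t, z) \<and> R1' (t, z) = R1 (t, z)"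
      using smooth_model_attach[OF att inv] by (elim exE conjE)
    have "Inv (Suc n) (X', Z', R0', R1')" using *(1-6) by (simp add: Inv_def)
    moreover have "Step n s (X', Z', R0', R1')" using *(7-9) unfolding Step_def s by auto
    ultimately show ?thesis by blast
  qed
  \<comment> \<open>The equation at \<open>n = 0\<close> records that the sequence starts with the
    discrete diffeology, which the definition of a smooth CW complex asks for.\<close>
  have "\<exists>f. \<forall>n. (Inv n (f n) \<and> (n = 0 \<longrightarrow> fst (f n) = X0)) \<and> Step n (f n) (f (Suc n))"
  proof (rule dependent_nat_choice)
    show "\<exists>s. Inv 0 s \<and> (0 = (0::nat) \<longrightarrow> fst s = X0)" using base by blast
    show "\<exists>s'. (Inv (Suc n) s' \<and> (Suc n = 0 \<longrightarrow> fst s' = X0)) \<and> Step n s s'"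
      if "Inv n s \<and> (n = 0 \<longrightarrow> fst s = X0)" for s n
      using step that by simp
  qed
  then obtain f where f: "\<And>n. Inv n (f n)" "fst (f 0) = X0" "\<And>n. Step n (f n) (f (Suc n))"
    by blast
  define Xs Zs R0 R1 where "Xs n = fst (f n)" and "Zs n = fst (snd (f n))"
    and "R0 n = fst (snd (snd (f n)))" and "R1 n = snd (snd (snd (f n)))" for n
  have inv: "diffeological_space (Xs n)" "points (Xs n) = topspace (Ys n)" "topspace (Zs n) = topspace (Ys n) \<times> {0..1}"
      "deforms_onto_end (Ys n) (Zs n) 0 (R0 n)" "deforms_onto_end (D_topology (Xs n)) (Zs n) 1 (R1 n)" for n
    using f(1)[of n] by (simp_all add: Inv_def Xs_def Zs_def R0_def R1_def split_beta)
  have stp: "\<exists>h \<Phi>. smooth_map (coproduct_diffeology (\<lambda>_. smooth_sphere n) (I n)) (Xs n) h \<and>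
        diffeological_pushout (coproduct_diffeology (\<lambda>_. smooth_sphere n) (I n)) (Xs n)
          (coproduct_diffeology (\<lambda>_. smooth_disk (Suc n)) (I n)) h (\<lambda>x. x) (Xs (Suc n)) (\<lambda>x. x) \<Phi>"
      "\<And>t z. z \<in> topspace (Zs n) \<Longrightarrow> R0 (Suc n) (t, z) = R0 n (t, z)"
      "\<And>t z. z \<in> topspace (Zs n) \<Longrightarrow> R1 (Suc n) (t, z) = R1 n (t, z)" for n
    using f(3)[of n] by (simp_all add: Step_def Xs_def Zs_def R0_def R1_def split_beta)
  define X where "X = union_diffeology Xs"
  have wf: "openin (Euclidean_space m) V \<and> Q \<in> V \<rightarrow> (\<Union>k. points (Xs k))"
    if "(m, V, Q) \<in> {(n, U, P) | n U P. \<exists>k. plot (Xs k) n U P}" for m V Q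
    using that plot_openin[OF inv(1)] plot_funcset[OF inv(1)] by fastforce
  have X_diff: "diffeological_space X"
    unfolding X_def union_diffeology_def by (rule diffeological_space_generated)
  \<comment> \<open>By \<open>openin_D_generated\<close> the plots of the skeleta suffice to test
    openness, so the D-topology of the union is the final topology over the skeleta.\<close>
  have DX: "union_space (\<lambda>n. D_topology (Xs n)) (D_topology X)"
  proof
    fix W
    have eq: "{u \<in> U. P u \<in> W \<inter> points (Xs k)} = {u \<in> U. P u \<in> W}" if "plot (Xs k) m U P" for k m U P
      using plot_funcset[OF inv(1) that] by auto
    have "openin (D_topology X) W \<longleftrightarrow> W \<subseteq> (\<Union>k. points (Xs k)) \<and>
        (\<forall>m V Q. (m, V, Q) \<in> {(n, U, P) | n U P. \<exists>k. plot (Xs k) n U P} \<longrightarrow> openin (Euclidean_space m) {v \<in> V. Q v \<in> W})"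
      unfolding X_def union_diffeology_def by (rule openin_D_generated) (rule wf)
    also have "\<dots> \<longleftrightarrow> W \<subseteq> (\<Union>k. points (Xs k)) \<and>
        (\<forall>k m U P. plot (Xs k) m U P \<longrightarrow> openin (Euclidean_space m) {u \<in> U. P u \<in> W \<inter> points (Xs k)})"
    proof -
      have "(\<forall>m V Q. (m, V, Q) \<in> {(n, U, P) | n U P. \<exists>k. plot (Xs k) n U P} \<longrightarrow> openin (Euclidean_space m) {v \<in> V. Q v \<in> W})
        \<longleftrightarrow> (\<forall>k m U P. plot (Xs k) m U P \<longrightarrow> openin (Euclidean_space m) {u \<in> U. P u \<in> W})" by blast
      also have "\<dots> \<longleftrightarrow> (\<forall>k m U P. plot (Xs k) m U P \<longrightarrow> openin (Euclidean_space m) {u \<in> U. P u \<in> W \<inter> points (Xs k)})"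
        by (intro all_cong1 imp_cong refl) (simp only: eq)
      finally show ?thesis by (rule arg_cong)
    qed
    also have "\<dots> \<longleftrightarrow> W \<subseteq> (\<Union>n. topspace (D_topology (Xs n))) \<and>
        (\<forall>n. openin (D_topology (Xs n)) (W \<inter> topspace (D_topology (Xs n))))"
      using inv(1) openin_D_topology[OF inv(1)] by (simp only: topspace_D_topology) blast
    finally show "openin (D_topology X) W \<longleftrightarrow> W \<subseteq> (\<Union>n. topspace (D_topology (Xs n))) \<and>
        (\<forall>n. openin (D_topology (Xs n)) (W \<inter> topspace (D_topology (Xs n))))" .
  qed
  have Zmono: "topspace (Zs n) \<subseteq> topspace (Zs (Suc n))" for n
    using cell_attachment.A_subset[OF att[of n]] by (auto simp: inv)
  have "Y homotopy_equivalent_space union_topology Zs"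
    using union_homotopy_equivalent[OF Y union_space_union_topology inv(4) Zmono stp(2)] .
  moreover have "D_topology X homotopy_equivalent_space union_topology Zs"
    using union_homotopy_equivalent[OF DX union_space_union_topology inv(5) Zmono stp(3)] .
  ultimately have "Y homotopy_equivalent_space D_topology X"
    using homotopy_equivalent_space_sym homotopy_eqv_trans by blast
  then have "NG_homotopy_equivalent Y (D_topology X)"
    unfolding NG_homotopy_equivalent_def
    using numerically_generated_union[OF Y discrete att] numerically_generated_D_topology[OF X_diff] by blast
  moreover have "smooth_CW_complex TYPE('i) X"
  proof -
    have "\<forall>n. \<exists>q. smooth_map (coproduct_diffeology (\<lambda>_. smooth_sphere n) (I n)) (Xs n) (fst q) \<and>
        diffeological_pushout (coproduct_diffeology (\<lambda>_. smooth_sphere n) (I n)) (Xs n)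
          (coproduct_diffeology (\<lambda>_. smooth_disk (Suc n)) (I n)) (fst q) (\<lambda>x. x) (Xs (Suc n)) (\<lambda>x. x) (snd q)"
      using stp(1) by simp
    then obtain q where "\<forall>n. smooth_map (coproduct_diffeology (\<lambda>_. smooth_sphere n) (I n)) (Xs n) (fst (q n)) \<and>
        diffeological_pushout (coproduct_diffeology (\<lambda>_. smooth_sphere n) (I n)) (Xs n)
          (coproduct_diffeology (\<lambda>_. smooth_disk (Suc n)) (I n)) (fst (q n)) (\<lambda>x. x) (Xs (Suc n)) (\<lambda>x. x) (snd (q n))"
      by (rule choice[THEN exE])
    moreover have "Xs 0 = discrete_diffeology (points (Xs 0))"
      using f(2) by (simp add: Xs_def X0_def)
    ultimately show ?thesis
      unfolding smooth_CW_complex_def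
      by (intro exI[of _ Xs] exI[of _ I] exI[of _ "\<lambda>n. fst (q n)"] exI[of _ "\<lambda>n. snd (q n)"]) (simp add: X_def)
  qed
  ultimately show ?thesis by blast
qed

end
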